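(* Let $\gamma>0$ and let $Q$ be a quantile function with $Q(1-s)=s^{-\gamma}\ell(s)$, $s\in(0,1)$, where $\ell$ is slowly varying at $0$. Let $(k_n)$ be a sequence of integers with $1\le k_n\le n$, $k_n\to\infty$, $k_n/n\to0$, and let $p_n=\alpha^{-1}\log k_n$ for a constant $\alpha>0$. (i) If $\alpha>1$, then $$\left(\frac{S_n(p_n)}{\Gamma(p_n+1)}\right)^{1/p_n}\longrightarrow\gamma\quad\text{in probability.}$$ (ii) If $\alpha>2$, then $$\frac{\sqrt{k_n}\,m_{p_n}(U_{k_n+1,n})}{\sigma_{p_n}(U_{k_n+1,n})}\,p_n\left[\left(\frac{S_n(p_n)}{m_{p_n}(U_{k_n+1,n})}\right)^{1/p_n}-1\right]\stackrel{\mathcal D}{\longrightarrow}N(0,1).$$ (iii) Suppose $\alpha>2$ and that there is a function $a$ regularly varying at $0$ such that $$\limsup_{v\downarrow0}\ \sup_{u\in(0,1]}\frac{|\ell(uv)-\ell(v)|}{a(v)}<\infty,\quad \lim_{v\downarrow0}\frac{a(v)}{\ell(v)}=0,\quad p_n\frac{a(k_n/n)}{\ell(k_n/n)}\to0,$$ $$\limsup_{n\to\infty}\ p_n^{-1}\log\left(\sqrt{k_n}\,\frac{a(k_n/n)}{\ell(k_n/n)}\right)<\log2 .$$ Then $$\frac{\sqrt{k_n}\,m_{p_n}}{\sigma_{p_n}}\,p_n\left[\left(\frac{S_n(p_n)}{m_{p_n}}\right)^{1/p_n}-1\right]\stackrel{\mathcal D}{\longrightarrow}N(0,1).$$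
   Context: $Q(s)=\inf\{x:F(x)\ge s\}$, $s\in(0,1)$, is the quantile function of a distribution function $F$. $U_1,U_2,\ldots$ are iid uniform$(0,1)$ and $U_{1,n}\le\ldots\le U_{n,n}$ are the order statistics of $U_1,\ldots,U_n$. The order statistics of an iid sample from $F$ are represented as $X_{n+1-i,n}=Q(1-U_{i,n})$, so that $$S_n(p)=\frac1{k_n}\sum_{i=1}^{k_n}\left(\log\frac{X_{n+1-i,n}}{X_{n-k_n,n}}\right)^p=\frac1{k_n}\sum_{i=1}^{k_n}\left(\log\frac{Q(1-U_{i,n})}{Q(1-U_{k_n+1,n})}\right)^p .$$ For small $v>0$ (so that $Q(1-v)>0$) let $Y(v)=\log\frac{Q(1-Uv)}{Q(1-v)}$ with $U$ uniform$(0,1)$, and for $p>0$ let $m_p(v)=\mathbb E\,Y(v)^p$, $\sigma_p^2(v)=\mathbf{Var}(Y(v)^p)$, $\sigma_p(v)=\sqrt{\sigma_p^2(v)}$; $m_p(U_{k_n+1,n})$ and $\sigma_p(U_{k_n+1,n})$ are these functions evaluated at the random point $U_{k_n+1,n}$ (which tends to $0$ in probability). The deterministic quantities are $m_p=\gamma^p\Gamma(p+1)$ and $\sigma_p^2=\gamma^{2p}\left(\Gamma(2p+1)-\Gamma(p+1)^2\right)$, $\sigma_p>0$. All quantities are considered for $n$ large. A positive measurable function $a$ on a right neighbourhood of $0$ is regularly varying at $0$ if for some $\rho\in\mathbb R$, $a(uv)/a(v)\to u^\rho$ as $v\downarrow0$ for each $u>0$; slowly varying means $\rho=0$. $\stackrel{\mathcal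 D}{\to}$ is convergence in distribution. *)

theory Defs
  imports "HOL-Probability.Probability"
begin

definition quantile :: "(real \<Rightarrow> real) \<Rightarrow> real \<Rightarrow> real" where
  "quantile F s = Inf {x. s \<le> F x}"

definition regularly_varying_at_0 :: "(real \<Rightarrow> real) \<Rightarrow> real \<Rightarrow> bool" where
  "regularly_varying_at_0 a \<rho> \<longleftrightarrow>
     (\<exists>\<delta>>0. (\<forall>v\<in>{0<..<\<delta>}. 0 < a v) \<and> a \<in> borel_measurable (restrict_space borel {0<..<\<delta>})) \<and>
     (\<forall>u>0. ((\<lambda>v. a (u * v) / a v) \<longlongrightarrow> u powr \<rho>) (at_right 0))"

abbreviation slowly_varying_at_0 :: "(real \<Rightarrow> real) \<Rightarrow> bool" where
  "slowly_varying_at_0 a \<equiv> regularly_varying_at_0 a 0"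

abbreviation uniform01 :: "real measure" where
  "uniform01 \<equiv> uniform_measure lborel {0<..<1}"

text \<open>The \<open>i\<close>-th smallest of \<open>U 1, \<dots>, U n\<close>, meaningful for \<open>1 \<le> i \<le> n\<close>.\<close>

definition order_stat :: "(nat \<Rightarrow> 'a \<Rightarrow> real) \<Rightarrow> nat \<Rightarrow> nat \<Rightarrow> 'a \<Rightarrow> real" where
  "order_stat U n i \<omega> = sort (map (\<lambda>j. U j \<omega>) [1..<Suc n]) ! (i - 1)"

text \<open>\<open>S_stat Q U k n p\<close> is \<open>S\<^sub>n(p)\<close> for \<open>k = k\<^sub>n\<close>, with the upper order statistics of the sample
  represented as \<open>Q (1 - order_stat U n i \<omega>)\<close>.\<close>

definition S_stat ::
  "(real \<Rightarrow> real) \<Rightarrow> (nat \<Rightarrow> 'a \<Rightarrow> real) \<Rightarrow> nat \<Rightarrow> nat \<Rightarrow> real \<Rightarrow> 'a \<Rightarrow> real" where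
  "S_stat Q U k n p \<omega> =
     1 / real k * (\<Sum>i=1..k.
       ln (Q (1 - order_stat U n i \<omega>) / Q (1 - order_stat U n (k + 1) \<omega>)) powr p)"

text \<open>\<open>Y_var Q v\<close> is \<open>Y(v)\<close>, a random variable on the space \<open>uniform01\<close>; the argument \<open>u\<close> is the
  outcome of the uniform variable.\<close>

definition Y_var :: "(real \<Rightarrow> real) \<Rightarrow> real \<Rightarrow> real \<Rightarrow> real" where
  "Y_var Q v u = ln (Q (1 - u * v) / Q (1 - v))"

definition m_fun :: "(real \<Rightarrow> real) \<Rightarrow> real \<Rightarrow> real \<Rightarrow> real" where
  "m_fun Q p v = prob_space.expectation uniform01 (\<lambda>u. Y_var Q v u powr p)"

definition sigma_fun :: "(real \<Rightarrow> real) \<Rightarrow> real \<Rightarrow> real \<Rightarrow> real" where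
  "sigma_fun Q p v = sqrt (prob_space.variance uniform01 (\<lambda>u. Y_var Q v u powr p))"

definition m_lim :: "real \<Rightarrow> real \<Rightarrow> real" where
  "m_lim \<gamma> p = \<gamma> powr p * Gamma (p + 1)"

definition sigma_lim :: "real \<Rightarrow> real \<Rightarrow> real" where
  "sigma_lim \<gamma> p = sqrt (\<gamma> powr (2 * p) * (Gamma (2 * p + 1) - (Gamma (p + 1))\<^sup>2))"

text \<open>Eventual measurability is part of the definition because \<open>measure\<close> assigns \<open>0\<close> to
  non-measurable sets, which would make the limit hold vacuously. No such clause is needed for
  \<open>converges_in_distribution\<close>: there \<open>distr\<close> of a non-measurable function is the zero measure,
  which prevents convergence to a probability measure.\<close>

definition converges_in_probability ::
  "'a measure \<Rightarrow> (nat \<Rightarrow> 'a \<Rightarrow> real) \<Rightarrow> real \<Rightarrow> bool" where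
  "converges_in_probability M X c \<longleftrightarrow>
     (\<forall>\<^sub>F n in sequentially. X n \<in> borel_measurable M) \<and>
     (\<forall>\<epsilon>>0. (\<lambda>n. measure M {\<omega> \<in> space M. \<bar>X n \<omega> - c\<bar> > \<epsilon>}) \<longlonglongrightarrow> 0)"

definition converges_in_distribution ::
  "'a measure \<Rightarrow> (nat \<Rightarrow> 'a \<Rightarrow> real) \<Rightarrow> real measure \<Rightarrow> bool" where
  "converges_in_distribution M X N \<longleftrightarrow> weak_conv_m (\<lambda>n. distr M borel (X n)) N"

end

theory Submission
  imports Defs
begin

text \<open>
  Given \<open>U\<^bsub>k+1,n\<^esub> = v\<close>, the ratios \<open>U\<^bsub>i,n\<^esub> / v\<close> with \<open>i \<le> k\<close> are the order statistics of \<open>k\<close> independent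
  uniform variables, so \<open>S\<^sub>n(p)\<close> is distributed as an average of \<open>k\<close> independent copies of \<open>Y(v)\<^sup>p\<close>.
  Since \<open>U\<^bsub>k+1,n\<^esub> < 2k/n\<close> with probability tending to one, it suffices to prove each limit for averages with
  an arbitrary deterministic sequence \<open>0 < v\<^sub>n < 2k\<^sub>n/n\<close>.

  With \<open>E = - ln u\<close>, a standard exponential variable, Potter bounds give
  \<open>(\<gamma> - \<epsilon>) (E - ln 2) \<le> Y(v) \<le> (\<gamma> + \<epsilon>) (E + ln 2)\<close>, hence \<open>E Y(v)\<^bsup>cp\<^esup>\<close> equals \<open>\<gamma>\<^bsup>cp\<^esup> \<Gamma>(cp + 1)\<close> up to a
  factor \<open>exp (o(p))\<close>, and \<open>E Y(v)\<^bsup>cp\<^esup> / (E Y(v)\<^sup>p)\<^sup>c = exp (p (c ln c + o(1)))\<close>. As \<open>k = exp (\<alpha>p)\<close> and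
  \<open>c ln c < \<alpha> (c - 1)\<close> for some \<open>c > 1\<close> exactly when \<open>\<alpha> > 1\<close>, a truncated weak law holds for \<open>\<alpha> > 1\<close>, and with
  \<open>2p\<close> in place of \<open>p\<close> Lyapunov's condition holds for \<open>\<alpha> > 2\<close>. The power \<open>1/p\<close> is monotone, so the events
  in (ii) and (iii) are events \<open>S\<^sub>n \<le> s\<^sub>n\<close> and only the limit of the standardised thresholds is needed.
\<close>

section \<open>Order statistics\<close>

text \<open>The exponent grows like ln k. A relative error 1 + \<epsilon> in Y(v) therefore becomes
  a factor exp(\<epsilon>p), a small power of k, whereas an additive error b in E costs only
  exp(\<plusminus>b), whatever the exponent. Slow variation thus controls moments on the exponential
  scale only. This is enough for (i) and (ii) because the conditions on \<alpha> are strict: c ln c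
  is convex with slope 1 at c = 1, so the line \<alpha>(c - 1) lies above it just to the right of 1
  once \<alpha> > 1. The price is that moments of order slightly above 1 and 2 take the place of
  second and third moments. In (i) the power 1/p turns every constant factor into 1, so it suffices
  to locate S between half the mean and an exponentially larger multiple of it. In (iii) the slopes
  in the bounds on Y must both be exactly \<gamma>, leaving only a shift b of the order of a/l. The
  relative bias b has to be small against the relative noise \<sigma>/(m sqrt k). Since c ln c
  equals 2 ln 2 at c = 2, the ratio m/\<sigma> decays like exp(-p ln 2) up to exp(o(p)); this is
  where the bound log 2 on the growth of sqrt k a/l comes from.\<close>

lemma sorted_nth_le_iff:
  fixes ys :: "real list"
  assumes "sorted ys" "i < length ys"
  shows "ys ! i \<le> x \<longleftrightarrow> Suc i \<le> length (filter (\<lambda>y. y \<le> x) ys)"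
  using assms
proof (induction ys arbitrary: i)
  case (Cons y ys)
  show ?case
  proof (cases "y \<le> x")
    case True
    then show ?thesis using Cons by (cases i) auto
  next
    case False
    then have "filter (\<lambda>y. y \<le> x) ys = []"
      using Cons.prems(1) by (auto simp: filter_empty_conv)
    moreover have "y \<le> (y # ys) ! i"
      using Cons.prems by (cases i) auto
    ultimately show ?thesis using False by auto
  qed
qed auto

text \<open>Reduces an order statistic to a count of independent events; its measurability and the
  tail bound \<open>prob_order_stat_ge\<close> both rest on this.\<close>

lemma order_stat_le_iff:
  assumes "1 \<le> i" "i \<le> n"
  shows "order_stat U n i \<omega> \<le> x \<longleftrightarrow> i \<le> card {j\<in>{1..n}. U j \<omega> \<le> x}"
proof -
  let ?ys = "sort (map (\<lambda>j. U j \<omega>) [1..<Suc n])"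
  have "order_stat U n i \<omega> \<le> x \<longleftrightarrow> Suc (i - 1) \<le> length (filter (\<lambda>y. y \<le> x) ?ys)"
    unfolding order_stat_def using assms by (intro sorted_nth_le_iff) auto
  also have "length (filter (\<lambda>y. y \<le> x) ?ys) = length (filter (\<lambda>j. U j \<omega> \<le> x) [1..<Suc n])"
    by (simp add: filter_sort filter_map o_def del: upt_Suc)
  also have "\<dots> = card {j\<in>{1..n}. U j \<omega> \<le> x}"
    by (subst distinct_card[symmetric]) (auto intro!: arg_cong[where f=card] simp del: upt_Suc)
  finally show ?thesis using assms by simp
qed

lemma borel_measurable_order_stat:
  assumes U: "\<And>i. i \<in> {1..n} \<Longrightarrow> U i \<in> borel_measurable M" and i: "1 \<le> i" "i \<le> n"
  shows "order_stat U n i \<in> borel_measurable M"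
proof (subst borel_measurable_iff_le, intro allI)
  fix x
  have "real (card {j\<in>{1..n}. U j \<omega> \<le> x}) = (\<Sum>j\<in>{1..n}. if U j \<omega> \<le> x then 1 else 0)" for \<omega>
    by (subst sum.inter_filter[symmetric]) auto
  then have "{\<omega>\<in>space M. order_stat U n i \<omega> \<le> x} =
    {\<omega>\<in>space M. real i \<le> (\<Sum>j\<in>{1..n}. if U j \<omega> \<le> x then 1 else 0)}"
    unfolding order_stat_le_iff[OF i] of_nat_le_iff[symmetric, where 'a=real] by simp
  also have "\<dots> \<in> sets M"
    using U by measurable
  finally show "{\<omega>\<in>space M. order_stat U n i \<omega> \<le> x} \<in> sets M" .
qed

text \<open>A sorted list is determined by its multiset, so listing the values below, at and above
  \<open>U j\<close> identifies the sorted sample. A sum over the smallest order statistics is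
  symmetric and hence becomes a sum over the unordered set \<open>I\<close>, where independence
  applies.\<close>

lemma order_stat_split:
  assumes j: "j \<in> {1..n}" and I: "I \<subseteq> {1..n} - {j}"
    and below: "\<And>i. i \<in> I \<Longrightarrow> U i \<omega> < U j \<omega>"
    and above: "\<And>i. i \<in> {1..n} - {j} - I \<Longrightarrow> U j \<omega> < U i \<omega>"
  shows "order_stat U n (card I + 1) \<omega> = U j \<omega>"
    and "(\<Sum>i=1..card I. f (order_stat U n i \<omega>)) = (\<Sum>i\<in>I. f (U i \<omega>))"
proof -
  define R where "R = {1..n} - {j} - I"
  define L where "L X = sorted_list_of_multiset (image_mset (\<lambda>i. U i \<omega>) (mset_set X))" for X
  have fin: "finite I" "finite R" using I by (auto simp: R_def finite_subset)
  have mL: "mset (L X) = image_mset (\<lambda>i. U i \<omega>) (mset_set X)" and sL: "sorted (L X)" for X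
    by (auto simp: L_def)
  have setL: "set (L X) = (\<lambda>i. U i \<omega>) ` X" if "finite X" for X
    using that by (simp add: L_def)
  have lenI: "length (L I) = card I"
    using mL[of I] by (metis size_image_mset size_mset size_mset_set)
  have un: "{1..n} = insert j (I \<union> R)" "j \<notin> I" "j \<notin> R" "I \<inter> R = {}"
    using j I by (auto simp: R_def)
  have eq: "sort (map (\<lambda>j. U j \<omega>) [1..<Suc n]) = L I @ U j \<omega> # L R"
  proof (rule properties_for_sort)
    have "mset (L I @ U j \<omega> # L R) = image_mset (\<lambda>i. U i \<omega>) (mset_set {1..n})"
      unfolding un(1) using fin un by (simp add: mL mset_set_Union)
    also have "\<dots> = mset (map (\<lambda>j. U j \<omega>) [1..<Suc n])"
      by (simp del: upt_Suc add: atLeastLessThanSuc_atLeastAtMost)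
    finally show "mset (L I @ U j \<omega> # L R) = mset (map (\<lambda>j. U j \<omega>) [1..<Suc n])" .
    have "x < U j \<omega>" if "x \<in> set (L I)" for x
      using that below unfolding setL[OF fin(1)] by blast
    moreover have "U j \<omega> < x" if "x \<in> set (L R)" for x
      using that above[folded R_def] unfolding setL[OF fin(2)] by blast
    ultimately show "sorted (L I @ U j \<omega> # L R)"
      using sL[of I] sL[of R] by (fastforce simp: sorted_append intro: less_imp_le)
  qed
  show "order_stat U n (card I + 1) \<omega> = U j \<omega>"
    unfolding order_stat_def eq by (simp add: nth_append lenI)
  have "(\<Sum>i=1..card I. f (order_stat U n i \<omega>)) = (\<Sum>i<card I. f (L I ! i))"
    unfolding order_stat_def eq
    by (rule sum.reindex_bij_witness[of _ Suc "\<lambda>i. i - 1"]) (auto simp: nth_append lenI)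
  also have "\<dots> = sum_list (map f (L I))"
    by (simp add: sum_list_sum_nth lenI atLeast0LessThan)
  also have "\<dots> = sum_mset (image_mset f (mset (L I)))"
    by (metis mset_map sum_mset_sum_list)
  also have "\<dots> = (\<Sum>i\<in>I. f (U i \<omega>))"
    by (simp add: mL image_mset.compositionality o_def sum_unfold_sum_mset)
  finally show "(\<Sum>i=1..card I. f (order_stat U n i \<omega>)) = (\<Sum>i\<in>I. f (U i \<omega>))" .
qed

text \<open>The index sought carries the entry at position \<open>k\<close> of the sorted image;
  injectivity makes counting in the image and in \<open>A\<close> agree.\<close>

lemma ex_rank:
  fixes f :: "nat \<Rightarrow> real"
  assumes "finite A" "inj_on f A" "k < card A"
  shows "\<exists>j\<in>A. card {i\<in>A. f i < f j} = k"
proof -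
  let ?xs = "sorted_list_of_set (f ` A)"
  have len: "length ?xs = card A" using assms by (simp add: card_image)
  have "?xs ! k \<in> f ` A" using assms len by (metis finite_imageI nth_mem set_sorted_list_of_set)
  then obtain j where j: "j \<in> A" "f j = ?xs ! k" by auto
  have sd: "sorted_wrt (<) ?xs" by (simp add: strict_sorted_list_of_set)
  have lt: "?xs ! m < ?xs ! k \<longleftrightarrow> m < k" if "m < card A" for m
    using sorted_wrt_nth_less[OF sd] that assms(3) len by (metis linorder_neqE_nat order.asym order.irrefl)
  have "f ` {i\<in>A. f i < f j} = {x\<in>set ?xs. x < ?xs ! k}" using j assms(1) by auto
  also have "\<dots> = (!) ?xs ` {..<k}"
  proof safe
    fix x assume "x \<in> set ?xs" "x < ?xs ! k"
    then show "x \<in> (!) ?xs ` {..<k}" using lt len by (metis imageI in_set_conv_nth lessThan_iff)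
  next
    fix m assume "m < k"
    then show "?xs ! m \<in> set ?xs" "?xs ! m < ?xs ! k"
      using assms(3) len lt[of m] by (auto intro!: nth_mem simp del: set_sorted_list_of_set)
  qed
  finally have "card (f ` {i\<in>A. f i < f j}) = card ((!) ?xs ` {..<k})" by simp
  also have "card (f ` {i\<in>A. f i < f j}) = card {i\<in>A. f i < f j}"
    using assms by (intro card_image) (auto intro: inj_on_subset)
  also have "card ((!) ?xs ` {..<k}) = k"
    using assms(3) len by (subst card_image) (auto intro!: inj_on_nth)
  finally show ?thesis using j by (intro bexI[of _ j]) simp_all
qed

section \<open>Conditioning on an order statistic\<close>

lemma prob_space_uniform01: "prob_space uniform01"
  by (rule prob_space_uniform_measure) auto

lemma ennreal_divide_one: "x / 1 = (x::ennreal)"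
  by (metis ennreal_one_neq_top mult_1_right mult_divide_eq_ennreal one_neq_zero)

lemma emeasure_uniform01: "A \<in> sets borel \<Longrightarrow> emeasure uniform01 A = emeasure lborel ({0<..<1} \<inter> A)"
  by (simp add: ennreal_divide_one)

lemma emeasure_uniform01_less:
  assumes "0 \<le> v" "v \<le> 1" shows "emeasure uniform01 {..<v} = ennreal v"
proof -
  have "{0<..<1} \<inter> {..<v} = {0<..<v}" using assms by auto
  then show ?thesis using assms by (simp add: ennreal_divide_one)
qed

lemma AE_uniform01: "AE u in uniform01. 0 < u \<and> u < 1"
  by (subst AE_uniform_measure) auto

text \<open>Dilation of Lebesgue measure. The bound \<open>v \<le> 1\<close> keeps
  \<open>{0<..<v}\<close> inside the unit interval.\<close>

lemma emeasure_uniform01_scale: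
  assumes v: "0 < v" "v \<le> 1" and A[measurable]: "A \<in> sets borel"
  shows "emeasure uniform01 ({..<v} \<inter> A) = ennreal v * emeasure (distr uniform01 borel ((*) v)) A"
proof -
  have "emeasure uniform01 ({..<v} \<inter> A) = emeasure lborel ({0<..<v} \<inter> A)"
    using v by (subst emeasure_uniform01) (auto intro!: arg_cong[where f="emeasure lborel"])
  also have "\<dots> = (\<integral>\<^sup>+x. indicator ({0<..<v} \<inter> A) x \<partial>lborel)"
    by simp
  also have "\<dots> = ennreal v * (\<integral>\<^sup>+x. indicator ({0<..<v} \<inter> A) (0 + v * x) \<partial>lborel)"
    using v by (subst nn_integral_real_affine[where c=v and t=0]) auto
  also have "(\<integral>\<^sup>+x. indicator ({0<..<v} \<inter> A) (0 + v * x) \<partial>lborel)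
      = (\<integral>\<^sup>+x. indicator ({0<..<1} \<inter> ((*) v -` A)) x \<partial>lborel)"
    using v by (intro nn_integral_cong) (auto simp: indicator_def zero_less_mult_iff)
  also have "\<dots> = emeasure uniform01 ((*) v -` A)"
    using measurable_sets[of "(*) v" borel borel A] by (subst emeasure_uniform01) auto
  also have "\<dots> = emeasure (distr uniform01 borel ((*) v)) A"
    by (subst emeasure_distr) auto
  finally show ?thesis .
qed

text \<open>Given that all coordinates fall below \<open>v\<close>, they are again independent and
  uniform on the shorter interval. Rectangles suffice, and on these each coordinate contributes one
  factor \<open>v\<close>, which the normalisation cancels.\<close>

lemma uniform_measure_PiM_uniform01:
  assumes v: "0 < v" "v \<le> 1" and I: "finite I"
  shows "uniform_measure (PiM I (\<lambda>_. uniform01)) (Pi\<^sub>E I (\<lambda>_. {..<v})) =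
    distr (PiM I (\<lambda>_. uniform01)) (PiM I (\<lambda>_. borel)) (compose I ((*) v))"
proof -
  let ?\<nu> = "distr uniform01 borel ((*) v)" and ?P = "PiM I (\<lambda>_. uniform01)"
  let ?B = "Pi\<^sub>E I (\<lambda>_. {..<v})"
  interpret u: prob_space uniform01 by (rule prob_space_uniform01)
  have \<nu>: "prob_space ?\<nu>" by (rule u.prob_space_distr) auto
  interpret P: product_prob_space "\<lambda>_. uniform01" I by standard
  interpret N: product_sigma_finite "\<lambda>_. ?\<nu>"
    using prob_space_imp_sigma_finite[OF \<nu>] by (simp add: product_sigma_finite_def)
  have PB: "emeasure ?P (Pi\<^sub>E I A) = (\<Prod>i\<in>I. emeasure uniform01 (A i))" if "\<And>i. i \<in> I \<Longrightarrow> A i \<in> sets borel" for A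
    using that by (intro P.emeasure_PiM I) auto
  have B: "?B \<in> sets ?P" by (intro sets_PiM_I_finite I) auto
  have "uniform_measure ?P ?B = PiM I (\<lambda>_. ?\<nu>)"
  proof (rule N.PiM_eqI[OF I])
    show "sets (uniform_measure ?P ?B) = sets (PiM I (\<lambda>_. ?\<nu>))"
      by (simp cong: sets_PiM_cong)
    fix A assume "\<And>i. i \<in> I \<Longrightarrow> A i \<in> sets ?\<nu>"
    then have A: "\<And>i. i \<in> I \<Longrightarrow> A i \<in> sets borel" by simp
    have "Pi\<^sub>E I A \<in> sets ?P" using A by (intro sets_PiM_I_finite I) auto
    then have "emeasure (uniform_measure ?P ?B) (Pi\<^sub>E I A) = emeasure ?P (?B \<inter> Pi\<^sub>E I A) / emeasure ?P ?B"
      using B by simp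
    also have "?B \<inter> Pi\<^sub>E I A = Pi\<^sub>E I (\<lambda>i. {..<v} \<inter> A i)" by (auto simp: PiE_def)
    also have "emeasure ?P \<dots> = (\<Prod>i\<in>I. ennreal v * emeasure ?\<nu> (A i))"
      using A v by (subst PB) (auto intro!: prod.cong simp only: emeasure_uniform01_scale sets.Int greaterThan_borel lessThan_borel)
    also have "\<dots> = ennreal v ^ card I * (\<Prod>i\<in>I. emeasure ?\<nu> (A i))"
      by (simp add: prod.distrib)
    also have "emeasure ?P ?B = ennreal v ^ card I"
      using v by (subst PB) (auto simp only: emeasure_uniform01_less[OF less_imp_le] lessThan_borel prod_constant)
    also have "ennreal v ^ card I * (\<Prod>i\<in>I. emeasure ?\<nu> (A i)) / ennreal v ^ card I = (\<Prod>i\<in>I. emeasure ?\<nu> (A i))"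
      using v by (subst mult.commute, intro mult_divide_eq_ennreal) (auto simp: ennreal_power)
    finally show "emeasure (uniform_measure ?P ?B) (Pi\<^sub>E I A) = (\<Prod>i\<in>I. emeasure ?\<nu> (A i))" .
  qed
  also have "\<dots> = distr ?P (PiM I (\<lambda>_. borel)) (compose I ((*) v))"
  proof -
    have "distr ?P (PiM I (\<lambda>_. ?\<nu>)) (compose I ((*) v)) = PiM I (\<lambda>i. distr uniform01 ?\<nu> ((*) v))"
      by (intro distr_PiM_finite_prob_space' I prob_space_uniform01 \<nu>) auto
    also have "distr uniform01 ?\<nu> ((*) v) = ?\<nu>" by (rule distr_cong) auto
    also have "distr ?P (PiM I (\<lambda>_. ?\<nu>)) (compose I ((*) v)) = distr ?P (PiM I (\<lambda>_. borel)) (compose I ((*) v))"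
      by (rule distr_cong) (auto cong: sets_PiM_cong)
    finally show ?thesis by simp
  qed
  finally show ?thesis .
qed

text \<open>Freezes \<open>X\<close> at a deterministic value. With \<open>X\<close> one uniform
  variable and \<open>Z\<close> the others, this does the work of a conditional
  distribution.\<close>

lemma (in prob_space) prob_indep_var_Fubini:
  assumes ind: "indep_var S X T Z" and A[measurable]: "A \<in> sets (S \<Otimes>\<^sub>M T)"
  shows "prob {\<omega>\<in>space M. (X \<omega>, Z \<omega>) \<in> A} = (\<integral>x. prob {\<omega>\<in>space M. (x, Z \<omega>) \<in> A} \<partial>distr M S X)"
    and "(\<lambda>x. prob {\<omega>\<in>space M. (x, Z \<omega>) \<in> A}) \<in> borel_measurable S"
proof -
  have X[measurable]: "X \<in> measurable M S" and Z[measurable]: "Z \<in> measurable M T"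
    and eq: "distr M S X \<Otimes>\<^sub>M distr M T Z = distr M (S \<Otimes>\<^sub>M T) (\<lambda>\<omega>. (X \<omega>, Z \<omega>))"
    using ind indep_var_distribution_eq[of S X T Z] by auto
  interpret DX: prob_space "distr M S X" by (rule prob_space_distr) simp
  interpret DZ: prob_space "distr M T Z" by (rule prob_space_distr) simp
  have emZ: "emeasure (distr M T Z) (Pair x -` A) = emeasure M {\<omega>\<in>space M. (x, Z \<omega>) \<in> A}"
    if "x \<in> space S" for x
    by (subst emeasure_distr) (auto intro!: arg_cong[where f="emeasure M"] sets_Pair1[OF A])
  have meas: "(\<lambda>x. measure (distr M T Z) (Pair x -` A)) \<in> borel_measurable S"
    using DZ.measurable_emeasure_Pair[of A S] A unfolding measure_def by simp
  have pZ: "measure (distr M T Z) (Pair x -` A) = prob {\<omega>\<in>space M. (x, Z \<omega>) \<in> A}" if "x \<in> space S" for x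
    using emZ[OF that] by (simp add: measure_def)
  show m: "(\<lambda>x. prob {\<omega>\<in>space M. (x, Z \<omega>) \<in> A}) \<in> borel_measurable S"
    using meas pZ by (subst measurable_cong[OF pZ[symmetric]]) auto
  have "emeasure M {\<omega>\<in>space M. (X \<omega>, Z \<omega>) \<in> A} = emeasure (distr M S X \<Otimes>\<^sub>M distr M T Z) A"
    unfolding eq by (subst emeasure_distr) (auto intro!: arg_cong[where f="emeasure M"])
  also have "\<dots> = (\<integral>\<^sup>+x. emeasure (distr M T Z) (Pair x -` A) \<partial>distr M S X)"
    by (rule DZ.emeasure_pair_measure_alt) simp
  also have "\<dots> = (\<integral>\<^sup>+x. ennreal (prob {\<omega>\<in>space M. (x, Z \<omega>) \<in> A}) \<partial>distr M S X)"
    by (intro nn_integral_cong) (simp add: emZ emeasure_eq_measure)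
  also have "\<dots> = ennreal (\<integral>x. prob {\<omega>\<in>space M. (x, Z \<omega>) \<in> A} \<partial>distr M S X)"
    using m by (intro nn_integral_eq_integral DX.integrable_const_bound[where B=1]) auto
  finally show "prob {\<omega>\<in>space M. (X \<omega>, Z \<omega>) \<in> A} = (\<integral>x. prob {\<omega>\<in>space M. (x, Z \<omega>) \<in> A} \<partial>distr M S X)"
    by (simp add: emeasure_eq_measure)
qed

locale iid_uniform = prob_space M for M :: "'a measure" +
  fixes U :: "nat \<Rightarrow> 'a \<Rightarrow> real"
  assumes indep: "indep_vars (\<lambda>_. borel) U {1..}"
    and unif: "\<And>i. i \<ge> 1 \<Longrightarrow> distr M borel (U i) = uniform01"
begin

lemma random_variable_U [measurable]: "i \<ge> 1 \<Longrightarrow> U i \<in> borel_measurable M"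
  using indep unfolding indep_vars_def by auto

lemma integral_U:
  fixes f :: "real \<Rightarrow> real"
  assumes "i \<ge> 1" "f \<in> borel_measurable borel"
  shows "expectation (\<lambda>\<omega>. f (U i \<omega>)) = (\<integral>u. f u \<partial>uniform01)"
  using assms by (simp add: integral_distr flip: unif)

lemma integrable_U:
  fixes f :: "real \<Rightarrow> real"
  assumes "i \<ge> 1" "f \<in> borel_measurable borel"
  shows "integrable M (\<lambda>\<omega>. f (U i \<omega>)) \<longleftrightarrow> integrable uniform01 f"
  using assms by (simp add: integrable_distr_eq flip: unif)

lemma AE_U_in_01:
  assumes "i \<ge> 1" shows "AE \<omega> in M. 0 < U i \<omega> \<and> U i \<omega> < 1"
proof -
  have "AE u in distr M borel (U i). 0 < u \<and> u < 1"
    unfolding unif[OF assms] by (rule AE_uniform01)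
  then show ?thesis using assms by (subst (asm) AE_distr_iff) auto
qed

lemma indep_var_U_restrict:
  assumes "j \<in> {1..n}"
  shows "indep_var (PiM {j} (\<lambda>_. borel)) (\<lambda>\<omega>. \<lambda>i\<in>{j}. U i \<omega>)
      (PiM ({1..n} - {j}) (\<lambda>_. borel)) (\<lambda>\<omega>. \<lambda>i\<in>{1..n} - {j}. U i \<omega>)"
  using assms by (intro indep_var_restrict[OF indep]) auto

text \<open>With \<open>U j\<close> frozen, \<open>U i\<close> would have to hit a fixed point, and
  the uniform law has no atoms. Hence ties, for which ranks are ambiguous, can be ignored.\<close>

lemma prob_U_eq:
  assumes "i \<in> {1..n}" "j \<in> {1..n}" "i \<noteq> j"
  shows "prob {\<omega>\<in>space M. U i \<omega> = U j \<omega>} = 0"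
proof -
  let ?S = "PiM {j} (\<lambda>_. borel :: real measure)" and ?T = "PiM ({1..n} - {j}) (\<lambda>_. borel :: real measure)"
  let ?A = "{xz \<in> space (?S \<Otimes>\<^sub>M ?T). snd xz i = fst xz j}"
  have i: "i \<in> {1..n} - {j}" using assms by auto
  have A: "?A \<in> sets (?S \<Otimes>\<^sub>M ?T)"
    using i by measurable
  have sp: "(\<lambda>i\<in>{1..n} - {j}. U i \<omega>) \<in> space ?T" "(\<lambda>i\<in>{j}. U i \<omega>) \<in> space ?S" for \<omega>
    by (auto simp: space_PiM)
  have "prob {\<omega>\<in>space M. U i \<omega> = x} = 0" for x
  proof -
    have "prob {\<omega>\<in>space M. U i \<omega> = x} = measure (distr M borel (U i)) {x}"
      using assms(1) by (subst measure_distr) (auto intro!: arg_cong[where f=prob])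
    also have "emeasure uniform01 {x} \<le> emeasure lborel {x}"
      unfolding emeasure_uniform01[OF borel_singleton[OF sets.empty_sets]] by (rule emeasure_mono) auto
    then have "measure (distr M borel (U i)) {x} = 0"
      using assms(1) by (simp add: unif measure_def)
    finally show ?thesis .
  qed
  then have "prob {\<omega>\<in>space M. (x, \<lambda>i\<in>{1..n} - {j}. U i \<omega>) \<in> ?A} = 0" for x
    using i sp by (cases "x \<in> space ?S") (simp_all add: space_pair_measure cong: conj_cong)
  then have "prob {\<omega>\<in>space M. (\<lambda>i\<in>{j}. U i \<omega>, \<lambda>i\<in>{1..n} - {j}. U i \<omega>) \<in> ?A} = 0"
    by (subst prob_indep_var_Fubini(1)[OF indep_var_U_restrict[OF assms(2)] A]) simp
  then show ?thesis using i sp by (simp add: space_pair_measure)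
qed

lemma prob_box_scale:
  assumes v: "0 < v" "v \<le> 1" and I: "finite I" "I \<subseteq> {1..}" "I \<noteq> {}"
    and C: "C \<in> sets (PiM I (\<lambda>_. borel))"
  shows "prob {\<omega>\<in>space M. (\<forall>i\<in>I. U i \<omega> < v) \<and> (\<lambda>i\<in>I. U i \<omega>) \<in> C} =
    v ^ card I * prob {\<omega>\<in>space M. (\<lambda>i\<in>I. v * U i \<omega>) \<in> C}"
proof -
  let ?P = "PiM I (\<lambda>_. uniform01)" and ?B = "Pi\<^sub>E I (\<lambda>_. {..<v})"
  let ?X = "\<lambda>\<omega>. \<lambda>i\<in>I. U i \<omega>"
  have ge1: "i \<ge> 1" if "i \<in> I" for i using I that by auto
  have X[measurable]: "?X \<in> measurable M (PiM I (\<lambda>_. borel))"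
    using ge1 by (intro measurable_restrict random_variable_U) auto
  have D: "distr M (PiM I (\<lambda>_. borel)) ?X = ?P"
  proof -
    have "distr M (PiM I (\<lambda>_. borel)) ?X = PiM I (\<lambda>i. distr M borel (U i))"
      using indep_vars_iff_distr_eq_PiM'[OF I(3), where X=U and M'="\<lambda>_. borel"] ge1
        indep_vars_subset[OF indep I(2)] by auto
    also have "\<dots> = ?P" using ge1 unif by (intro PiM_cong) auto
    finally show ?thesis .
  qed
  have setsP: "sets ?P = sets (PiM I (\<lambda>_. borel))" by (simp cong: sets_PiM_cong)
  have B: "?B \<in> sets ?P" by (intro sets_PiM_I_finite I) auto
  have "(\<lambda>x. \<lambda>i\<in>I. v * x i) \<in> PiM I (\<lambda>_. borel) \<rightarrow>\<^sub>M PiM I (\<lambda>_. borel)"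
    by measurable
  then have comp: "compose I ((*) v) \<in> PiM I (\<lambda>_. borel) \<rightarrow>\<^sub>M PiM I (\<lambda>_. borel)"
    by (simp add: compose_def[abs_def])
  interpret u: prob_space uniform01 by (rule prob_space_uniform01)
  interpret P: product_prob_space "\<lambda>_. uniform01" I by standard
  have PB: "emeasure ?P ?B = ennreal (v ^ card I)"
    using v by (subst P.emeasure_PiM) (use I in \<open>auto simp only: emeasure_uniform01_less[OF less_imp_le] lessThan_borel prod_constant sets_uniform_measure sets_lborel ennreal_power less_imp_le\<close>)
  have "emeasure ?P (?B \<inter> C) = emeasure ?P ?B * emeasure (uniform_measure ?P ?B) C"
    using B C v PB setsP by (subst emeasure_uniform_measure)
      (auto simp: ennreal_times_divide intro!: mult_divide_eq_ennreal[symmetric] simp: mult.commute[of "ennreal _"])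
  also have "emeasure (uniform_measure ?P ?B) C = emeasure (distr ?P (PiM I (\<lambda>_. borel)) (compose I ((*) v))) C"
    by (simp only: uniform_measure_PiM_uniform01[OF v I(1)])
  also have "\<dots> = emeasure (distr M (PiM I (\<lambda>_. borel)) (compose I ((*) v) \<circ> ?X)) C"
    unfolding D[symmetric] using comp X by (subst distr_distr) auto
  also have "compose I ((*) v) \<circ> ?X = (\<lambda>\<omega>. \<lambda>i\<in>I. v * U i \<omega>)"
    by (auto simp: compose_def fun_eq_iff)
  also have "emeasure (distr M (PiM I (\<lambda>_. borel)) (\<lambda>\<omega>. \<lambda>i\<in>I. v * U i \<omega>)) C
      = emeasure M {\<omega>\<in>space M. (\<lambda>i\<in>I. v * U i \<omega>) \<in> C}"
    using C ge1 by (subst emeasure_distr) (auto intro!: arg_cong[where f="emeasure M"] measurable_restrict)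
  finally have 1: "emeasure ?P (?B \<inter> C) = ennreal (v ^ card I) * emeasure M {\<omega>\<in>space M. (\<lambda>i\<in>I. v * U i \<omega>) \<in> C}"
    using PB by simp
  have "emeasure ?P (?B \<inter> C) = emeasure M (?X -` (?B \<inter> C) \<inter> space M)"
    unfolding D[symmetric] using B C setsP by (subst emeasure_distr) auto
  also have "?X -` (?B \<inter> C) \<inter> space M = {\<omega>\<in>space M. (\<forall>i\<in>I. U i \<omega> < v) \<and> ?X \<omega> \<in> C}"
    by auto
  finally show ?thesis
    using 1 v by (simp add: emeasure_eq_measure ennreal_mult'[symmetric])
qed

text \<open>
  Split according to the index \<open>j\<close> of the \<open>(k + 1)\<close>-st smallest variable and the set \<open>I\<close> of the \<open>k\<close> smaller ones.
  On each piece, Fubini over \<open>U\<^sub>j = v\<close> and rescaling \<open>U\<^sub>i\<close>, \<open>i \<in> I\<close>, by \<open>v\<close> leave a factor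
  \<open>v\<^sup>k P(U\<^sub>i > v for the rest)\<close> that does not depend on \<open>B\<close>, so comparing \<open>B\<close> with the sure event avoids
  computing the density of the order statistic.
\<close>

lemma prob_order_stat_approx:
  fixes g :: "real \<Rightarrow> real \<Rightarrow> real"
  assumes k: "1 \<le> k" "k < n" and w: "0 < w" "w \<le> 1" and q: "0 \<le> q" "q \<le> 1" and \<epsilon>: "0 \<le> \<epsilon>"
    and g: "(\<lambda>(x, y). g x y) \<in> borel_measurable (borel \<Otimes>\<^sub>M borel)"
    and B: "B \<in> sets (borel \<Otimes>\<^sub>M borel)"
    and approx: "\<And>v I. 0 < v \<Longrightarrow> v < w \<Longrightarrow> I \<subseteq> {1..n} \<Longrightarrow> card I = k \<Longrightarrow>
      \<bar>prob {\<omega>\<in>space M. (v, \<Sum>i\<in>I. g (v * U i \<omega>) v) \<in> B} - q\<bar> \<le> \<epsilon>"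
  shows "\<bar>prob {\<omega>\<in>space M. (order_stat U n (k + 1) \<omega>,
      \<Sum>i=1..k. g (order_stat U n i \<omega>) (order_stat U n (k + 1) \<omega>)) \<in> B} - q\<bar>
    \<le> \<epsilon> + 2 * prob {\<omega>\<in>space M. w \<le> order_stat U n (k + 1) \<omega>}"
proof -
  let ?V = "order_stat U n (k + 1)"
  let ?T = "\<lambda>\<omega>. \<Sum>i=1..k. g (order_stat U n i \<omega>) (?V \<omega>)"
  have g'' [measurable (raw)]: "(\<lambda>x. g (f x) (h x)) \<in> borel_measurable N"
    if "f \<in> borel_measurable N" "h \<in> borel_measurable N" for f h and N :: "'b measure"
    using measurable_compose[OF measurable_Pair[OF that] g] by simp
  have UNIV_sets [simp]: "UNIV \<in> sets (borel \<Otimes>\<^sub>M borel :: (real \<times> real) measure)"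
    using sets.top[of "borel \<Otimes>\<^sub>M borel :: (real \<times> real) measure"] by (simp add: space_pair_measure)
  define Idx where "Idx = (SIGMA j:{1..n}. {I. I \<subseteq> {1..n} - {j} \<and> card I = k})"
  have finIdx: "finite Idx"
    unfolding Idx_def by (intro finite_SigmaI) auto
  \<comment> \<open>A set in the product space rather than an event, so that \<open>U j\<close> can
    be frozen. The constraint below \<open>w\<close> belongs to the piece because
    \<open>approx\<close> covers only such values; \<open>C = UNIV\<close> gives the piece
    itself.\<close>
  define A where "A j I C = {xz \<in> space (PiM {j} (\<lambda>_. borel) \<Otimes>\<^sub>M PiM ({1..n} - {j}) (\<lambda>_. borel)).
      0 < fst xz j \<and> fst xz j < w \<and> (\<forall>i\<in>I. snd xz i < fst xz j) \<and> (\<forall>i\<in>{1..n} - {j} - I. fst xz j < snd xz i) \<and>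
      (fst xz j, \<Sum>i\<in>I. g (snd xz i) (fst xz j)) \<in> C}" for j :: nat and I and C :: "(real \<times> real) set"
  define D where "D j I C = {\<omega>\<in>space M. ((\<lambda>i\<in>{j}. U i \<omega>), (\<lambda>i\<in>{1..n} - {j}. U i \<omega>)) \<in> A j I C}"
    for j :: nat and I and C :: "(real \<times> real) set"
  have A_iff: "(x, \<lambda>i\<in>{1..n} - {j}. U i \<omega>) \<in> A j I C \<longleftrightarrow> 0 < x j \<and> x j < w \<and> (\<forall>i\<in>I. U i \<omega> < x j) \<and>
      (\<forall>i\<in>{1..n} - {j} - I. x j < U i \<omega>) \<and> (x j, \<Sum>i\<in>I. g (U i \<omega>) (x j)) \<in> C"
    if "(j, I) \<in> Idx" "x \<in> space (PiM {j} (\<lambda>_. borel))" for x \<omega> j I C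
  proof -
    have I: "I \<subseteq> {1..n} - {j}" using that by (auto simp: Idx_def)
    then have 1: "(\<lambda>i\<in>{1..n} - {j}. U i \<omega>) i = U i \<omega>" if "i \<in> I" for i using that by auto
    have 2: "(\<Sum>i\<in>I. g ((\<lambda>i\<in>{1..n} - {j}. U i \<omega>) i) (x j)) = (\<Sum>i\<in>I. g (U i \<omega>) (x j))"
      using 1 by (intro sum.cong) auto
    have 3: "(\<forall>i\<in>I. (\<lambda>i\<in>{1..n} - {j}. U i \<omega>) i < x j) \<longleftrightarrow> (\<forall>i\<in>I. U i \<omega> < x j)"
      using 1 by auto
    show ?thesis
      unfolding A_def using 2 3 that(2) by (auto simp: space_pair_measure space_PiM)
  qed
  have D_iff: "\<omega> \<in> D j I C \<longleftrightarrow> \<omega> \<in> space M \<and> 0 < U j \<omega> \<and> U j \<omega> < w \<and> (\<forall>i\<in>I. U i \<omega> < U j \<omega>) \<and>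
      (\<forall>i\<in>{1..n} - {j} - I. U j \<omega> < U i \<omega>) \<and> (U j \<omega>, \<Sum>i\<in>I. g (U i \<omega>) (U j \<omega>)) \<in> C"
    if "(j, I) \<in> Idx" for \<omega> j I C
    using A_iff[OF that, of "\<lambda>i\<in>{j}. U i \<omega>" \<omega> C] unfolding D_def by (simp add: space_PiM)
  have A_sets: "A j I C \<in> sets (PiM {j} (\<lambda>_. borel) \<Otimes>\<^sub>M PiM ({1..n} - {j}) (\<lambda>_. borel))"
    if "(j, I) \<in> Idx" and C[measurable]: "C \<in> sets (borel \<Otimes>\<^sub>M borel)" for j I C
  proof -
    let ?P = "PiM {j} (\<lambda>_. borel :: real measure) \<Otimes>\<^sub>M PiM ({1..n} - {j}) (\<lambda>_. borel :: real measure)"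
    have I: "I \<subseteq> {1..n} - {j}" using that by (auto simp: Idx_def)
    then have fin: "finite I" by (auto intro: finite_subset)
    have m1[measurable]: "(\<lambda>xz. fst xz j) \<in> borel_measurable ?P"
      by measurable
    have m2: "(\<lambda>xz. snd xz i) \<in> borel_measurable ?P" if "i \<in> {1..n} - {j}" for i
      using that by measurable
    have "{xz \<in> space ?P. snd xz i < fst xz j} \<in> sets ?P" if "i \<in> I" for i
      using that I by (intro borel_measurable_less m1 m2) blast
    then have 1: "{xz \<in> space ?P. \<forall>i\<in>I. snd xz i < fst xz j} \<in> sets ?P"
      using fin by (intro sets.sets_Collect_finite_All) auto
    have "{xz \<in> space ?P. fst xz j < snd xz i} \<in> sets ?P" if "i \<in> {1..n} - {j} - I" for i
      using that by (intro borel_measurable_less m1 m2) blast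
    then have 2: "{xz \<in> space ?P. \<forall>i\<in>{1..n} - {j} - I. fst xz j < snd xz i} \<in> sets ?P"
      by (intro sets.sets_Collect_finite_All) auto
    have "(\<lambda>xz. \<Sum>i\<in>I. g (snd xz i) (fst xz j)) \<in> borel_measurable ?P"
      using I by (intro borel_measurable_sum g'' m1 m2) blast
    then have 3: "{xz \<in> space ?P. (fst xz j, \<Sum>i\<in>I. g (snd xz i) (fst xz j)) \<in> C} \<in> sets ?P"
      by measurable
    show ?thesis
      unfolding A_def by (intro sets.sets_Collect_conj 1 2 3 borel_measurable_less m1 borel_measurable_const)
  qed
  have compare: "\<bar>prob (D j I B) - q * prob (D j I UNIV)\<bar> \<le> \<epsilon> * prob (D j I UNIV)" if jI: "(j, I) \<in> Idx" for j I
  proof -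
    let ?S = "PiM {j} (\<lambda>_. borel :: real measure)" and ?X = "\<lambda>\<omega>. \<lambda>i\<in>{j}. U i \<omega>"
    let ?N = "distr M ?S ?X"
    define F where "F C x = prob {\<omega>\<in>space M. (x, \<lambda>i\<in>{1..n} - {j}. U i \<omega>) \<in> A j I C}" for C x
    have j: "j \<in> {1..n}" and I: "I \<subseteq> {1..n} - {j}" "card I = k" using jI by (auto simp: Idx_def)
    have I': "I \<subseteq> {1..}" "I \<noteq> {}" "I \<subseteq> {1..n}" and finI: "finite I"
      using I k by (auto intro: finite_subset)
    define R where "R = {1..n} - {j} - I"
    have finR: "finite R" by (simp add: R_def)
    have ind: "indep_var (PiM I (\<lambda>_. borel)) (\<lambda>\<omega>. \<lambda>i\<in>I. U i \<omega>) (PiM R (\<lambda>_. borel)) (\<lambda>\<omega>. \<lambda>i\<in>R. U i \<omega>)"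
      using I by (intro indep_var_restrict[OF indep]) (auto simp: R_def)
    have F: "F C x = x j ^ k * prob {\<omega>\<in>space M. (x j, \<Sum>i\<in>I. g (x j * U i \<omega>) (x j)) \<in> C} *
        prob {\<omega>\<in>space M. \<forall>i\<in>R. x j < U i \<omega>}"
      if C: "C \<in> sets (borel \<Otimes>\<^sub>M borel)" and x: "x \<in> space ?S" "0 < x j" "x j < w" for C x
    proof -
      let ?v = "x j"
      let ?C1 = "{z\<in>space (PiM I (\<lambda>_. borel :: real measure)). (?v, \<Sum>i\<in>I. g (z i) ?v) \<in> C}"
      let ?C2 = "{z\<in>space (PiM R (\<lambda>_. borel :: real measure)). \<forall>i\<in>R. ?v < z i}"
      let ?C3 = "{z\<in>space (PiM I (\<lambda>_. borel :: real measure)). (\<forall>i\<in>I. z i < ?v)}"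
      have m[measurable]: "(\<lambda>z. z i) \<in> borel_measurable (PiM K (\<lambda>_. borel :: real measure))" if "i \<in> K" for i K
        using that by measurable
      have C1: "?C1 \<in> sets (PiM I (\<lambda>_. borel))"
        using C by measurable
      have C2: "?C2 \<in> sets (PiM R (\<lambda>_. borel))"
        using finR by measurable
      have C3: "?C3 \<in> sets (PiM I (\<lambda>_. borel))"
        using finI by measurable
      have restr: "(\<Sum>i\<in>I. g ((\<lambda>i\<in>I. U i \<omega>) i) ?v) = (\<Sum>i\<in>I. g (U i \<omega>) ?v)"
        "(\<Sum>i\<in>I. g ((\<lambda>i\<in>I. ?v * U i \<omega>) i) ?v) = (\<Sum>i\<in>I. g (?v * U i \<omega>) ?v)" for \<omega>
        by (intro sum.cong; simp)+
      have "F C x = prob ((\<lambda>\<omega>. (\<lambda>i\<in>I. U i \<omega>, \<lambda>i\<in>R. U i \<omega>)) -` ((?C3 \<inter> ?C1) \<times> ?C2) \<inter> space M)"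
      proof -
        have "((\<lambda>i\<in>I. U i \<omega>, \<lambda>i\<in>R. U i \<omega>) \<in> (?C3 \<inter> ?C1) \<times> ?C2) \<longleftrightarrow>
          (x, \<lambda>i\<in>{1..n} - {j}. U i \<omega>) \<in> A j I C" for \<omega>
          unfolding A_iff[OF jI x(1)] R_def[symmetric] mem_Times_iff using x restr(1)[of \<omega>] by (auto simp: space_PiM)
        then show ?thesis
          unfolding F_def by (intro arg_cong[where f=prob]) blast
      qed
      also have "\<dots> = prob ((\<lambda>\<omega>. \<lambda>i\<in>I. U i \<omega>) -` (?C3 \<inter> ?C1) \<inter> space M) * prob ((\<lambda>\<omega>. \<lambda>i\<in>R. U i \<omega>) -` ?C2 \<inter> space M)"
        using C1 C2 C3 by (intro indep_varD[OF ind]) auto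
      also have "(\<lambda>\<omega>. \<lambda>i\<in>I. U i \<omega>) -` (?C3 \<inter> ?C1) \<inter> space M = {\<omega>\<in>space M. (\<forall>i\<in>I. U i \<omega> < ?v) \<and> (\<lambda>i\<in>I. U i \<omega>) \<in> ?C1}"
        by (auto simp: space_PiM)
      also have "prob \<dots> = ?v ^ k * prob {\<omega>\<in>space M. (\<lambda>i\<in>I. ?v * U i \<omega>) \<in> ?C1}"
        using C1 I I' finI x w by (subst prob_box_scale) auto
      also have "{\<omega>\<in>space M. (\<lambda>i\<in>I. ?v * U i \<omega>) \<in> ?C1} = {\<omega>\<in>space M. (x j, \<Sum>i\<in>I. g (x j * U i \<omega>) (x j)) \<in> C}"
        using restr(2) by (auto simp: space_PiM)
      also have "(\<lambda>\<omega>. \<lambda>i\<in>R. U i \<omega>) -` ?C2 \<inter> space M = {\<omega>\<in>space M. \<forall>i\<in>R. x j < U i \<omega>}"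
        by (auto simp: space_PiM)
      finally show ?thesis .
    qed
    have prob_D: "prob (D j I C) = (\<integral>x. F C x \<partial>?N)" and F_meas: "F C \<in> borel_measurable ?N"
      if "C \<in> sets (borel \<Otimes>\<^sub>M borel)" for C
      using prob_indep_var_Fubini[OF indep_var_U_restrict[OF j] A_sets[OF jI that]]
      unfolding D_def F_def by simp_all
    have pw: "\<bar>F B x - q * F UNIV x\<bar> \<le> \<epsilon> * F UNIV x" if "x \<in> space ?S" for x
    proof (cases "0 < x j \<and> x j < w")
      case True
      let ?h = "prob {\<omega>\<in>space M. (x j, \<Sum>i\<in>I. g (x j * U i \<omega>) (x j)) \<in> B}"
      let ?r = "x j ^ k * prob {\<omega>\<in>space M. \<forall>i\<in>R. x j < U i \<omega>}"
      have "F B x - q * F UNIV x = ?r * (?h - q)" and U: "F UNIV x = ?r"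
        using F[OF B that] F[of UNIV x] that True by (auto simp: prob_space algebra_simps)
      then have "\<bar>F B x - q * F UNIV x\<bar> = ?r * \<bar>?h - q\<bar>"
        using True by (simp add: abs_mult)
      also have "\<dots> \<le> ?r * \<epsilon>"
        using True I' I approx by (intro mult_left_mono) auto
      finally show ?thesis by (simp only: U mult.commute)
    next
      case False
      then have "F C x = 0" for C by (auto simp: F_def A_def)
      then show ?thesis by simp
    qed
    interpret N: prob_space ?N
      using j by (intro prob_space_distr measurable_restrict random_variable_U) auto
    have int: "integrable ?N (F C)" if "C \<in> sets (borel \<Otimes>\<^sub>M borel)" for C
      using F_meas[OF that] by (intro N.integrable_const_bound[where B=1]) (auto simp: F_def)
    have "\<bar>prob (D j I B) - q * prob (D j I UNIV)\<bar> = \<bar>\<integral>x. F B x - q * F UNIV x \<partial>?N\<bar>"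
      using int B by (simp add: prob_D)
    also have "\<dots> \<le> (\<integral>x. \<bar>F B x - q * F UNIV x\<bar> \<partial>?N)"
      by (rule integral_abs_bound)
    also have "\<dots> \<le> (\<integral>x. \<epsilon> * F UNIV x \<partial>?N)"
      using int B pw by (intro integral_mono) auto
    finally show ?thesis by (simp add: prob_D)
  qed
  have D_V: "?V \<omega> = U j \<omega>" "?T \<omega> = (\<Sum>i\<in>I. g (U i \<omega>) (U j \<omega>))"
    if "(j, I) \<in> Idx" "\<omega> \<in> D j I C" for \<omega> j I C
    using order_stat_split[of j n I U \<omega>] that(2)[unfolded D_iff[OF that(1)]] that(1)
    by (auto simp: Idx_def)
  have disj: "disjoint_family_on (\<lambda>(j, I). D j I C) Idx" for C
  proof -
    have "(j, I) = (j', I')" if "(j, I) \<in> Idx" "(j', I') \<in> Idx" "\<omega> \<in> D j I C" "\<omega> \<in> D j' I' C" for j I j' I' \<omega>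
    proof -
      note * = that(3)[unfolded D_iff[OF that(1)]] that(4)[unfolded D_iff[OF that(2)]]
      have I: "I \<subseteq> {1..n} - {j}" "j \<in> {1..n}" "I' \<subseteq> {1..n} - {j'}" "j' \<in> {1..n}"
        using that by (auto simp: Idx_def)
      have V: "U j \<omega> = U j' \<omega>" using D_V(1)[OF that(1,3)] D_V(1)[OF that(2,4)] by simp
      \<comment> \<open>Otherwise \<open>j'\<close> would lie strictly below or strictly above
        \<open>j\<close> on the first piece, although both indices carry the value of the same order
        statistic.\<close>
      have "j = j'"
      proof (rule ccontr)
        assume "j \<noteq> j'"
        then have "j' \<in> I \<or> j' \<in> {1..n} - {j} - I" using I by auto
        then show False using * V by auto
      qed
      moreover have "i \<in> I \<longleftrightarrow> i \<in> I'" for i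
      proof (cases "i \<in> {1..n} - {j}")
        case True
        then show ?thesis using * V \<open>j = j'\<close> by (metis DiffI less_asym)
      qed (use I \<open>j = j'\<close> in auto)
      ultimately show ?thesis by auto
    qed
    then show ?thesis unfolding disjoint_family_on_def by blast
  qed
  have D_sets: "D j I C \<in> events" if "(j, I) \<in> Idx" "C \<in> sets (borel \<Otimes>\<^sub>M borel)" for j I C
  proof -
    have "j \<in> {1..n}" using that by (auto simp: Idx_def)
    then have X: "(\<lambda>\<omega>. (\<lambda>i\<in>{j}. U i \<omega>, \<lambda>i\<in>{1..n} - {j}. U i \<omega>)) \<in>
        measurable M (PiM {j} (\<lambda>_. borel) \<Otimes>\<^sub>M PiM ({1..n} - {j}) (\<lambda>_. borel))"
      by (intro measurable_Pair measurable_restrict random_variable_U) auto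
    show ?thesis
      using measurable_sets[OF X A_sets[OF that]] by (simp add: D_def vimage_def Int_def conj_commute)
  qed
  let ?G = "\<lambda>C. \<Union>(j, I)\<in>Idx. D j I C"
  have prob_G: "prob (?G C) = (\<Sum>(j, I)\<in>Idx. prob (D j I C))" if "C \<in> sets (borel \<Otimes>\<^sub>M borel)" for C
    using finIdx disj D_sets that by (subst finite_measure_finite_Union) (auto simp: split_beta)
  have "\<bar>prob (?G B) - q * prob (?G UNIV)\<bar> = \<bar>\<Sum>(j, I)\<in>Idx. prob (D j I B) - q * prob (D j I UNIV)\<bar>"
    unfolding prob_G[OF B] prob_G[OF UNIV_sets] by (simp add: sum_subtractf sum_distrib_left split_beta)
  also have "\<dots> \<le> (\<Sum>(j, I)\<in>Idx. \<epsilon> * prob (D j I UNIV))"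
    unfolding split_beta by (rule order.trans[OF sum_abs]) (auto intro!: sum_mono compare)
  also have "\<dots> = \<epsilon> * prob (?G UNIV)"
    unfolding prob_G[OF UNIV_sets] by (simp add: sum_distrib_left split_beta)
  finally have GB: "\<bar>prob (?G B) - q * prob (?G UNIV)\<bar> \<le> \<epsilon> * prob (?G UNIV)" .
  have V: "?V \<in> borel_measurable M" and T: "?T \<in> borel_measurable M"
  proof -
    have [measurable]: "order_stat U n i \<in> borel_measurable M" if "i \<in> {1..k + 1}" for i
      using that k by (intro borel_measurable_order_stat random_variable_U) auto
    show "?V \<in> borel_measurable M" "?T \<in> borel_measurable M" by measurable
  qed
  let ?R = "{\<omega>\<in>space M. (?V \<omega>, ?T \<omega>) \<in> B}" and ?W = "{\<omega>\<in>space M. w \<le> ?V \<omega>}"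
  have sets: "?R \<in> events" "?W \<in> events" "?G C \<in> events" if "C \<in> sets (borel \<Otimes>\<^sub>M borel)" for C
    using V T B finIdx D_sets that by auto
  have sub: "?G B \<subseteq> ?R" "?R \<inter> ?G UNIV \<subseteq> ?G B"
  proof -
    have "\<omega> \<in> ?R" if "(j, I) \<in> Idx" "\<omega> \<in> D j I B" for j I \<omega>
      using D_V[OF that] that(2)[unfolded D_iff[OF that(1)]] by (simp only: mem_Collect_eq simp_thms)
    then show "?G B \<subseteq> ?R" by blast
    have "\<omega> \<in> D j I B" if "(j, I) \<in> Idx" "\<omega> \<in> D j I UNIV" "\<omega> \<in> ?R" for j I \<omega>
      using D_V[OF that(1,2)] that(3) that(2)[unfolded D_iff[OF that(1)]] unfolding D_iff[OF that(1)]
      by (simp only: mem_Collect_eq simp_thms) blast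
    then show "?R \<inter> ?G UNIV \<subseteq> ?G B" by blast
  qed
  \<comment> \<open>Off a null set all values are positive and distinct, so some index has exactly
    \<open>k\<close> values below it; it yields a piece unless its value reaches
    \<open>w\<close>.\<close>
  have "AE \<omega> in M. \<omega> \<notin> ?W \<longrightarrow> \<omega> \<in> ?G UNIV"
  proof -
    have "AE \<omega> in M. \<forall>i\<in>{1..n}. 0 < U i \<omega> \<and> U i \<omega> < 1"
      by (intro AE_finite_allI AE_U_in_01) auto
    moreover have "AE \<omega> in M. \<forall>i\<in>{1..n}. \<forall>j\<in>{1..n}. i \<noteq> j \<longrightarrow> U i \<omega> \<noteq> U j \<omega>"
    proof (intro AE_finite_allI)
      fix i j assume ij: "i \<in> {1..n}" "j \<in> {1..n}"
      show "AE \<omega> in M. i \<noteq> j \<longrightarrow> U i \<omega> \<noteq> U j \<omega>"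
      proof (cases "i = j")
        case False
        have "{\<omega>\<in>space M. U i \<omega> = U j \<omega>} \<in> events" using ij by auto
        then have "{\<omega>\<in>space M. U i \<omega> = U j \<omega>} \<in> null_sets M"
          using prob_U_eq[OF ij False] by (auto simp: emeasure_eq_measure)
        then show ?thesis by (rule AE_I') auto
      qed simp
    qed auto
    ultimately show ?thesis
      using AE_space
    proof eventually_elim
      case (elim \<omega>)
      show ?case
      proof
        assume W: "\<omega> \<notin> ?W"
        have "inj_on (\<lambda>i. U i \<omega>) {1..n}" using elim(2) by (auto simp: inj_on_def)
        from ex_rank[OF _ this, of k] obtain j where j: "j \<in> {1..n}" "card {i\<in>{1..n}. U i \<omega> < U j \<omega>} = k"
          using k by auto
        let ?I = "{i\<in>{1..n}. U i \<omega> < U j \<omega>}"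
        have jI: "(j, ?I) \<in> Idx" using j by (auto simp: Idx_def)
        have above: "U j \<omega> < U i \<omega>" if "i \<in> {1..n} - {j} - ?I" for i
          using that elim(2) j(1) by (metis (no_types, lifting) DiffE linorder_neqE_linordered_idom mem_Collect_eq singletonI)
        have "order_stat U n (card ?I + 1) \<omega> = U j \<omega>"
        proof (rule order_stat_split(1)[OF j(1)])
          show "?I \<subseteq> {1..n} - {j}" by auto
        qed (use above in blast)+
        then have "U j \<omega> < w"
          using W elim(3) by (simp only: j(2)) simp
        moreover have "0 < U j \<omega>" using elim(1) j(1) by blast
        ultimately have "\<omega> \<in> D j ?I UNIV"
          unfolding D_iff[OF jI] using above elim(3) by blast
        then show "\<omega> \<in> ?G UNIV" using jI by blast
      qed
    qed
  qed
  then have "prob (space M - ?W) \<le> prob (?G UNIV)"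
    using sets by (intro finite_measure_mono_AE) auto
  then have W: "1 - prob ?W \<le> prob (?G UNIV)"
    using sets by (simp add: prob_compl)
  have "prob (?G B) \<le> prob ?R"
    using sub sets by (intro finite_measure_mono) auto
  moreover have "prob ?R \<le> prob (?G B) + (1 - prob (?G UNIV))"
  proof -
    note G = sets(3)[OF B] sets(3)[OF UNIV_sets]
    have "?R \<subseteq> ?G B \<union> (space M - ?G UNIV)" using sub(2) by blast
    then have "prob ?R \<le> prob (?G B \<union> (space M - ?G UNIV))"
      by (intro finite_measure_mono sets.Un sets.Diff sets.top G)
    also have "\<dots> \<le> prob (?G B) + prob (space M - ?G UNIV)"
      by (intro measure_Un_le sets.Diff sets.top G)
    finally show ?thesis by (simp only: prob_compl[OF G(2)])
  qed
  moreover have "\<epsilon> * prob (?G UNIV) \<le> \<epsilon>" "q * (1 - prob (?G UNIV)) \<le> 1 - prob (?G UNIV)"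
    "q * prob (?G UNIV) \<le> q"
    using \<epsilon> q by (auto intro: mult_left_le mult_left_le_one_le)
  \<comment> \<open>The event outside all pieces has probability at most \<open>prob ?W\<close>. It
    enters the upper estimate through \<open>?R\<close> and the lower one through
    \<open>q * (1 - prob (?G UNIV))\<close>.\<close>
  ultimately show ?thesis
    using GB W q \<epsilon> measure_nonneg[of M ?W] prob_le_1[of "?G UNIV"] by (auto simp: algebra_simps abs_le_iff)
qed

end

section \<open>Moments of the exponential distribution\<close>

lemma distributed_neg_ln_uniform01: "distributed uniform01 lborel (\<lambda>u. - ln u) (exponential_density 1)"
proof -
  interpret prob_space uniform01 by (rule prob_space_uniform01)
  have "prob {u\<in>space uniform01. - ln u \<le> a} = 1 - exp (- a * 1)" if "0 \<le> a" for a
  proof -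
    have "{0<..<1} \<inter> {u\<in>space uniform01. - ln u \<le> a} = {exp (- a)..<1}"
    proof (rule set_eqI)
      fix u :: real
      have "- ln u \<le> a \<longleftrightarrow> exp (- a) \<le> u" if "0 < u"
        using that ln_ge_iff[of u "- a"] by linarith
      moreover have "0 < u" if "exp (- a) \<le> u" using that exp_gt_zero[of "- a"] by linarith
      ultimately show "u \<in> {0<..<1} \<inter> {u\<in>space uniform01. - ln u \<le> a} \<longleftrightarrow> u \<in> {exp (- a)..<1}"
        by auto
    qed
    then have "emeasure uniform01 {u\<in>space uniform01. - ln u \<le> a} = ennreal (1 - exp (- a))"
      using that by (subst emeasure_uniform_measure) (auto simp: ennreal_divide_one)
    then show ?thesis using that by (simp add: measure_def)
  qed
  then show ?thesis by (subst exponential_distributed_iff) auto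
qed

lemma nn_integral_exponential_density_1:
  assumes "f \<in> borel_measurable borel"
  shows "(\<integral>\<^sup>+u. f (- ln u) \<partial>uniform01) = (\<integral>\<^sup>+t. ennreal (indicator {0..} t * exp (- t)) * f t \<partial>lborel)"
  using assms by (subst distributed_nn_integral[OF distributed_neg_ln_uniform01, symmetric])
    (auto intro!: nn_integral_cong simp: exponential_density_def indicator_def)

text \<open>Substituting s = t + b turns the shift into the factor \<open>exp b\<close> for every
  exponent \<open>q\<close>; the range s \<ge> b is then enlarged to s \<ge> 0. The independence of
  \<open>q\<close> keeps the bound useful when the exponent tends to infinity.\<close>

lemma nn_integral_exponential_moment_upper:
  fixes q b :: real
  assumes q: "q > 0" and b: "b \<ge> 0"
  shows "(\<integral>\<^sup>+u. ennreal ((- ln u + b) powr q) \<partial>uniform01) \<le> ennreal (exp b * Gamma (q + 1))"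
proof -
  have "(\<integral>\<^sup>+u. ennreal ((- ln u + b) powr q) \<partial>uniform01) =
      (\<integral>\<^sup>+t. ennreal (indicator {0..} t * exp (- t)) * ennreal ((t + b) powr q) \<partial>lborel)"
    by (rule nn_integral_exponential_density_1) simp
  also have "\<dots> = (\<integral>\<^sup>+s. ennreal (indicator {0..} (s - b) * exp (b - s)) * ennreal (s powr q) \<partial>lborel)"
    by (subst nn_integral_real_affine[where c=1 and t="- b"]) auto
  also have "\<dots> \<le> (\<integral>\<^sup>+s. ennreal (exp b) * ennreal (indicator {0..} s * s powr (q + 1 - 1) / exp s) \<partial>lborel)"
    using b by (intro nn_integral_mono) (auto simp: indicator_def exp_diff ennreal_mult''[symmetric])
  also have "\<dots> = ennreal (exp b) * ennreal (Gamma (q + 1))"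
    using q by (subst nn_integral_cmult) (auto simp: Gamma_conv_nn_integral_real)
  finally show ?thesis by (simp add: ennreal_mult')
qed

text \<open>Cutting at 0 makes the shifted integral start exactly at 0, hence an equality.\<close>

lemma nn_integral_exponential_moment_lower:
  fixes q b :: real
  assumes q: "q > 0" and b: "b \<ge> 0"
  shows "(\<integral>\<^sup>+u. ennreal (max 0 (- ln u - b) powr q) \<partial>uniform01) = ennreal (exp (- b) * Gamma (q + 1))"
proof -
  have "(\<integral>\<^sup>+u. ennreal (max 0 (- ln u - b) powr q) \<partial>uniform01) =
      (\<integral>\<^sup>+t. ennreal (indicator {0..} t * exp (- t)) * ennreal (max 0 (t - b) powr q) \<partial>lborel)"
    by (rule nn_integral_exponential_density_1) simp
  also have "\<dots> = (\<integral>\<^sup>+s. ennreal (indicator {0..} (b + s) * exp (- b - s)) * ennreal (max 0 s powr q) \<partial>lborel)"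
    by (subst nn_integral_real_affine[where c=1 and t="b"]) auto
  also have "\<dots> = (\<integral>\<^sup>+s. ennreal (exp (- b)) * ennreal (indicator {0..} s * s powr (q + 1 - 1) / exp s) \<partial>lborel)"
    using b q by (intro nn_integral_cong) (auto simp: indicator_def exp_diff ennreal_mult''[symmetric] max_def)
  also have "\<dots> = ennreal (exp (- b)) * ennreal (Gamma (q + 1))"
    using q by (subst nn_integral_cmult) (auto simp: Gamma_conv_nn_integral_real)
  finally show ?thesis by (simp add: ennreal_mult')
qed

text \<open>Serves two regimes: slopes on both sides of \<gamma> with \<open>b = ln 2\<close>, from
  the Potter bounds, and both slopes equal to \<gamma> with a small \<open>b\<close>, from the
  second-order condition. The lower hypothesis also makes \<open>Y\<close> nonnegative, so that
  powers are monotone.\<close>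

lemma powr_moment_bounds:
  fixes Y :: "real \<Rightarrow> real" and q b A A' :: real
  assumes Y[measurable]: "Y \<in> borel_measurable borel" and q: "q > 0" and b: "b \<ge> 0" and A: "A \<ge> 0" "A' \<ge> 0"
    and lo: "\<And>u. 0 < u \<Longrightarrow> u < 1 \<Longrightarrow> A * max 0 (- ln u - b) \<le> Y u"
    and up: "\<And>u. 0 < u \<Longrightarrow> u < 1 \<Longrightarrow> Y u \<le> A' * (- ln u + b)"
  shows "integrable uniform01 (\<lambda>u. Y u powr q)"
    and "A powr q * exp (- b) * Gamma (q + 1) \<le> (\<integral>u. Y u powr q \<partial>uniform01)"
    and "(\<integral>u. Y u powr q \<partial>uniform01) \<le> A' powr q * exp b * Gamma (q + 1)"
proof -
  have G: "Gamma (q + 1) > 0" using q by (intro Gamma_real_pos) simp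
  have "(\<integral>\<^sup>+u. ennreal (Y u powr q) \<partial>uniform01) \<le> (\<integral>\<^sup>+u. ennreal (A' powr q) * ennreal ((- ln u + b) powr q) \<partial>uniform01)"
  proof (rule nn_integral_mono_AE)
    show "AE u in uniform01. ennreal (Y u powr q) \<le> ennreal (A' powr q) * ennreal ((- ln u + b) powr q)"
      using AE_uniform01
    proof eventually_elim
      case (elim u)
      then have "0 \<le> - ln u" by simp
      moreover have "0 \<le> Y u" using lo[of u] elim A by (smt (verit) mult_nonneg_nonneg)
      ultimately have "Y u powr q \<le> (A' * (- ln u + b)) powr q"
        using up[of u] elim q by (intro powr_mono2) auto
      also have "\<dots> = A' powr q * (- ln u + b) powr q"
        by (rule powr_mult)
      finally show ?case by (simp add: ennreal_mult'[symmetric])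
    qed
  qed
  also have "\<dots> = ennreal (A' powr q) * (\<integral>\<^sup>+u. ennreal ((- ln u + b) powr q) \<partial>uniform01)"
    by (rule nn_integral_cmult) simp
  also have "\<dots> \<le> ennreal (A' powr q) * ennreal (exp b * Gamma (q + 1))"
    by (intro mult_left_mono nn_integral_exponential_moment_upper q b) simp
  finally have U: "(\<integral>\<^sup>+u. ennreal (Y u powr q) \<partial>uniform01) \<le> ennreal (A' powr q * exp b * Gamma (q + 1))"
    by (simp add: ennreal_mult'[symmetric] mult.assoc)
  show int: "integrable uniform01 (\<lambda>u. Y u powr q)"
    using U by (intro integrableI_nonneg) (auto simp: less_top[symmetric] top_unique)
  have eq: "(\<integral>\<^sup>+u. ennreal (Y u powr q) \<partial>uniform01) = ennreal (\<integral>u. Y u powr q \<partial>uniform01)"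
    by (rule nn_integral_eq_integral[OF int]) simp
  show "(\<integral>u. Y u powr q \<partial>uniform01) \<le> A' powr q * exp b * Gamma (q + 1)"
    using U G unfolding eq by (subst (asm) ennreal_le_iff) auto
  have "ennreal (A powr q * exp (- b) * Gamma (q + 1)) = ennreal (A powr q) * (\<integral>\<^sup>+u. ennreal (max 0 (- ln u - b) powr q) \<partial>uniform01)"
    by (simp add: nn_integral_exponential_moment_lower[OF q b] ennreal_mult'[symmetric] mult.assoc)
  also have "\<dots> = (\<integral>\<^sup>+u. ennreal (A powr q) * ennreal (max 0 (- ln u - b) powr q) \<partial>uniform01)"
    by (rule nn_integral_cmult[symmetric]) simp
  also have "\<dots> \<le> (\<integral>\<^sup>+u. ennreal (Y u powr q) \<partial>uniform01)"
  proof (rule nn_integral_mono_AE)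
    show "AE u in uniform01. ennreal (A powr q) * ennreal (max 0 (- ln u - b) powr q) \<le> ennreal (Y u powr q)"
      using AE_uniform01
    proof eventually_elim
      case (elim u)
      have "A powr q * max 0 (- ln u - b) powr q = (A * max 0 (- ln u - b)) powr q"
        by (rule powr_mult[symmetric])
      also have "\<dots> \<le> Y u powr q"
        using lo[of u] elim q A by (intro powr_mono2) auto
      finally show ?case by (simp add: ennreal_mult'[symmetric])
    qed
  qed
  finally show "A powr q * exp (- b) * Gamma (q + 1) \<le> (\<integral>u. Y u powr q \<partial>uniform01)"
    unfolding eq by (subst (asm) ennreal_le_iff) (auto simp: integral_nonneg_AE)
qed

section \<open>Bounds for the logarithm of the Gamma function\<close>

lemma nn_integral_exponential_density:
  assumes "l > 0" shows "(\<integral>\<^sup>+t. ennreal (indicator {0..} t * exp (- l * t)) \<partial>lborel) = ennreal (1 / l)"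
proof -
  interpret prob_space "density lborel (exponential_density l)"
    by (rule prob_space_exponential_density) fact
  have "1 = (\<integral>\<^sup>+t. ennreal (exponential_density l t) \<partial>lborel)"
    using emeasure_space_1 by (simp add: emeasure_density)
  also have "\<dots> = (\<integral>\<^sup>+t. ennreal l * ennreal (indicator {0..} t * exp (- l * t)) \<partial>lborel)"
    using assms by (intro nn_integral_cong) (auto simp: exponential_density_def indicator_def ennreal_mult' mult.commute)
  also have "\<dots> = ennreal l * (\<integral>\<^sup>+t. ennreal (indicator {0..} t * exp (- l * t)) \<partial>lborel)"
    by (rule nn_integral_cmult) simp
  finally have "ennreal (1 / l) = ennreal (1 / l) * (ennreal l * (\<integral>\<^sup>+t. ennreal (indicator {0..} t * exp (- l * t)) \<partial>lborel))"
    by (metis mult_1_right)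
  also have "\<dots> = (\<integral>\<^sup>+t. ennreal (indicator {0..} t * exp (- l * t)) \<partial>lborel)"
    using assms by (simp add: mult.assoc[symmetric] ennreal_mult'[symmetric])
  finally show ?thesis by simp
qed

text \<open>Only arguments above \<open>x\<close> are kept in the Gamma integral; there the power is
  at least \<open>x powr x\<close>.\<close>

lemma ln_Gamma_plus1_ge:
  fixes x :: real
  assumes x: "x > 0" shows "x * ln x - x \<le> ln (Gamma (x + 1))"
proof -
  have G: "Gamma (x + 1) > 0" using x by (intro Gamma_real_pos) simp
  have "ennreal (x powr x * exp (- x)) = ennreal (x powr x * exp (- x)) * (\<integral>\<^sup>+t. ennreal (indicator {0..} t * exp (- 1 * t)) \<partial>lborel)"
    by (subst nn_integral_exponential_density) auto
  also have "\<dots> = (\<integral>\<^sup>+t. ennreal (x powr x * exp (- x)) * ennreal (indicator {0..} t * exp (- 1 * t)) \<partial>lborel)"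
    by (rule nn_integral_cmult[symmetric]) simp
  also have "\<dots> \<le> (\<integral>\<^sup>+t. ennreal (indicator {0..} (x + t) * (x + t) powr (x + 1 - 1) / exp (x + t)) \<partial>lborel)"
    using x by (intro nn_integral_mono)
      (auto simp: indicator_def ennreal_mult''[symmetric] exp_add exp_minus divide_simps intro!: ennreal_leI powr_mono2)
  also have "\<dots> = ennreal (Gamma (x + 1))"
    using x by (subst Gamma_conv_nn_integral_real, simp, subst (2) nn_integral_real_affine[where c=1 and t=x]) auto
  finally have "x powr x * exp (- x) \<le> Gamma (x + 1)"
    using G by (subst (asm) ennreal_le_iff) auto
  then have "ln (x powr x * exp (- x)) \<le> ln (Gamma (x + 1))"
    using x G by (subst ln_le_cancel_iff) auto
  then show ?thesis using x by (simp add: ln_mult ln_powr)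
qed

text \<open>Exponential tilting: \<open>t powr x * exp (- (1 - e) * t)\<close> is largest at
  \<open>t = x / (1 - e)\<close>, and the remaining \<open>exp (- e * t)\<close> integrates to
  \<open>1 / e\<close>. The loss \<open>- x * ln (1 - e)\<close> is linear in \<open>x\<close> with
  an arbitrarily small coefficient, hence harmless for rates per unit of the exponent.\<close>

lemma ln_Gamma_plus1_le:
  fixes x e :: real
  assumes x: "x > 0" and e: "0 < e" "e < 1"
  shows "ln (Gamma (x + 1)) \<le> x * ln x - x - x * ln (1 - e) - ln e"
proof -
  have G: "Gamma (x + 1) > 0" using x by (intro Gamma_real_pos) simp
  define K where "K = x * ln x - x - x * ln (1 - e)"
  have key: "t powr x \<le> exp K * exp ((1 - e) * t)" if "t > 0" for t
  proof -
    have "ln (t * (1 - e) / x) \<le> t * (1 - e) / x - 1"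
      using that x e by (intro ln_le_minus_one) auto
    then have "x * (ln t + ln (1 - e) - ln x) \<le> x * (t * (1 - e) / x - 1)"
      using that x e by (intro mult_left_mono) (auto simp: ln_mult ln_div)
    moreover have "x * (t * (1 - e) / x - 1) = t * (1 - e) - x"
      using x by (simp add: field_simps)
    ultimately have "x * ln t \<le> K + (1 - e) * t"
      by (simp add: K_def algebra_simps)
    then show ?thesis using that by (simp add: powr_def exp_add[symmetric])
  qed
  have "ennreal (Gamma (x + 1)) = (\<integral>\<^sup>+t. ennreal (indicator {0..} t * t powr (x + 1 - 1) / exp t) \<partial>lborel)"
    using x by (intro Gamma_conv_nn_integral_real) simp
  also have "\<dots> \<le> (\<integral>\<^sup>+t. ennreal (exp K) * ennreal (indicator {0..} t * exp (- e * t)) \<partial>lborel)"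
  proof (rule nn_integral_mono)
    fix t :: real
    consider "t \<le> 0" | "t > 0" by linarith
    then show "ennreal (indicator {0..} t * t powr (x + 1 - 1) / exp t) \<le> ennreal (exp K) * ennreal (indicator {0..} t * exp (- e * t))"
    proof cases
      case 2
      have "t powr x / exp t \<le> exp K * exp ((1 - e) * t) / exp t"
        using key[OF 2] by (intro divide_right_mono) auto
      also have "\<dots> = exp K * exp (- e * t)" by (simp add: exp_diff[symmetric] exp_add[symmetric] algebra_simps)
      finally show ?thesis using 2 by (simp add: ennreal_mult'[symmetric])
    qed (auto simp: indicator_def)
  qed
  also have "\<dots> = ennreal (exp K) * ennreal (1 / e)"
    using e by (subst nn_integral_cmult) (simp_all only: nn_integral_exponential_density, simp)
  finally have "Gamma (x + 1) \<le> exp K / e"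
    using e by (simp add: ennreal_mult'[symmetric])
  then have "ln (Gamma (x + 1)) \<le> ln (exp K / e)"
    using G e by (subst ln_le_cancel_iff) auto
  then show ?thesis using e by (simp add: ln_div K_def)
qed

section \<open>Regularly varying tails\<close>

text \<open>\<open>Inf\<close> on the reals is antitone only among nonempty sets bounded below; the
  limits of the cdf at both ends guarantee this for levels inside (0, 1).\<close>

lemma quantile_mono:
  assumes "real_distribution D" "0 < s" "s \<le> t" "t < 1"
  shows "quantile (cdf D) s \<le> quantile (cdf D) t"
proof -
  interpret real_distribution D by fact
  have "eventually (\<lambda>x. t < cdf D x) at_top"
    using cdf_lim_at_top_prob assms by (intro order_tendstoD)
  then obtain x where "t < cdf D x" by (auto simp: eventually_at_top_linorder)
  then have "{x. t \<le> cdf D x} \<noteq> {}" by (auto intro: less_imp_le)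
  moreover have "eventually (\<lambda>x. cdf D x < s) at_bot"
    using cdf_lim_at_bot assms by (intro order_tendstoD)
  then obtain y where y: "cdf D y < s" by (auto simp: eventually_at_bot_linorder)
  have "bdd_below {x. s \<le> cdf D x}"
  proof (rule bdd_belowI)
    fix x assume "x \<in> {x. s \<le> cdf D x}"
    then show "y \<le> x" using y cdf_nondecreasing[of x y] by (cases "y \<le> x") auto
  qed
  ultimately show ?thesis
    unfolding quantile_def using assms by (intro cInf_superset_mono) auto
qed

text \<open>Outside [0, 1] and at 0 the set under \<open>Inf\<close> is everything or empty, so the
  default value of \<open>Inf\<close> is constant there. Together with monotonicity on (0, 1) and
  the single point 1 this gives finitely many monotone pieces.\<close>

lemma borel_measurable_quantile:
  assumes "real_distribution D"
  shows "quantile (cdf D) \<in> borel_measurable borel"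
proof -
  interpret real_distribution D by fact
  have "s \<le> 0 \<Longrightarrow> {x. s \<le> cdf D x} = UNIV" for s
    using cdf_nonneg order.trans by auto
  then have 1: "mono_on {..0} (quantile (cdf D))"
    by (intro mono_onI) (simp add: quantile_def)
  have "1 < s \<Longrightarrow> {x. s \<le> cdf D x} = {}" for s
    using cdf_bounded_prob by (auto simp: not_le intro: order.strict_trans1)
  then have 2: "mono_on {1<..} (quantile (cdf D))"
    by (intro mono_onI) (simp add: quantile_def)
  have 3: "mono_on {0<..<1} (quantile (cdf D))"
    by (intro mono_onI quantile_mono assms) auto
  show ?thesis
  proof (rule borel_measurable_piecewise_mono[where C="{{..0}, {0<..<1}, {1}, {1<..}}"])
    show "\<Union> {{..0}, {0<..<1}, {1}, {1<..}} = (UNIV :: real set)" by auto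
  qed (use 1 2 3 in \<open>auto intro: mono_onI\<close>)
qed

locale regular_tail =
  fixes D :: "real measure" and Q l :: "real \<Rightarrow> real" and \<gamma> :: real
  assumes \<gamma>_pos: "\<gamma> > 0"
    and D: "real_distribution D"
    and Q_eq: "Q = quantile (cdf D)"
    and Q_tail: "\<And>s. s \<in> {0<..<1} \<Longrightarrow> Q (1 - s) = s powr (-\<gamma>) * l s"
    and slow: "slowly_varying_at_0 l"
begin

lemma Q_antimono: "0 < s \<Longrightarrow> s \<le> t \<Longrightarrow> t < 1 \<Longrightarrow> Q (1 - t) \<le> Q (1 - s)"
  unfolding Q_eq by (rule quantile_mono[OF D]) auto

lemma Q_measurable [measurable]: "Q \<in> borel_measurable borel"
  unfolding Q_eq by (rule borel_measurable_quantile[OF D])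

lemma Y_var_measurable [measurable]: "Y_var Q v \<in> borel_measurable borel"
  unfolding Y_var_def[abs_def] by measurable

lemma m_fun_measurable [measurable]: "m_fun Q q \<in> borel_measurable borel"
proof -
  interpret u: prob_space uniform01 by (rule prob_space_uniform01)
  have "(\<lambda>v. \<integral>u. Y_var Q v u powr q \<partial>uniform01) \<in> borel_measurable borel"
    unfolding Y_var_def by measurable
  then show ?thesis by (simp add: m_fun_def[abs_def])
qed

lemma sigma_fun_measurable [measurable]: "sigma_fun Q q \<in> borel_measurable borel"
proof -
  interpret u: prob_space uniform01 by (rule prob_space_uniform01)
  have "(\<lambda>v. sqrt (\<integral>u. (Y_var Q v u powr q - m_fun Q q v)\<^sup>2 \<partial>uniform01)) \<in> borel_measurable borel"
    unfolding Y_var_def by measurable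
  then show ?thesis by (simp add: sigma_fun_def[abs_def] m_fun_def)
qed

lemma l_pos: obtains \<delta> where "0 < \<delta>" "\<delta> \<le> 1" "\<And>s. 0 < s \<Longrightarrow> s < \<delta> \<Longrightarrow> 0 < l s" "\<And>s. 0 < s \<Longrightarrow> s < \<delta> \<Longrightarrow> 0 < Q (1 - s)"
proof -
  obtain \<delta> where \<delta>: "\<delta> > 0" "\<forall>v\<in>{0<..<\<delta>}. 0 < l v"
    using slow unfolding regularly_varying_at_0_def by blast
  show ?thesis
  proof (rule that[of "min \<delta> 1"])
    fix s assume s: "0 < s" "s < min \<delta> 1"
    then show "0 < l s" using \<delta> by auto
    with s show "0 < Q (1 - s)" by (subst Q_tail) auto
  qed (use \<delta> in auto)
qed

text \<open>Slow variation at the ratio 1/2, in logarithmic form for \<open>Q\<close>. Iterated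
  along \<open>v / 2 ^ j\<close> and combined with monotonicity of \<open>Q\<close>, it takes the
  place of a uniform convergence theorem.\<close>

lemma dyadic_bounds:
  assumes e: "e > 0"
  obtains v0 where "0 < v0" "v0 < 1" "\<And>v. 0 < v \<Longrightarrow> v < v0 \<Longrightarrow> 0 < Q (1 - v)"
    "\<And>v. 0 < v \<Longrightarrow> v < v0 \<Longrightarrow> (\<gamma> - e) * ln 2 \<le> ln (Q (1 - v / 2)) - ln (Q (1 - v))"
    "\<And>v. 0 < v \<Longrightarrow> v < v0 \<Longrightarrow> ln (Q (1 - v / 2)) - ln (Q (1 - v)) \<le> (\<gamma> + e) * ln 2"
proof -
  obtain \<delta> where \<delta>: "0 < \<delta>" "\<delta> \<le> 1" "\<And>s. 0 < s \<Longrightarrow> s < \<delta> \<Longrightarrow> 0 < l s" "\<And>s. 0 < s \<Longrightarrow> s < \<delta> \<Longrightarrow> 0 < Q (1 - s)"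
    using l_pos by blast
  have "((\<lambda>v. l (1 / 2 * v) / l v) \<longlongrightarrow> (1 / 2) powr 0) (at_right 0)"
    using slow unfolding regularly_varying_at_0_def by (elim conjE allE[of _ "1 / 2"]) simp
  then have "((\<lambda>v. ln (l (1 / 2 * v) / l v)) \<longlongrightarrow> ln 1) (at_right 0)"
    by (intro tendsto_ln) auto
  then have "eventually (\<lambda>v. dist (ln (l (1 / 2 * v) / l v)) (ln 1) < e * ln 2) (at_right 0)"
    by (rule tendstoD) (use e in auto)
  then obtain d where d: "d > 0" "\<And>v. 0 < v \<Longrightarrow> v < d \<Longrightarrow> \<bar>ln (l (v / 2) / l v)\<bar> < e * ln 2"
    by (auto simp: eventually_at_right_field dist_real_def)
  have eq: "ln (Q (1 - v / 2)) - ln (Q (1 - v)) = \<gamma> * ln 2 + ln (l (v / 2) / l v)" if "0 < v" "v < \<delta>" for v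
    using that \<delta>(2) \<delta>(3)[of v] \<delta>(3)[of "v / 2"]
    by (simp add: Q_tail ln_mult ln_div ln_powr algebra_simps)
  show ?thesis
  proof (rule that[of "min (min \<delta> d) (1 / 2)"])
    fix v assume v: "0 < v" "v < min (min \<delta> d) (1 / 2)"
    show "0 < Q (1 - v)" using v \<delta> by auto
    have "\<bar>ln (l (v / 2) / l v)\<bar> < e * ln 2" using v d by auto
    then show "(\<gamma> - e) * ln 2 \<le> ln (Q (1 - v / 2)) - ln (Q (1 - v))"
      "ln (Q (1 - v / 2)) - ln (Q (1 - v)) \<le> (\<gamma> + e) * ln 2"
      using v eq[of v] by (auto simp: algebra_simps)
  qed (use d \<delta> in auto)
qed

lemma potter_bounds:
  assumes e: "0 < e" "e < \<gamma>"
  obtains v0 where "0 < v0" "v0 < 1" "\<And>v. 0 < v \<Longrightarrow> v < v0 \<Longrightarrow> 0 < Q (1 - v)"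
    "\<And>v u. 0 < v \<Longrightarrow> v < v0 \<Longrightarrow> 0 < u \<Longrightarrow> u < 1 \<Longrightarrow> (\<gamma> - e) * max 0 (- ln u - ln 2) \<le> Y_var Q v u"
    "\<And>v u. 0 < v \<Longrightarrow> v < v0 \<Longrightarrow> 0 < u \<Longrightarrow> u < 1 \<Longrightarrow> Y_var Q v u \<le> (\<gamma> + e) * (- ln u + ln 2)"
proof -
  obtain v0 where v0: "0 < v0" "v0 < 1" and pos: "\<And>v. 0 < v \<Longrightarrow> v < v0 \<Longrightarrow> 0 < Q (1 - v)"
    and lo: "\<And>v. 0 < v \<Longrightarrow> v < v0 \<Longrightarrow> (\<gamma> - e) * ln 2 \<le> ln (Q (1 - v / 2)) - ln (Q (1 - v))"
    and up: "\<And>v. 0 < v \<Longrightarrow> v < v0 \<Longrightarrow> ln (Q (1 - v / 2)) - ln (Q (1 - v)) \<le> (\<gamma> + e) * ln 2"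
    using dyadic_bounds[OF e(1)] by blast
  have iter: "real j * ((\<gamma> - e) * ln 2) \<le> ln (Q (1 - v / 2 ^ j)) - ln (Q (1 - v)) \<and>
      ln (Q (1 - v / 2 ^ j)) - ln (Q (1 - v)) \<le> real j * ((\<gamma> + e) * ln 2)" if v: "0 < v" "v < v0" for v j
  proof (induction j)
    case (Suc j)
    have "v / 2 ^ j \<le> v" using v by (simp add: divide_simps)
    then have "0 < v / 2 ^ j" "v / 2 ^ j < v0" using v by auto
    from lo[OF this] up[OF this] have
      "(\<gamma> - e) * ln 2 \<le> ln (Q (1 - v / 2 ^ Suc j)) - ln (Q (1 - v / 2 ^ j))"
      "ln (Q (1 - v / 2 ^ Suc j)) - ln (Q (1 - v / 2 ^ j)) \<le> (\<gamma> + e) * ln 2"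
      by (simp_all add: field_simps)
    then show ?case using Suc.IH by (simp add: distrib_right)
  qed simp
  have main: "(\<gamma> - e) * max 0 (- ln u - ln 2) \<le> Y_var Q v u \<and> Y_var Q v u \<le> (\<gamma> + e) * (- ln u + ln 2)"
    if v: "0 < v" "v < v0" and u: "0 < u" "u < 1" for u v
  proof -
    \<comment> \<open>So \<open>u\<close> lies between \<open>1 / 2 ^ Suc j\<close> and
      \<open>1 / 2 ^ j\<close>. Moving it to either end costs at most one dyadic step, which is the
      additive \<open>ln 2\<close> in both bounds.\<close>
    define j where "j = nat \<lfloor>- ln u / ln 2\<rfloor>"
    have "0 \<le> - ln u / ln 2" using u by (simp add: divide_nonpos_pos)
    then have "real j \<le> - ln u / ln 2" "- ln u / ln 2 < real j + 1"
      unfolding j_def by linarith+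
    then have j: "real j * ln 2 \<le> - ln u" "- ln u \<le> (real j + 1) * ln 2"
      by (auto simp: field_simps)
    have pow: "1 / 2 ^ i = exp (- (real i * ln 2))" for i
      by (simp add: exp_minus exp_of_nat_mult divide_inverse)
    have "u = exp (ln u)" using u by simp
    then have "u \<le> 1 / 2 ^ j" "1 / 2 ^ Suc j \<le> u"
      unfolding pow using j by (metis exp_le_cancel_iff neg_le_iff_le minus_minus, metis exp_le_cancel_iff neg_le_iff_le minus_minus of_nat_Suc add.commute)
    then have uv: "u * v \<le> v / 2 ^ j" "v / 2 ^ Suc j \<le> u * v" "u * v \<le> v" "0 < u * v"
      using u v mult_right_mono[of u "1 / 2 ^ j" v] mult_right_mono[of "1 / 2 ^ Suc j" u v] by auto
    then have uv0: "u * v < v0" "u * v < 1" using v v0 by linarith+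
    note pos_uv = pos[OF uv(4) uv0(1)]
    have "v / 2 ^ i \<le> v" for i using v by (simp add: divide_simps)
    then have small: "v / 2 ^ i < v0" for i using v by (meson order.strict_trans1)
    have "0 < v / 2 ^ i" for i using v by simp
    note P = pos[OF this small]
    have Y: "Y_var Q v u = ln (Q (1 - u * v)) - ln (Q (1 - v))"
      unfolding Y_var_def using pos[of v] pos_uv v by (simp add: ln_div)
    have "ln (Q (1 - u * v)) \<le> ln (Q (1 - v / 2 ^ Suc j))"
      using uv uv0 v P[of "Suc j"] pos_uv by (subst ln_le_cancel_iff) (auto intro!: Q_antimono)
    then have "Y_var Q v u \<le> real (Suc j) * ((\<gamma> + e) * ln 2)"
      using iter[OF v, of "Suc j"] unfolding Y by linarith
    also have "\<dots> = (\<gamma> + e) * (real j * ln 2 + ln 2)" by (simp add: algebra_simps)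
    also have "\<dots> \<le> (\<gamma> + e) * (- ln u + ln 2)"
      using j e by (intro mult_left_mono) auto
    finally have U: "Y_var Q v u \<le> (\<gamma> + e) * (- ln u + ln 2)" .
    have "ln (Q (1 - v / 2 ^ j)) \<le> ln (Q (1 - u * v))"
      using uv v order.strict_trans[OF small[of j] v0(2)] P[of j] pos_uv by (subst ln_le_cancel_iff) (auto intro!: Q_antimono)
    then have "real j * ((\<gamma> - e) * ln 2) \<le> Y_var Q v u"
      using iter[OF v, of j] unfolding Y by linarith
    moreover have "(\<gamma> - e) * max 0 (- ln u - ln 2) \<le> (\<gamma> - e) * (real j * ln 2)"
      using j e by (intro mult_left_mono) (auto simp: algebra_simps)
    ultimately show ?thesis using U by (simp add: mult_ac)
  qed
  then show ?thesis using that v0 pos by blast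
qed

text \<open>The constants 2 and 1/2 are \<open>exp (ln 2)\<close> and its inverse, coming from the
  shift in \<open>potter_bounds\<close>. Neither they nor \<open>v0\<close> depend on
  \<open>q\<close>, so \<open>q\<close> may grow while \<open>v\<close> tends to 0.\<close>

lemma moment_bounds:
  assumes e: "0 < e" "e < \<gamma>"
  obtains v0 where "0 < v0" "v0 < 1"
    "\<And>v q. 0 < v \<Longrightarrow> v < v0 \<Longrightarrow> 0 < q \<Longrightarrow> integrable uniform01 (\<lambda>u. Y_var Q v u powr q)"
    "\<And>v q. 0 < v \<Longrightarrow> v < v0 \<Longrightarrow> 0 < q \<Longrightarrow> (\<gamma> - e) powr q / 2 * Gamma (q + 1) \<le> m_fun Q q v"
    "\<And>v q. 0 < v \<Longrightarrow> v < v0 \<Longrightarrow> 0 < q \<Longrightarrow> m_fun Q q v \<le> 2 * (\<gamma> + e) powr q * Gamma (q + 1)"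
proof -
  obtain v0 where v0: "0 < v0" "v0 < 1"
    "\<And>v u. 0 < v \<Longrightarrow> v < v0 \<Longrightarrow> 0 < u \<Longrightarrow> u < 1 \<Longrightarrow> (\<gamma> - e) * max 0 (- ln u - ln 2) \<le> Y_var Q v u"
    "\<And>v u. 0 < v \<Longrightarrow> v < v0 \<Longrightarrow> 0 < u \<Longrightarrow> u < 1 \<Longrightarrow> Y_var Q v u \<le> (\<gamma> + e) * (- ln u + ln 2)"
    using potter_bounds[OF e] by metis
  show ?thesis
  proof (rule that[OF v0(1,2)])
    fix v q :: real assume v: "0 < v" "v < v0" and q: "0 < q"
    note B = powr_moment_bounds[OF Y_var_measurable q, of "ln 2" "\<gamma> - e" "\<gamma> + e" v, OF _ _ _ v0(3,4)[OF v]]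
    show "integrable uniform01 (\<lambda>u. Y_var Q v u powr q)" by (rule B(1)) (use e in auto)
    show "(\<gamma> - e) powr q / 2 * Gamma (q + 1) \<le> m_fun Q q v"
      unfolding m_fun_def using B(2) e by (simp add: exp_minus)
    show "m_fun Q q v \<le> 2 * (\<gamma> + e) powr q * Gamma (q + 1)"
      unfolding m_fun_def using B(3) e by (simp add: mult_ac)
  qed
qed

end

section \<open>Exponential growth rates of the moments\<close>

lemma exp_tendsto_0_of_rate:
  fixes a p :: "nat \<Rightarrow> real"
  assumes "(\<lambda>n. a n / p n) \<longlonglongrightarrow> L" "L < \<theta>" "filterlim p at_top sequentially"
  shows "(\<lambda>n. exp (a n - \<theta> * p n)) \<longlonglongrightarrow> 0"
proof -
  have "(\<lambda>n. a n / p n - \<theta>) \<longlonglongrightarrow> L - \<theta>" by (intro tendsto_intros assms)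
  then have "filterlim (\<lambda>n. (a n / p n - \<theta>) * p n) at_bot sequentially"
    using assms by (intro filterlim_tendsto_neg_mult_at_bot) auto
  moreover have "eventually (\<lambda>n. (a n / p n - \<theta>) * p n = a n - \<theta> * p n) sequentially"
    using filterlim_at_top_dense[THEN iffD1, OF assms(3), rule_format, of 0]
    by eventually_elim (simp add: left_diff_distrib)
  ultimately have "filterlim (\<lambda>n. a n - \<theta> * p n) at_bot sequentially"
    by (simp add: filterlim_cong)
  then show ?thesis by (rule filterlim_compose[OF exp_at_bot])
qed

lemma eventually_at_right_0_seq:
  fixes v :: "nat \<Rightarrow> real"
  assumes "filterlim v (at_right 0) sequentially" "0 < d"
  shows "eventually (\<lambda>n. 0 < v n \<and> v n < d) sequentially"
  using assms by (intro eventually_compose_filterlim[OF _ assms(1)]) (auto simp: eventually_at_right_field)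

context regular_tail
begin

lemma eventually_moments:
  assumes v: "filterlim v (at_right 0) sequentially"
  shows "eventually (\<lambda>n. \<forall>q>0. integrable uniform01 (\<lambda>u. Y_var Q (v n) u powr q) \<and> 0 < m_fun Q q (v n)) sequentially"
proof -
  obtain v0 where v0: "0 < v0" "v0 < 1"
    "\<And>v q. 0 < v \<Longrightarrow> v < v0 \<Longrightarrow> 0 < q \<Longrightarrow> integrable uniform01 (\<lambda>u. Y_var Q v u powr q)"
    "\<And>v q. 0 < v \<Longrightarrow> v < v0 \<Longrightarrow> 0 < q \<Longrightarrow> (\<gamma> - \<gamma> / 2) powr q / 2 * Gamma (q + 1) \<le> m_fun Q q v"
    using moment_bounds[of "\<gamma> / 2"] \<gamma>_pos by (metis half_gt_zero field_sum_of_halves less_add_same_cancel1)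
  have "0 < m_fun Q q v" if "0 < v" "v < v0" "0 < q" for v q
  proof -
    have "0 < (\<gamma> - \<gamma> / 2) powr q / 2 * Gamma (q + 1)"
      using that \<gamma>_pos by (intro mult_pos_pos Gamma_real_pos) auto
    then show ?thesis using v0(4)[OF that] by linarith
  qed
  then show ?thesis
    using eventually_at_right_0_seq[OF v v0(1)] v0(3) by (auto elim!: eventually_mono)
qed

text \<open>Division by \<open>p n\<close> removes constant factors, and the bounds on ln Gamma at c
  p give c ln(c p) - c. The diverging part c ln p is subtracted; being linear in \<open>c\<close>,
  it disappears from the ratios formed next.\<close>

lemma moment_growth:
  assumes v: "filterlim v (at_right 0) sequentially" and p: "filterlim p at_top sequentially" and c: "c > 0"
  shows "(\<lambda>n. ln (m_fun Q (c * p n) (v n)) / p n - c * ln (p n)) \<longlonglongrightarrow> c * ln (c * \<gamma>) - c"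
proof (rule tendstoI)
  fix e :: real assume e: "e > 0"
  have "((\<lambda>h. c * (ln (\<gamma> + h) - ln \<gamma> - ln (1 - h))) \<longlongrightarrow> c * (ln (\<gamma> + 0) - ln \<gamma> - ln (1 - 0))) (at_right 0)"
    using \<gamma>_pos by (intro tendsto_intros) auto
  then have 1: "eventually (\<lambda>h. c * (ln (\<gamma> + h) - ln \<gamma> - ln (1 - h)) < e / 2) (at_right 0)"
    by (rule order_tendstoD) (use e in auto)
  have "((\<lambda>h. c * (ln \<gamma> - ln (\<gamma> - h))) \<longlongrightarrow> c * (ln \<gamma> - ln (\<gamma> - 0))) (at_right 0)"
    using \<gamma>_pos by (intro tendsto_intros) auto
  then have 2: "eventually (\<lambda>h. c * (ln \<gamma> - ln (\<gamma> - h)) < e / 2) (at_right 0)"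
    by (rule order_tendstoD) (use e in auto)
  have 3: "eventually (\<lambda>h. 0 < h \<and> h < \<gamma> \<and> h < 1) (at_right (0::real))"
    using \<gamma>_pos by (auto simp: eventually_at_right_field intro!: exI[of _ "min \<gamma> 1"])
  \<comment> \<open>One small \<open>h\<close> acts both as the slope error in the Potter bounds and
    as the tilting parameter in the Gamma bound.\<close>
  obtain h where h: "0 < h" "h < \<gamma>" "h < 1"
    and h1: "c * (ln (\<gamma> + h) - ln \<gamma> - ln (1 - h)) < e / 2" and h2: "c * (ln \<gamma> - ln (\<gamma> - h)) < e / 2"
    using eventually_happens'[OF trivial_limit_at_right_real eventually_conj[OF 1 eventually_conj[OF 2 3]]] by blast
  obtain v0 where v0: "0 < v0" "v0 < 1"
    "\<And>v q. 0 < v \<Longrightarrow> v < v0 \<Longrightarrow> 0 < q \<Longrightarrow> (\<gamma> - h) powr q / 2 * Gamma (q + 1) \<le> m_fun Q q v"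
    "\<And>v q. 0 < v \<Longrightarrow> v < v0 \<Longrightarrow> 0 < q \<Longrightarrow> m_fun Q q v \<le> 2 * (\<gamma> + h) powr q * Gamma (q + 1)"
    using moment_bounds[OF h(1,2)] by metis
  have "(\<lambda>n. (ln 2 - ln h) / p n) \<longlonglongrightarrow> 0" "(\<lambda>n. ln 2 / p n) \<longlonglongrightarrow> 0"
    by (intro real_tendsto_divide_at_top[OF tendsto_const p])+
  from this[THEN order_tendstoD(2), of "e / 2"]
  have "eventually (\<lambda>n. (ln 2 - ln h) / p n < e / 2) sequentially" "eventually (\<lambda>n. ln 2 / p n < e / 2) sequentially"
    using e by auto
  moreover have "eventually (\<lambda>n. 0 < p n) sequentially" using p by (simp add: filterlim_at_top_dense)
  ultimately show "eventually (\<lambda>n. dist (ln (m_fun Q (c * p n) (v n)) / p n - c * ln (p n)) (c * ln (c * \<gamma>) - c) < e) sequentially"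
    using eventually_at_right_0_seq[OF v v0(1)]
  proof eventually_elim
    case (elim n)
    define q m G where "q = c * p n" and "m = m_fun Q q (v n)" and "G = Gamma (q + 1)"
    have q: "q > 0" using c elim by (simp add: q_def)
    have G: "G > 0" using q by (simp add: G_def Gamma_real_pos)
    have lnq: "ln q = ln c + ln (p n)" using c elim by (simp add: q_def ln_mult)
    have lo: "(\<gamma> - h) powr q / 2 * G \<le> m" and up: "m \<le> 2 * (\<gamma> + h) powr q * G"
      using v0(3,4)[of "v n" q] elim q by (auto simp: m_def G_def)
    have "0 < (\<gamma> - h) powr q / 2 * G" using h G by simp
    with lo have m: "m > 0" by linarith
    have "q * ln (\<gamma> - h) - ln 2 + (q * ln q - q) \<le> ln ((\<gamma> - h) powr q / 2 * G)"
      using ln_Gamma_plus1_ge[OF q] h G by (simp add: ln_mult ln_div ln_powr G_def)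
    also have "\<dots> \<le> ln m" using lo h G m by (subst ln_le_cancel_iff) auto
    finally have "(q * ln (\<gamma> - h) - ln 2 + (q * ln q - q)) / p n \<le> ln m / p n"
      using elim by (intro divide_right_mono) auto
    moreover have "(q * ln (\<gamma> - h) - ln 2 + (q * ln q - q)) / p n = c * ln (\<gamma> - h) - ln 2 / p n + c * ln c + c * ln (p n) - c"
      using elim by (simp add: q_def lnq[unfolded q_def] field_simps)
    ultimately have L: "c * ln (\<gamma> - h) - ln 2 / p n + c * ln c + c * ln (p n) - c \<le> ln m / p n" by simp
    have "ln m \<le> ln (2 * (\<gamma> + h) powr q * G)" using up h G m \<gamma>_pos by (subst ln_le_cancel_iff) auto
    also have "\<dots> \<le> ln 2 + q * ln (\<gamma> + h) + (q * ln q - q - q * ln (1 - h) - ln h)"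
      using ln_Gamma_plus1_le[OF q h(1,3)] h G by (simp add: ln_mult ln_powr G_def)
    finally have "ln m / p n \<le> (ln 2 + q * ln (\<gamma> + h) + (q * ln q - q - q * ln (1 - h) - ln h)) / p n"
      using elim by (intro divide_right_mono) auto
    moreover have "(ln 2 + q * ln (\<gamma> + h) + (q * ln q - q - q * ln (1 - h) - ln h)) / p n =
      c * ln (\<gamma> + h) + c * ln c + c * ln (p n) - c - c * ln (1 - h) + (ln 2 - ln h) / p n"
      using elim by (simp add: q_def lnq[unfolded q_def] field_simps)
    ultimately have U: "ln m / p n \<le> c * ln (\<gamma> + h) + c * ln c + c * ln (p n) - c - c * ln (1 - h) + (ln 2 - ln h) / p n"
      by simp
    have "c * ln (c * \<gamma>) = c * ln c + c * ln \<gamma>" using c \<gamma>_pos by (simp add: ln_mult distrib_left)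
    then show ?case
      using L U h1[unfolded right_diff_distrib] h2[unfolded right_diff_distrib] elim(1,2)
      unfolding m_def q_def dist_real_def abs_less_iff by (intro conjI; linarith)
  qed
qed

text \<open>Everything linear in \<open>c\<close> cancels, namely c ln p, c ln \<gamma> and - c. The
  rate that remains depends neither on \<gamma> nor on the slowly varying function.\<close>

lemma moment_ratio_growth:
  assumes v: "filterlim v (at_right 0) sequentially" and p: "filterlim p at_top sequentially" and c: "c > 0"
  shows "(\<lambda>n. ln (m_fun Q (c * p n) (v n) / m_fun Q (p n) (v n) powr c) / p n) \<longlonglongrightarrow> c * ln c"
proof -
  have "(\<lambda>n. (ln (m_fun Q (c * p n) (v n)) / p n - c * ln (p n)) - c * (ln (m_fun Q (1 * p n) (v n)) / p n - 1 * ln (p n)))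
      \<longlonglongrightarrow> (c * ln (c * \<gamma>) - c) - c * (1 * ln (1 * \<gamma>) - 1)"
    by (rule tendsto_diff[OF moment_growth[OF v p c] tendsto_mult[OF tendsto_const moment_growth[OF v p zero_less_one]]])
  also have "(c * ln (c * \<gamma>) - c) - c * (1 * ln (1 * \<gamma>) - 1) = c * ln c"
    using c \<gamma>_pos by (simp add: ln_mult algebra_simps)
  finally show ?thesis
  proof (rule Lim_transform_eventually)
    have "eventually (\<lambda>n. 0 < p n) sequentially" using p by (simp add: filterlim_at_top_dense)
    then show "eventually (\<lambda>n. (ln (m_fun Q (c * p n) (v n)) / p n - c * ln (p n)) - c * (ln (m_fun Q (1 * p n) (v n)) / p n - 1 * ln (p n))
      = ln (m_fun Q (c * p n) (v n) / m_fun Q (p n) (v n) powr c) / p n) sequentially"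
      using eventually_moments[OF v]
    proof eventually_elim
      case (elim n)
      then have "0 < m_fun Q (c * p n) (v n)" "0 < m_fun Q (p n) (v n)" using c by auto
      then show ?case by (simp add: ln_div ln_powr diff_divide_distrib algebra_simps)
    qed
  qed
qed

text \<open>Since k = exp(\<alpha>p), the factor \<open>exp (\<theta> * p n)\<close> stands for the
  power of k against which the moment ratio is measured.\<close>

lemma moment_ratio_tendsto_0:
  assumes v: "filterlim v (at_right 0) sequentially" and p: "filterlim p at_top sequentially" and c: "c > 0"
    and \<theta>: "c * ln c < \<theta>"
  shows "(\<lambda>n. m_fun Q (c * p n) (v n) / (m_fun Q (p n) (v n) powr c * exp (\<theta> * p n))) \<longlonglongrightarrow> 0"
proof (rule Lim_transform_eventually)
  show "(\<lambda>n. exp (ln (m_fun Q (c * p n) (v n) / m_fun Q (p n) (v n) powr c) - \<theta> * p n)) \<longlonglongrightarrow> 0"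
    by (rule exp_tendsto_0_of_rate[OF moment_ratio_growth[OF v p c] \<theta> p])
  have "eventually (\<lambda>n. 0 < p n) sequentially" using p by (simp add: filterlim_at_top_dense)
  then show "eventually (\<lambda>n. exp (ln (m_fun Q (c * p n) (v n) / m_fun Q (p n) (v n) powr c) - \<theta> * p n) =
      m_fun Q (c * p n) (v n) / (m_fun Q (p n) (v n) powr c * exp (\<theta> * p n))) sequentially"
    using eventually_moments[OF v]
  proof eventually_elim
    case (elim n)
    then have "0 < m_fun Q (c * p n) (v n)" "0 < m_fun Q (p n) (v n)" using c by auto
    then show ?case by (simp add: exp_diff)
  qed
qed

lemma moment_inverse_ratio_tendsto_0:
  assumes v: "filterlim v (at_right 0) sequentially" and p: "filterlim p at_top sequentially" and c: "c > 0"
    and \<theta>: "\<theta> < c * ln c"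
  shows "(\<lambda>n. m_fun Q (p n) (v n) powr c * exp (\<theta> * p n) / m_fun Q (c * p n) (v n)) \<longlonglongrightarrow> 0"
proof (rule Lim_transform_eventually)
  have "(\<lambda>n. - ln (m_fun Q (c * p n) (v n) / m_fun Q (p n) (v n) powr c) / p n) \<longlonglongrightarrow> - (c * ln c)"
    using tendsto_minus[OF moment_ratio_growth[OF v p c]] by simp
  then show "(\<lambda>n. exp (- ln (m_fun Q (c * p n) (v n) / m_fun Q (p n) (v n) powr c) - (- \<theta>) * p n)) \<longlonglongrightarrow> 0"
    by (rule exp_tendsto_0_of_rate[OF _ _ p]) (use \<theta> in simp)
  have "eventually (\<lambda>n. 0 < p n) sequentially" using p by (simp add: filterlim_at_top_dense)
  then show "eventually (\<lambda>n. exp (- ln (m_fun Q (c * p n) (v n) / m_fun Q (p n) (v n) powr c) - (- \<theta>) * p n) =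
      m_fun Q (p n) (v n) powr c * exp (\<theta> * p n) / m_fun Q (c * p n) (v n)) sequentially"
    using eventually_moments[OF v]
  proof eventually_elim
    case (elim n)
    then have "0 < m_fun Q (c * p n) (v n)" "0 < m_fun Q (p n) (v n)" using c by auto
    then have "0 < m_fun Q (c * p n) (v n) / m_fun Q (p n) (v n) powr c" (is "0 < ?R") by simp
    then have "exp (- ln ?R - (- \<theta>) * p n) = exp (\<theta> * p n) / ?R"
      by (simp add: exp_diff)
    then show ?case by simp
  qed
qed

end

section \<open>Limit theorems for sums of functions of uniform variables\<close>

text \<open>Interpolates between the two terms according to whether \<open>\<bar>s * x\<bar>\<close>
  exceeds 1. The remainder in the expansion of a characteristic function thereby becomes a moment of
  order \<open>r\<close> close to 2; for \<alpha> near 2 the third moments grow too fast.\<close>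

lemma min_square_cube_le_powr:
  fixes s x r :: real
  assumes r: "2 < r" "r \<le> 3"
  shows "min (6 * x\<^sup>2) (\<bar>s\<bar> * \<bar>x\<bar> ^ 3) \<le> 6 * \<bar>s\<bar> powr (r - 2) * \<bar>x\<bar> powr r"
proof (cases "x = 0 \<or> s = 0")
  case False
  then have pos: "\<bar>s * x\<bar> > 0" by simp
  have eq: "\<bar>s\<bar> powr (r - 2) * \<bar>x\<bar> powr r = x\<^sup>2 * \<bar>s * x\<bar> powr (r - 2)"
    using False by (simp add: abs_mult powr_mult powr_diff powr_numeral divide_simps)
  show ?thesis
  proof (cases "\<bar>s * x\<bar> \<le> 1")
    case True
    then have "\<bar>s * x\<bar> powr 1 \<le> \<bar>s * x\<bar> powr (r - 2)"
      using r pos by (intro powr_mono') auto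
    then have "x\<^sup>2 * \<bar>s * x\<bar> \<le> x\<^sup>2 * \<bar>s * x\<bar> powr (r - 2)"
      using pos by (intro mult_left_mono) auto
    moreover have "x\<^sup>2 = \<bar>x\<bar> * \<bar>x\<bar>" by (simp add: power2_eq_square)
    then have "\<bar>s\<bar> * \<bar>x\<bar> ^ 3 = x\<^sup>2 * \<bar>s * x\<bar>"
      by (simp only: abs_mult power3_eq_cube mult_ac)
    moreover have "0 \<le> x\<^sup>2 * \<bar>s * x\<bar> powr (r - 2)" by simp
    ultimately show ?thesis unfolding mult.assoc eq by linarith
  next
    case False
    then have "1 \<le> \<bar>s * x\<bar> powr (r - 2)" using r by (intro ge_one_powr_ge_zero) auto
    then have "x\<^sup>2 * 1 \<le> x\<^sup>2 * \<bar>s * x\<bar> powr (r - 2)" by (intro mult_left_mono) auto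
    then show ?thesis unfolding mult.assoc eq by linarith
  qed
qed auto

context iid_uniform
begin

lemma indep_vars_comp_U:
  assumes "I \<subseteq> {1..}" "f \<in> borel_measurable borel"
  shows "indep_vars (\<lambda>_. borel) (\<lambda>i \<omega>. f (U i \<omega>)) I"
  by (rule indep_vars_compose2[OF indep_vars_subset[OF indep assms(1)]]) (use assms in auto)

lemma sum_U_measurable:
  fixes f :: "real \<Rightarrow> real"
  assumes "I \<subseteq> {1..}" "f \<in> borel_measurable borel"
  shows "(\<lambda>\<omega>. \<Sum>i\<in>I. f (U i \<omega>)) \<in> borel_measurable M"
  using assms by (intro borel_measurable_sum measurable_compose[OF random_variable_U]) auto

lemma expectation_sum_U_squared:
  fixes f :: "real \<Rightarrow> real"
  assumes I: "finite I" "I \<subseteq> {1..}" and f[measurable]: "f \<in> borel_measurable borel"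
    and bound: "\<And>u. \<bar>f u\<bar> \<le> B" and mean: "(\<integral>u. f u \<partial>uniform01) = 0"
  shows "expectation (\<lambda>\<omega>. (\<Sum>i\<in>I. f (U i \<omega>))\<^sup>2) = real (card I) * (\<integral>u. (f u)\<^sup>2 \<partial>uniform01)"
    and "integrable M (\<lambda>\<omega>. (\<Sum>i\<in>I. f (U i \<omega>))\<^sup>2)"
proof -
  have ge1: "i \<ge> 1" if "i \<in> I" for i using I that by auto
  have [measurable]: "(\<lambda>\<omega>. f (U i \<omega>)) \<in> borel_measurable M" if "i \<in> I" for i
    using ge1[OF that] by measurable
  have int: "integrable M (\<lambda>\<omega>. f (U i \<omega>) * f (U j \<omega>))" if "i \<in> I" "j \<in> I" for i j
  proof (rule integrable_const_bound[where B="B * B"])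
    show "AE \<omega> in M. norm (f (U i \<omega>) * f (U j \<omega>)) \<le> B * B"
      using bound by (auto simp: abs_mult intro!: AE_I2 mult_mono order.trans[OF abs_ge_zero bound])
  qed (use that in measurable)
  have int1: "integrable M (\<lambda>\<omega>. f (U i \<omega>))" if "i \<in> I" for i
    using that bound by (intro integrable_const_bound[where B="B"]) auto
  have eq: "(\<Sum>i\<in>I. f (U i \<omega>))\<^sup>2 = (\<Sum>i\<in>I. \<Sum>j\<in>I. f (U i \<omega>) * f (U j \<omega>))" for \<omega>
    by (simp add: power2_eq_square sum_product)
  show "integrable M (\<lambda>\<omega>. (\<Sum>i\<in>I. f (U i \<omega>))\<^sup>2)"
    unfolding eq using int by auto
  have E: "expectation (\<lambda>\<omega>. f (U i \<omega>) * f (U j \<omega>)) = (if i = j then (\<integral>u. (f u)\<^sup>2 \<partial>uniform01) else 0)"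
    if ij: "i \<in> I" "j \<in> I" for i j
  proof (cases "i = j")
    case True
    then show ?thesis using integral_U[OF ge1[OF ij(1)], of "\<lambda>u. (f u)\<^sup>2"] by (simp add: power2_eq_square)
  next
    case False
    have "expectation (\<lambda>\<omega>. \<Prod>l\<in>{i, j}. f (U l \<omega>)) = (\<Prod>l\<in>{i, j}. expectation (\<lambda>\<omega>. f (U l \<omega>)))"
      by (rule indep_vars_lebesgue_integral) (use ij I int1 in \<open>auto intro!: indep_vars_comp_U\<close>)
    then show ?thesis using False integral_U[OF ge1[OF ij(1)] f] mean by simp
  qed
  have "expectation (\<lambda>\<omega>. (\<Sum>i\<in>I. f (U i \<omega>))\<^sup>2) = (\<Sum>i\<in>I. \<Sum>j\<in>I. expectation (\<lambda>\<omega>. f (U i \<omega>) * f (U j \<omega>)))"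
    unfolding eq using int by (subst Bochner_Integration.integral_sum) (auto intro!: sum.cong Bochner_Integration.integral_sum)
  also have "\<dots> = (\<Sum>i\<in>I. \<Sum>j\<in>I. if i = j then (\<integral>u. (f u)\<^sup>2 \<partial>uniform01) else 0)"
    using E by (intro sum.cong) auto
  also have "\<dots> = real (card I) * (\<integral>u. (f u)\<^sup>2 \<partial>uniform01)"
    using I by simp
  finally show "expectation (\<lambda>\<omega>. (\<Sum>i\<in>I. f (U i \<omega>))\<^sup>2) = real (card I) * (\<integral>u. (f u)\<^sup>2 \<partial>uniform01)" .
qed

text \<open>Chebyshev with the variance replaced by the larger second moment. It is applied to
  bounded functions only: truncated variables and indicators.\<close>

lemma prob_sum_U_deviation:
  fixes f :: "real \<Rightarrow> real"
  assumes I: "finite I" "I \<subseteq> {1..}" and f[measurable]: "f \<in> borel_measurable borel"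
    and bound: "\<And>u. \<bar>f u\<bar> \<le> B" and t: "t > 0"
  shows "prob {\<omega>\<in>space M. t \<le> \<bar>(\<Sum>i\<in>I. f (U i \<omega>)) - real (card I) * (\<integral>u. f u \<partial>uniform01)\<bar>}
    \<le> real (card I) * (\<integral>u. (f u)\<^sup>2 \<partial>uniform01) / t\<^sup>2"
proof -
  interpret u: prob_space uniform01 by (rule prob_space_uniform01)
  define \<mu> where "\<mu> = (\<integral>u. f u \<partial>uniform01)"
  let ?h = "\<lambda>u. f u - \<mu>"
  have intf: "integrable uniform01 f" using bound by (intro u.integrable_const_bound[where B=B]) auto
  have intf2: "integrable uniform01 (\<lambda>u. (f u)\<^sup>2)"
    using bound by (intro u.integrable_const_bound[where B="B\<^sup>2"]) (auto simp: abs_le_square_iff[symmetric] intro!: AE_I2 order.trans[OF bound])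
  have "\<bar>?h u\<bar> \<le> B + \<bar>\<mu>\<bar>" for u using bound[of u] by linarith
  note S = expectation_sum_U_squared[OF I, of ?h, OF _ this]
  have m0: "(\<integral>u. ?h u \<partial>uniform01) = 0" using intf by (simp add: \<mu>_def u.prob_space)
  have "(\<integral>u. (?h u)\<^sup>2 \<partial>uniform01) = (\<integral>u. (f u)\<^sup>2 \<partial>uniform01) - \<mu>\<^sup>2"
    unfolding \<mu>_def using u.variance_eq[OF intf intf2] by simp
  then have var: "(\<integral>u. (?h u)\<^sup>2 \<partial>uniform01) \<le> (\<integral>u. (f u)\<^sup>2 \<partial>uniform01)" by simp
  have eq: "(\<Sum>i\<in>I. f (U i \<omega>)) - real (card I) * \<mu> = (\<Sum>i\<in>I. ?h (U i \<omega>))" for \<omega>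
    by (simp add: sum_subtractf)
  have "prob {\<omega>\<in>space M. t \<le> \<bar>\<Sum>i\<in>I. ?h (U i \<omega>)\<bar>} = prob {\<omega>\<in>space M. t\<^sup>2 \<le> (\<Sum>i\<in>I. ?h (U i \<omega>))\<^sup>2}"
    using t by (intro arg_cong[where f=prob]) (auto simp: abs_le_square_iff[symmetric])
  also have "\<dots> \<le> expectation (\<lambda>\<omega>. (\<Sum>i\<in>I. ?h (U i \<omega>))\<^sup>2) / t\<^sup>2"
    using t S(2) m0 by (intro integral_Markov_inequality_measure[where A="{}"]) auto
  also have "\<dots> = real (card I) * (\<integral>u. (?h u)\<^sup>2 \<partial>uniform01) / t\<^sup>2"
    using S(1) m0 by simp
  also have "\<dots> \<le> real (card I) * (\<integral>u. (f u)\<^sup>2 \<partial>uniform01) / t\<^sup>2"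
    using var by (intro divide_right_mono mult_left_mono) auto
  finally show ?thesis unfolding \<mu>_def[symmetric] eq .
qed

text \<open>For \<alpha> < 2 ln 2 the second moment of Y\<hat>p exceeds k times its squared mean,
  and Chebyshev for \<open>X\<close> itself is useless; truncation gets by with a moment of order
  \<open>r\<close>. With \<open>L \<le> 1 / 4\<close> the truncated mean is at least 3/4 of
  \<open>m\<close>, so a drop to half the mean is a deviation of \<open>k * m / 4\<close>, which
  produces the constant 16.\<close>

lemma prob_sum_U_le_half_mean:
  fixes X :: "real \<Rightarrow> real"
  assumes I: "finite I" "I \<subseteq> {1..}" "I \<noteq> {}" and X[measurable]: "X \<in> borel_measurable borel"
    and nonneg: "\<And>u. 0 \<le> X u" and r: "1 < r" "r \<le> 2"
    and int: "integrable uniform01 X" "integrable uniform01 (\<lambda>u. X u powr r)"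
    and m: "m = (\<integral>u. X u \<partial>uniform01)" "m > 0"
    and L: "L = (\<integral>u. X u powr r \<partial>uniform01) / (m powr r * real (card I) powr (r - 1))" "L \<le> 1 / 4"
  shows "prob {\<omega>\<in>space M. (\<Sum>i\<in>I. X (U i \<omega>)) \<le> real (card I) * m / 2} \<le> 16 * L"
proof -
  interpret u: prob_space uniform01 by (rule prob_space_uniform01)
  let ?k = "real (card I)"
  have k: "?k > 0" using I by (simp add: card_gt_0_iff)
  \<comment> \<open>Truncating at \<open>K = k m\<close> makes the lost mean \<open>L m\<close> and the variance of the average \<open>L m\<^sup>2\<close>.\<close>
  define K where "K = ?k * m"
  have K: "K > 0" using k m by (simp add: K_def)
  define X' where "X' u = (if X u \<le> K then X u else 0)" for u
  have [measurable]: "X' \<in> borel_measurable borel" unfolding X'_def[abs_def] by measurable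
  have X'_b: "\<bar>X' u\<bar> \<le> K" "0 \<le> X' u" "X' u \<le> X u" for u using nonneg K by (auto simp: X'_def)
  define R where "R = (\<integral>u. X u powr r \<partial>uniform01)"
  have R: "R = L * m powr r * ?k powr (r - 1)" using L m k by (simp add: R_def)
  have intX': "integrable uniform01 X'" using X'_b(1) by (intro u.integrable_const_bound[where B=K]) auto
  have intX'2: "integrable uniform01 (\<lambda>u. (X' u)\<^sup>2)"
    using X'_b K by (intro u.integrable_const_bound[where B="K\<^sup>2"]) (auto intro!: power_mono)
  have "m - (\<integral>u. X' u \<partial>uniform01) = (\<integral>u. X u - X' u \<partial>uniform01)"
    using int intX' m by simp
  \<comment> \<open>Where \<open>X u > K\<close>, the decreasing power
    \<open>X u powr (1 - r)\<close> is at most \<open>K powr (1 - r)\<close>. The second moment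
    further down uses the increasing power \<open>2 - r\<close> below \<open>K\<close> in the same
    way.\<close>
  also have "\<dots> \<le> (\<integral>u. K powr (1 - r) * X u powr r \<partial>uniform01)"
  proof (rule integral_mono)
    show "X u - X' u \<le> K powr (1 - r) * X u powr r" for u
    proof (cases "X u \<le> K")
      case False
      then have X: "X u > 0" using K by simp
      have "X u powr (1 - r) \<le> K powr (1 - r)" using False K r by (intro powr_mono2') auto
      then have "X u powr (1 - r) * X u powr r \<le> K powr (1 - r) * X u powr r" by (intro mult_right_mono) auto
      then show ?thesis using False X by (simp add: X'_def powr_add[symmetric])
    qed (auto simp: X'_def)
  qed (use int intX' in auto)
  also have "\<dots> = K powr (1 - r) * R" by (simp add: R_def)
  also have "\<dots> = L * m * (?k powr (1 - r) * ?k powr (r - 1)) * (m powr (r - 1) * m powr (1 - r))"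
    using k m by (simp add: R K_def powr_mult powr_mult_base mult_ac flip: powr_diff)
  also have "\<dots> = L * m" using k m by (simp flip: powr_add)
  finally have mean: "m - (\<integral>u. X' u \<partial>uniform01) \<le> L * m" .
  have "L * m \<le> 1 / 4 * m" using L m by (intro mult_right_mono) auto
  with mean have mean': "3 / 4 * m \<le> (\<integral>u. X' u \<partial>uniform01)" by simp
  have "(\<integral>u. (X' u)\<^sup>2 \<partial>uniform01) \<le> (\<integral>u. K powr (2 - r) * X u powr r \<partial>uniform01)"
  proof (rule integral_mono)
    show "(X' u)\<^sup>2 \<le> K powr (2 - r) * X u powr r" for u
    proof (cases "X u \<le> K \<and> X u > 0")
      case True
      then have "X u powr (2 - r) \<le> K powr (2 - r)" using r by (intro powr_mono2) auto
      then have "X u powr (2 - r) * X u powr r \<le> K powr (2 - r) * X u powr r" by (intro mult_right_mono) auto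
      then show ?thesis using True by (simp add: X'_def powr_add[symmetric])
    qed (use nonneg[of u] in \<open>auto simp: X'_def\<close>)
  qed (use int intX'2 in auto)
  also have "\<dots> = K powr (2 - r) * R" by (simp add: R_def)
  also have "\<dots> = L * (?k powr (2 - r) * ?k powr (r - 1)) * (m powr r * m powr (2 - r))"
    using k m by (simp add: R K_def powr_mult mult_ac)
  also have "\<dots> = L * ?k * m\<^sup>2" using k m by (simp flip: powr_add)
  finally have sq: "(\<integral>u. (X' u)\<^sup>2 \<partial>uniform01) \<le> L * ?k * m\<^sup>2" .
  have [measurable]: "(\<lambda>\<omega>. \<Sum>i\<in>I. X' (U i \<omega>)) \<in> borel_measurable M"
    by (rule sum_U_measurable[OF I(2)]) simp
  have "prob {\<omega>\<in>space M. (\<Sum>i\<in>I. X (U i \<omega>)) \<le> ?k * m / 2}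
    \<le> prob {\<omega>\<in>space M. ?k * m / 4 \<le> \<bar>(\<Sum>i\<in>I. X' (U i \<omega>)) - ?k * (\<integral>u. X' u \<partial>uniform01)\<bar>}"
  proof (intro finite_measure_mono subsetI CollectI conjI)
    fix \<omega> assume "\<omega> \<in> {\<omega>\<in>space M. (\<Sum>i\<in>I. X (U i \<omega>)) \<le> ?k * m / 2}"
    then have "(\<Sum>i\<in>I. X (U i \<omega>)) \<le> ?k * m / 2" "\<omega> \<in> space M" by auto
    moreover have "(\<Sum>i\<in>I. X' (U i \<omega>)) \<le> (\<Sum>i\<in>I. X (U i \<omega>))" by (intro sum_mono X'_b)
    moreover have "?k * (3 / 4 * m) \<le> ?k * (\<integral>u. X' u \<partial>uniform01)" using mean' k by (intro mult_left_mono) auto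
    ultimately show "?k * m / 4 \<le> \<bar>(\<Sum>i\<in>I. X' (U i \<omega>)) - ?k * (\<integral>u. X' u \<partial>uniform01)\<bar>" "\<omega> \<in> space M"
      by linarith+
  qed measurable
  also have "\<dots> \<le> ?k * (\<integral>u. (X' u)\<^sup>2 \<partial>uniform01) / (?k * m / 4)\<^sup>2"
    using k m X'_b by (intro prob_sum_U_deviation I) auto
  also have "\<dots> \<le> ?k * (L * ?k * m\<^sup>2) / (?k * m / 4)\<^sup>2"
    using sq k by (intro divide_right_mono mult_left_mono) auto
  also have "\<dots> = 16 * L" using k m by (simp add: power2_eq_square)
  finally show ?thesis .
qed

lemma prob_order_stat_ge:
  assumes k: "1 \<le> k" "k < n" and w: "2 * real k / real n \<le> 1"
  shows "prob {\<omega>\<in>space M. 2 * real k / real n \<le> order_stat U n (k + 1) \<omega>} \<le> 6 / real k"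
proof -
  \<comment> \<open>A point between k/n and 2k/n. The number of variables up to \<open>x\<close> has
    mean 3k/2 but must not exceed k, a deviation of k/2; Chebyshev then gives (3k/2) / (k/2)^2 =
    6/k.\<close>
  define x where "x = 3 / 2 * real k / real n"
  have n: "real n > 0" using k by simp
  have x: "0 < x" "x < 2 * real k / real n" "x \<le> 1" "real n * x = 3 / 2 * real k"
    using k n w by (auto simp: x_def field_simps)
  let ?f = "\<lambda>u. if u \<le> x then 1 else 0 :: real"
  have "{0<..<1} \<inter> {..x} = (if x = 1 then {0<..<1} else {0<..x})" using x by auto
  then have "measure uniform01 {..x} = x"
    using x by (simp add: measure_def ennreal_divide_one)
  moreover have "(\<integral>u. ?f u \<partial>uniform01) = (\<integral>u. indicator {..x} u \<partial>uniform01)"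
    by (intro Bochner_Integration.integral_cong) (auto simp: indicator_def)
  ultimately have f1: "(\<integral>u. ?f u \<partial>uniform01) = x" by simp
  have f2: "(\<integral>u. (?f u)\<^sup>2 \<partial>uniform01) = x"
    by (subst f1[symmetric], intro Bochner_Integration.integral_cong) auto
  have "prob {\<omega>\<in>space M. 2 * real k / real n \<le> order_stat U n (k + 1) \<omega>} \<le>
    prob {\<omega>\<in>space M. real k / 2 \<le> \<bar>(\<Sum>i\<in>{1..n}. ?f (U i \<omega>)) - real (card {1..n}) * (\<integral>u. ?f u \<partial>uniform01)\<bar>}"
  proof (intro finite_measure_mono subsetI CollectI conjI)
    fix \<omega> assume "\<omega> \<in> {\<omega>\<in>space M. 2 * real k / real n \<le> order_stat U n (k + 1) \<omega>}"
    then have "\<not> order_stat U n (k + 1) \<omega> \<le> x" "\<omega> \<in> space M" using x by auto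
    then have "card {j\<in>{1..n}. U j \<omega> \<le> x} \<le> k"
      using order_stat_le_iff[of "k + 1" n U \<omega> x] k by auto
    moreover have "real (card {j\<in>{1..n}. U j \<omega> \<le> x}) = (\<Sum>j\<in>{1..n}. ?f (U j \<omega>))"
      by (subst sum.inter_filter[symmetric]) auto
    ultimately show "real k / 2 \<le> \<bar>(\<Sum>i\<in>{1..n}. ?f (U i \<omega>)) - real (card {1..n}) * (\<integral>u. ?f u \<partial>uniform01)\<bar>" "\<omega> \<in> space M"
      using x(4) \<open>\<omega> \<in> space M\<close> unfolding f1 by (simp_all del: sum.inter_filter)
  qed measurable
  also have "\<dots> \<le> real (card {1..n}) * (\<integral>u. (?f u)\<^sup>2 \<partial>uniform01) / (real k / 2)\<^sup>2"
    by (rule prob_sum_U_deviation[where B=1]) (use k in auto)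
  also have "real (card {1..n}) * (\<integral>u. (?f u)\<^sup>2 \<partial>uniform01) = 3 / 2 * real k"
    unfolding f2 using x(4) by simp
  also have "3 / 2 * real k / (real k / 2)\<^sup>2 = 6 / real k"
    using k by (simp add: power2_eq_square)
  finally show ?thesis .
qed

text \<open>A triangular array: summands and index sets change with n. The k-th powers of the
  characteristic function and of 1 - t^2/(2k) differ by at most k times the difference of the bases,
  so the Lyapunov ratio bounds the whole error.\<close>

lemma lyapunov_clt:
  fixes X :: "nat \<Rightarrow> real \<Rightarrow> real" and I :: "nat \<Rightarrow> nat set" and r :: real
  assumes X[measurable]: "\<And>n. X n \<in> borel_measurable borel"
    and I: "\<And>n. finite (I n)" "\<And>n. I n \<subseteq> {1..}"
    and card: "filterlim (\<lambda>n. card (I n)) at_top sequentially"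
    and moments: "eventually (\<lambda>n. integrable uniform01 (X n) \<and> (\<integral>u. X n u \<partial>uniform01) = 0 \<and>
      integrable uniform01 (\<lambda>u. (X n u)\<^sup>2) \<and> (\<integral>u. (X n u)\<^sup>2 \<partial>uniform01) = 1 \<and>
      integrable uniform01 (\<lambda>u. \<bar>X n u\<bar> powr r)) sequentially"
    and r: "2 < r" "r \<le> 3"
    and lyapunov: "(\<lambda>n. (\<integral>u. \<bar>X n u\<bar> powr r \<partial>uniform01) / real (card (I n)) powr (r / 2 - 1)) \<longlonglongrightarrow> 0"
  shows "weak_conv_m (\<lambda>n. distr M borel (\<lambda>\<omega>. (\<Sum>i\<in>I n. X n (U i \<omega>)) / sqrt (real (card (I n))))) std_normal_distribution"
proof (rule levy_continuity)
  interpret u: prob_space uniform01 by (rule prob_space_uniform01)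
  show "real_distribution (distr M borel (\<lambda>\<omega>. (\<Sum>i\<in>I n. X n (U i \<omega>)) / sqrt (real (card (I n)))))" for n
    by (intro real_distribution_distr borel_measurable_divide sum_U_measurable[OF I(2)]) simp_all
  show "real_distribution std_normal_distribution" by (rule real_dist_normal_dist)
  fix t :: real
  define k where "k n = real (card (I n))" for n
  define \<mu> where "\<mu> n = distr uniform01 borel (X n)" for n
  define s where "s n = t / sqrt (k n)" for n
  have \<mu>: "real_distribution (\<mu> n)" for n unfolding \<mu>_def by (rule u.real_distribution_distr) simp
  have k_top: "filterlim k at_top sequentially"
    unfolding k_def using card by (rule filterlim_compose[OF filterlim_real_sequentially])
  have char: "char (distr M borel (\<lambda>\<omega>. (\<Sum>i\<in>I n. X n (U i \<omega>)) / sqrt (k n))) t = char (\<mu> n) (s n) ^ card (I n)" for n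
  proof -
    have "char (distr M borel (\<lambda>\<omega>. \<Sum>i\<in>I n. X n (U i \<omega>) / sqrt (k n))) t
        = (\<Prod>i\<in>I n. char (distr M borel (\<lambda>\<omega>. X n (U i \<omega>) / sqrt (k n))) t)"
      by (rule char_distr_sum) (rule indep_vars_comp_U[OF I(2)], simp)
    also have "\<dots> = (\<Prod>i\<in>I n. char (\<mu> n) (s n))"
    proof (rule prod.cong)
      fix i assume i: "i \<in> I n"
      then have i1: "i \<ge> 1" using I(2) by auto
      have "distr M borel (\<lambda>\<omega>. X n (U i \<omega>) / sqrt (k n)) = distr (distr M borel (U i)) borel (\<lambda>u. X n u / sqrt (k n))"
        using i1 by (subst distr_distr) (auto simp: o_def)
      also have "\<dots> = distr uniform01 borel (\<lambda>u. X n u / sqrt (k n))" by (simp only: unif[OF i1])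
      finally show "char (distr M borel (\<lambda>\<omega>. X n (U i \<omega>) / sqrt (k n))) t = char (\<mu> n) (s n)"
        by (simp add: char_def \<mu>_def integral_distr s_def)
    qed simp
    finally show ?thesis by (simp add: sum_divide_distrib)
  qed
  define L where "L n = (\<integral>u. \<bar>X n u\<bar> powr r \<partial>uniform01)" for n
  have bound: "eventually (\<lambda>n. cmod (char (\<mu> n) (s n) ^ card (I n) - complex_of_real ((1 + (-(t^2) / 2) / card (I n)) ^ card (I n)))
    \<le> (t\<^sup>2 * \<bar>t\<bar> powr (r - 2)) * (L n / k n powr (r / 2 - 1))) sequentially"
  proof -
    \<comment> \<open>The condition k \<ge> t^2/4 makes 1 - t^2/(2k) at least -1, so that both bases
      have modulus at most 1.\<close>
    have "eventually (\<lambda>n. k n > 0 \<and> k n \<ge> t\<^sup>2 / 4) sequentially"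
      using k_top[unfolded filterlim_at_top_dense, rule_format, of 0]
        k_top[unfolded filterlim_at_top, rule_format, of "t\<^sup>2 / 4"] by eventually_elim simp
    then show ?thesis using moments
    proof eventually_elim
      case (elim n)
      interpret \<mu>: real_distribution "\<mu> n" by (rule \<mu>)
      have intr: "integrable uniform01 (\<lambda>u. 6 * \<bar>s n\<bar> powr (r - 2) * \<bar>X n u\<bar> powr r)" using elim by auto
      have "(\<integral>u. min (6 * (X n u)\<^sup>2) (\<bar>s n\<bar> * \<bar>X n u\<bar> ^ 3) \<partial>uniform01) \<le> (\<integral>u. 6 * \<bar>s n\<bar> powr (r - 2) * \<bar>X n u\<bar> powr r \<partial>uniform01)"
        by (rule integral_mono_AE[OF Bochner_Integration.integrable_bound[OF intr] intr]) (auto intro!: AE_I2 min_square_cube_le_powr[OF r] order.trans[OF min_square_cube_le_powr[OF r]])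
      then have mn: "(\<integral>u. min (6 * (X n u)\<^sup>2) (\<bar>s n\<bar> * \<bar>X n u\<bar> ^ 3) \<partial>uniform01) \<le> 6 * \<bar>s n\<bar> powr (r - 2) * L n"
        by (simp add: L_def)
      have "cmod (char (\<mu> n) (s n) - (1 - (s n)\<^sup>2 * 1 / 2)) \<le> (s n)\<^sup>2 / 6 * (\<integral>u. min (6 * (X n u)\<^sup>2) (\<bar>s n\<bar> * \<bar>X n u\<bar> ^ 3) \<partial>uniform01)"
        using elim by (intro u.char_approx3'[OF _ _ _ _ _ \<mu>_def]) auto
      also have "\<dots> \<le> (s n)\<^sup>2 / 6 * (6 * \<bar>s n\<bar> powr (r - 2) * L n)"
        using mn by (intro mult_left_mono) auto
      finally have c: "cmod (char (\<mu> n) (s n) - (1 - (s n)\<^sup>2 / 2)) \<le> (s n)\<^sup>2 * \<bar>s n\<bar> powr (r - 2) * L n" by simp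
      have sq: "(s n)\<^sup>2 = t\<^sup>2 / k n" using elim by (simp add: s_def power_divide)
      have e: "complex_of_real (1 + (-(t^2) / 2) / card (I n)) = 1 - (s n)\<^sup>2 / 2"
        by (simp add: sq k_def flip: of_real_power)
      have c': "cmod (char (\<mu> n) (s n) - complex_of_real (1 + (-(t^2) / 2) / card (I n))) \<le> (s n)\<^sup>2 * \<bar>s n\<bar> powr (r - 2) * L n"
        unfolding e by (rule c)
      have "cmod (char (\<mu> n) (s n) ^ card (I n) - (complex_of_real (1 + (-(t^2) / 2) / card (I n))) ^ card (I n))
        \<le> card (I n) * cmod (char (\<mu> n) (s n) - complex_of_real (1 + (-(t^2) / 2) / card (I n)))"
      proof (rule norm_power_diff)
        have "\<bar>1 + (-(t^2) / 2) / card (I n)\<bar> \<le> 1"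
          using elim by (intro abs_leI) (auto simp: k_def field_simps)
        then show "cmod (complex_of_real (1 + (-(t^2) / 2) / card (I n))) \<le> 1" by (simp only: norm_of_real)
      qed (rule \<mu>.cmod_char_le_1)
      also have "\<dots> \<le> card (I n) * ((s n)\<^sup>2 * \<bar>s n\<bar> powr (r - 2) * L n)"
        using c' by (intro mult_left_mono) auto
      also have "\<dots> = (t\<^sup>2 * \<bar>t\<bar> powr (r - 2)) * (L n / k n powr (r / 2 - 1))"
      proof -
        have "\<bar>s n\<bar> powr (r - 2) = \<bar>t\<bar> powr (r - 2) / k n powr (r / 2 - 1)"
          using elim by (simp add: s_def abs_divide powr_divide powr_half_sqrt[symmetric] powr_powr diff_divide_distrib)
        then show ?thesis using elim unfolding sq by (simp add: k_def)
      qed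
      finally show ?case by simp
    qed
  qed
  have lim0: "(\<lambda>n. (t\<^sup>2 * \<bar>t\<bar> powr (r - 2)) * (L n / k n powr (r / 2 - 1))) \<longlonglongrightarrow> 0"
    using tendsto_mult[OF tendsto_const lyapunov] by (simp add: L_def k_def)
  have "(\<lambda>m. (1 + (-(t^2) / 2) / real m) ^ m) \<longlonglongrightarrow> exp (-(t^2) / 2)"
    by (rule tendsto_exp_limit_sequentially)
  then have "(\<lambda>n. (1 + (-(t^2) / 2) / real (card (I n))) ^ card (I n)) \<longlonglongrightarrow> exp (-(t^2) / 2)"
    by (rule filterlim_compose) (rule card)
  then have "(\<lambda>n. complex_of_real ((1 + (-(t^2) / 2) / real (card (I n))) ^ card (I n))) \<longlonglongrightarrow> complex_of_real (exp (-(t^2) / 2))"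
    by (rule tendsto_of_real)
  then have "(\<lambda>n. char (\<mu> n) (s n) ^ card (I n)) \<longlonglongrightarrow> complex_of_real (exp (-(t^2) / 2))"
    by (rule Lim_transform) (rule Lim_null_comparison[OF bound lim0])
  then show "(\<lambda>n. char (distr M borel (\<lambda>\<omega>. (\<Sum>i\<in>I n. X n (U i \<omega>)) / sqrt (real (card (I n))))) t) \<longlonglongrightarrow> char std_normal_distribution t"
    using char by (simp add: char_std_normal_distribution k_def)
qed

end

section \<open>Reduction to rows of independent variables\<close>

text \<open>The thresholds move with n; monotonicity of each cdf traps the moving value between the
  fixed points \<open>x0 - d / 2\<close> and \<open>x0 + d / 2\<close>.\<close>

lemma weak_conv_m_cdf_tendsto:
  assumes \<mu>: "\<And>n. real_distribution (\<mu> n)" and N: "real_distribution N" and conv: "weak_conv_m \<mu> N"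
    and cont: "\<And>y. isCont (cdf N) y" and x: "x \<longlonglongrightarrow> x0"
  shows "(\<lambda>n. cdf (\<mu> n) (x n)) \<longlonglongrightarrow> cdf N x0"
proof (rule tendstoI)
  fix e :: real assume e: "e > 0"
  have lim: "(\<lambda>n. cdf (\<mu> n) y) \<longlonglongrightarrow> cdf N y" for y
    using conv cont unfolding weak_conv_m_def weak_conv_def by auto
  obtain d where d: "d > 0" "\<And>y. \<bar>y - x0\<bar> < d \<Longrightarrow> \<bar>cdf N y - cdf N x0\<bar> < e / 2"
    using cont[of x0] e unfolding continuous_at_eps_delta dist_real_def by (metis half_gt_zero)
  have N1: "\<bar>cdf N (x0 - d / 2) - cdf N x0\<bar> < e / 2" "\<bar>cdf N (x0 + d / 2) - cdf N x0\<bar> < e / 2"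
    using d by auto
  have "eventually (\<lambda>n. dist (x n) x0 < d / 2) sequentially" using x d by (intro tendstoD) auto
  moreover have "eventually (\<lambda>n. dist (cdf (\<mu> n) (x0 - d / 2)) (cdf N (x0 - d / 2)) < e / 2) sequentially"
    using lim e by (intro tendstoD) auto
  moreover have "eventually (\<lambda>n. dist (cdf (\<mu> n) (x0 + d / 2)) (cdf N (x0 + d / 2)) < e / 2) sequentially"
    using lim e by (intro tendstoD) auto
  ultimately show "eventually (\<lambda>n. dist (cdf (\<mu> n) (x n)) (cdf N x0) < e) sequentially"
  proof eventually_elim
    case (elim n)
    interpret real_distribution "\<mu> n" by (rule \<mu>)
    have "cdf (\<mu> n) (x0 - d / 2) \<le> cdf (\<mu> n) (x n)" "cdf (\<mu> n) (x n) \<le> cdf (\<mu> n) (x0 + d / 2)"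
      using elim(1) unfolding dist_real_def by (intro cdf_nondecreasing; linarith)+
    then show ?case using elim(2,3) N1 unfolding dist_real_def by linarith
  qed
qed

lemma isCont_cdf_std_normal: "isCont (cdf std_normal_distribution) x"
proof -
  interpret real_distribution std_normal_distribution by (rule real_dist_normal_dist)
  have "{x} \<in> null_sets lborel" by auto
  moreover have "absolutely_continuous lborel std_normal_distribution"
    by (intro absolutely_continuousI_density) simp
  ultimately have "{x} \<in> null_sets std_normal_distribution" by (auto simp: absolutely_continuous_def)
  then show ?thesis by (simp add: isCont_cdf measure_def null_setsD1)
qed

locale power_hill = iid_uniform M U + regular_tail D Q l \<gamma>
  for M :: "'a measure" and U D Q l \<gamma> +
  fixes k :: "nat \<Rightarrow> nat" and p :: "nat \<Rightarrow> real" and \<alpha> :: real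
  assumes k_bounds: "\<And>n. n \<ge> 1 \<Longrightarrow> 1 \<le> k n \<and> k n \<le> n"
    and k_top: "filterlim k at_top sequentially"
    and k_ratio: "(\<lambda>n. real (k n) / real n) \<longlonglongrightarrow> 0"
    and \<alpha>_pos: "\<alpha> > 0"
    and p_eq: "\<And>n. p n = 1 / \<alpha> * ln (real (k n))"
begin

lemma k_top_real: "filterlim (\<lambda>n. real (k n)) at_top sequentially"
  by (rule filterlim_compose[OF filterlim_real_sequentially k_top])

lemma p_top: "filterlim p at_top sequentially"
proof -
  have "filterlim (\<lambda>n. 1 / \<alpha> * ln (real (k n))) at_top sequentially"
    using \<alpha>_pos by (intro filterlim_tendsto_pos_mult_at_top[OF tendsto_const]
      filterlim_compose[OF ln_at_top k_top_real]) auto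
  then show ?thesis by (simp add: p_eq[abs_def])
qed

lemma p_pos: "eventually (\<lambda>n. 0 < p n) sequentially"
  using p_top by (simp add: filterlim_at_top_dense)

lemma k_exp: "n \<ge> 1 \<Longrightarrow> real (k n) = exp (\<alpha> * p n)"
  using k_bounds[of n] \<alpha>_pos by (simp add: p_eq)

lemma k_powr: "n \<ge> 1 \<Longrightarrow> real (k n) powr c = exp (c * \<alpha> * p n)"
  using k_bounds[of n] by (simp add: k_exp powr_def mult_ac)

definition w :: "nat \<Rightarrow> real" where "w n = 2 * real (k n) / real n"

lemma w_tendsto: "w \<longlonglongrightarrow> 0"
  using tendsto_mult[OF tendsto_const[of 2] k_ratio] by (simp add: w_def[abs_def])

lemma w_pos: "n \<ge> 1 \<Longrightarrow> 0 < w n"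
  using k_bounds[of n] by (simp add: w_def)

lemma eventually_k_less: "eventually (\<lambda>n. n \<ge> 1 \<and> 1 \<le> k n \<and> k n < n \<and> w n \<le> 1) sequentially"
proof -
  have "eventually (\<lambda>n. w n < 1) sequentially" using w_tendsto by (rule order_tendstoD) simp
  then show ?thesis using eventually_ge_at_top[of 1]
  proof eventually_elim
    case (elim n)
    then show ?case using k_bounds[of n] by (simp add: w_def divide_simps)
  qed
qed

text \<open>
  The bound \<open>v < w\<close> matters only for deterministic centering, where \<open>w\<close> is the point at which the
  second-order remainder is evaluated.
\<close>

definition row :: "(nat \<Rightarrow> real) \<Rightarrow> (nat \<Rightarrow> nat set) \<Rightarrow> bool" where
  "row v I \<longleftrightarrow> filterlim v (at_right 0) sequentially \<and> eventually (\<lambda>n. v n < w n) sequentially \<and>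
    (\<forall>n. finite (I n) \<and> I n \<subseteq> {1..}) \<and> eventually (\<lambda>n. card (I n) = k n) sequentially"

definition S_row :: "(nat \<Rightarrow> real) \<Rightarrow> (nat \<Rightarrow> nat set) \<Rightarrow> nat \<Rightarrow> 'a \<Rightarrow> real" where
  "S_row v I n \<omega> = 1 / real (k n) * (\<Sum>i\<in>I n. Y_var Q (v n) (U i \<omega>) powr p n)"

lemma S_row_measurable [measurable]: "row v I \<Longrightarrow> S_row v I n \<in> borel_measurable M"
  unfolding S_row_def[abs_def] row_def by (intro borel_measurable_times sum_U_measurable) auto

text \<open>\<open>prob_order_stat_approx\<close> wants an error uniform in \<open>v\<close> and
  \<open>I\<close>, while limit theorems speak of sequences; uniformity follows by contradiction.
  Events for pairs are needed because in (ii) the normalisation depends on the order statistic as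
  well.\<close>

lemma S_stat_tendsto_of_rows:
  assumes B: "\<And>n. B n \<in> sets (borel \<Otimes>\<^sub>M borel)" and q: "0 \<le> q" "q \<le> 1"
    and rows: "\<And>v I. row v I \<Longrightarrow> (\<lambda>n. prob {\<omega>\<in>space M. (v n, S_row v I n \<omega>) \<in> B n}) \<longlonglongrightarrow> q"
  shows "(\<lambda>n. prob {\<omega>\<in>space M. (order_stat U n (k n + 1) \<omega>, S_stat Q U (k n) n (p n) \<omega>) \<in> B n}) \<longlonglongrightarrow> q"
proof (rule tendstoI)
  fix e :: real assume e: "e > 0"
  define good where "good n v I \<longleftrightarrow> 0 < v \<and> v < w n \<and> I \<subseteq> {1..n} \<and> card I = k n" for n v I
  define P where "P n v I = prob {\<omega>\<in>space M. (v, 1 / real (k n) * (\<Sum>i\<in>I. Y_var Q v (U i \<omega>) powr p n)) \<in> B n}" for n v I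
  define bad where "bad n v I \<longleftrightarrow> good n v I \<and> \<not> \<bar>P n v I - q\<bar> \<le> e / 2" for n v I
  \<comment> \<open>Otherwise selecting a bad pair wherever there is one gives a row violating \<open>rows\<close>.\<close>
  have uniform: "eventually (\<lambda>n. \<forall>v I. \<not> bad n v I) sequentially"
  proof (rule ccontr)
    assume contra: "\<not> eventually (\<lambda>n. \<forall>v I. \<not> bad n v I) sequentially"
    \<comment> \<open>The default pair lies strictly below \<open>w n\<close> and has the right
      cardinality, so the selection is a row even if bad pairs occur only for some n.\<close>
    define sel where "sel n = (if \<exists>vI. bad n (fst vI) (snd vI) then (SOME vI. bad n (fst vI) (snd vI)) else (w n / 2, {1..k n}))" for n
    define v where "v n = fst (sel n)" for n
    define I where "I n = snd (sel n)" for n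
    have sel: "bad n (v n) (I n) \<or> (v n = w n / 2 \<and> I n = {1..k n})" for n
      using someI_ex[of "\<lambda>vI. bad n (fst vI) (snd vI)"] by (auto simp: v_def I_def sel_def)
    have bad_sel: "bad n (v n) (I n)" if "bad n v' I'" for n v' I'
      using someI[of "\<lambda>vI. bad n (fst vI) (snd vI)" "(v', I')"] that by (auto simp: v_def I_def sel_def)
    have v_bounds: "0 < v n \<and> v n < w n" if "n \<ge> 1" for n
      using sel[of n] w_pos[OF that] by (auto simp: bad_def good_def)
    have ev: "eventually (\<lambda>n. 0 < v n \<and> v n < w n) sequentially"
      using v_bounds by (rule eventually_sequentiallyI)
    have "row v I"
    proof -
      have "v \<longlonglongrightarrow> 0"
        by (rule tendsto_sandwich[OF _ _ tendsto_const w_tendsto])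
          (use ev in \<open>auto elim!: eventually_mono\<close>)
      then have "filterlim v (at_right 0) sequentially"
        using ev by (auto simp: filterlim_at elim!: eventually_mono)
      moreover have "finite (I n) \<and> I n \<subseteq> {1..} \<and> card (I n) = k n" for n
        using sel[of n] by (auto simp: bad_def good_def intro: finite_subset)
      ultimately show ?thesis
        unfolding row_def using ev by (auto elim!: eventually_mono)
    qed
    from tendstoD[OF rows[OF this], of "e / 2"] e
    have "eventually (\<lambda>n. dist (P n (v n) (I n)) q < e / 2) sequentially"
      by (simp add: P_def S_row_def)
    then have "eventually (\<lambda>n. \<not> bad n (v n) (I n)) sequentially"
      by (rule eventually_mono) (auto simp: bad_def dist_real_def)
    then have "eventually (\<lambda>n. \<forall>v I. \<not> bad n v I) sequentially"
      by (rule eventually_mono) (use bad_sel in blast)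
    with contra show False by contradiction
  qed
  \<comment> \<open>Twice the bound 6/k for the probability that the order statistic reaches
    \<open>w n\<close>; the other half of \<open>e\<close> pays for the rows.\<close>
  have "(\<lambda>n. 12 / real (k n)) \<longlonglongrightarrow> 0"
    by (rule real_tendsto_divide_at_top[OF tendsto_const k_top_real])
  then have "eventually (\<lambda>n. 12 / real (k n) < e / 2) sequentially"
    by (rule order_tendstoD) (use e in simp)
  then show "eventually (\<lambda>n. dist (prob {\<omega>\<in>space M. (order_stat U n (k n + 1) \<omega>, S_stat Q U (k n) n (p n) \<omega>) \<in> B n}) q < e) sequentially"
    using uniform eventually_k_less
  proof eventually_elim
    case (elim n)
    \<comment> \<open>\<open>prob_order_stat_approx\<close> is stated for plain sums; pulling
      \<open>B n\<close> back along \<open>?h\<close> restores the factor 1/k.\<close>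
    let ?h = "\<lambda>x :: real \<times> real. (fst x, 1 / real (k n) * snd x)"
    let ?B = "?h -` B n"
    have "?h \<in> (borel \<Otimes>\<^sub>M borel) \<rightarrow>\<^sub>M (borel \<Otimes>\<^sub>M borel)" by measurable
    from measurable_sets[OF this B[of n]] have B': "?B \<in> sets (borel \<Otimes>\<^sub>M borel)"
      by (simp add: space_pair_measure)
    define g where "g u v = ln (Q (1 - u) / Q (1 - v)) powr p n" for u v
    have g: "(\<lambda>(u, v). g u v) \<in> borel_measurable (borel \<Otimes>\<^sub>M borel)" unfolding g_def by measurable
    have "\<bar>prob {\<omega>\<in>space M. (order_stat U n (k n + 1) \<omega>,
        \<Sum>i=1..k n. g (order_stat U n i \<omega>) (order_stat U n (k n + 1) \<omega>)) \<in> ?B} - q\<bar>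
      \<le> e / 2 + 2 * prob {\<omega>\<in>space M. w n \<le> order_stat U n (k n + 1) \<omega>}"
    proof (rule prob_order_stat_approx[OF _ _ _ _ q _ g B'])
      fix v I assume v: "0 < v" "v < w n" and I: "I \<subseteq> {1..n}" "card I = k n"
      then have "good n v I" by (simp add: good_def)
      then have "\<bar>P n v I - q\<bar> \<le> e / 2" using elim by (auto simp: bad_def)
      then show "\<bar>prob {\<omega>\<in>space M. (v, \<Sum>i\<in>I. g (v * U i \<omega>) v) \<in> ?B} - q\<bar> \<le> e / 2"
        by (simp add: P_def g_def Y_var_def mult.commute)
    qed (use elim e w_pos[of n] in auto)
    moreover have "2 * prob {\<omega>\<in>space M. w n \<le> order_stat U n (k n + 1) \<omega>} \<le> 12 / real (k n)"
      using prob_order_stat_ge[of "k n" n, folded w_def] elim(3) by simp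
    ultimately show ?case
      using elim(1) by (simp add: dist_real_def S_stat_def g_def)
  qed
qed

section \<open>Variance asymptotics and the central limit theorem along rows\<close>

lemma sigma_fun_squared:
  assumes "integrable uniform01 (\<lambda>u. Y_var Q v u powr q)" "integrable uniform01 (\<lambda>u. Y_var Q v u powr (2 * q))"
  shows "(sigma_fun Q q v)\<^sup>2 = m_fun Q (2 * q) v - (m_fun Q q v)\<^sup>2"
proof -
  interpret u: prob_space uniform01 by (rule prob_space_uniform01)
  have sq: "(Y_var Q v u powr q)\<^sup>2 = Y_var Q v u powr (2 * q)" for u
    by (simp add: power2_eq_square powr_add[symmetric])
  have "(sigma_fun Q q v)\<^sup>2 = u.variance (\<lambda>u. Y_var Q v u powr q)"
    unfolding sigma_fun_def by (rule real_sqrt_pow2) (rule u.variance_positive)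
  also have "\<dots> = m_fun Q (2 * q) v - (m_fun Q q v)\<^sup>2"
    using assms by (subst u.variance_eq) (simp_all add: sq m_fun_def)
  finally show ?thesis .
qed

text \<open>The case c = 2, \<theta> = 0, as 2 ln 2 > 0. Since p tends to infinity the squared mean
  is negligible, and the variance is asymptotically the second moment.\<close>

lemma mean_square_ratio_tendsto_0:
  assumes v: "filterlim v (at_right 0) sequentially"
  shows "(\<lambda>n. (m_fun Q (p n) (v n))\<^sup>2 / m_fun Q (2 * p n) (v n)) \<longlonglongrightarrow> 0"
proof (rule Lim_transform_eventually)
  show "(\<lambda>n. m_fun Q (p n) (v n) powr 2 * exp (0 * p n) / m_fun Q (2 * p n) (v n)) \<longlonglongrightarrow> 0"
    by (rule moment_inverse_ratio_tendsto_0[OF v p_top]) auto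
  show "eventually (\<lambda>n. m_fun Q (p n) (v n) powr 2 * exp (0 * p n) / m_fun Q (2 * p n) (v n) =
      (m_fun Q (p n) (v n))\<^sup>2 / m_fun Q (2 * p n) (v n)) sequentially"
    using eventually_moments[OF v] p_pos 
  proof eventually_elim
    case (elim n)
    then have "0 < m_fun Q (p n) (v n)" by auto
    then show ?case by (simp add: powr_numeral)
  qed
qed

lemma eventually_sigma:
  assumes v: "filterlim v (at_right 0) sequentially"
  shows "eventually (\<lambda>n. 0 < m_fun Q (p n) (v n) \<and> 0 < m_fun Q (2 * p n) (v n) \<and> 0 < sigma_fun Q (p n) (v n) \<and>
    (sigma_fun Q (p n) (v n))\<^sup>2 = m_fun Q (2 * p n) (v n) - (m_fun Q (p n) (v n))\<^sup>2 \<and>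
    m_fun Q (2 * p n) (v n) / 2 \<le> (sigma_fun Q (p n) (v n))\<^sup>2) sequentially"
proof -
  have "eventually (\<lambda>n. (m_fun Q (p n) (v n))\<^sup>2 / m_fun Q (2 * p n) (v n) < 1 / 2) sequentially"
    by (rule order_tendstoD[OF mean_square_ratio_tendsto_0[OF v]]) simp
  then show ?thesis using eventually_moments[OF v] p_pos
  proof eventually_elim
    case (elim n)
    then have pos: "0 < m_fun Q (p n) (v n)" "0 < m_fun Q (2 * p n) (v n)" by auto
    have sq: "(sigma_fun Q (p n) (v n))\<^sup>2 = m_fun Q (2 * p n) (v n) - (m_fun Q (p n) (v n))\<^sup>2"
      using elim by (intro sigma_fun_squared) auto
    have half: "m_fun Q (2 * p n) (v n) / 2 \<le> (sigma_fun Q (p n) (v n))\<^sup>2"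
      using elim(1) pos unfolding sq by (simp add: field_simps)
    then have "sigma_fun Q (p n) (v n) \<noteq> 0" using pos by auto
    moreover have "sigma_fun Q (p n) (v n) \<ge> 0"
      unfolding sigma_fun_def by (auto intro!: integral_nonneg_AE)
    ultimately show ?case using pos sq half by simp
  qed
qed

text \<open>Thresholds varying with n are allowed because solving the root inequality for S gives
  such thresholds; only the limit of their standardised form matters.\<close>

lemma row_clt:
  assumes \<alpha>: "\<alpha> > 2" and row: "row v I"
    and s: "(\<lambda>n. (s n - m_fun Q (p n) (v n)) * sqrt (real (k n)) / sigma_fun Q (p n) (v n)) \<longlonglongrightarrow> x"
  shows "(\<lambda>n. prob {\<omega>\<in>space M. S_row v I n \<omega> \<le> s n}) \<longlonglongrightarrow> cdf std_normal_distribution x"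
proof -
  interpret u: prob_space uniform01 by (rule prob_space_uniform01)
  have v: "filterlim v (at_right 0) sequentially" and I: "\<And>n. finite (I n)" "\<And>n. I n \<subseteq> {1..}"
    and card: "eventually (\<lambda>n. card (I n) = k n) sequentially"
    using row by (auto simp: row_def)
  \<comment> \<open>\<open>c\<close> is the midpoint of 1 and \<open>b\<close>. Below \<alpha>/2 it
    satisfies c ln c \<le> c (c - 1) < \<alpha>/2 (c - 1); below 3/2 the Lyapunov order 2c stays
    within 3.\<close>
  define b where "b = min (\<alpha> / 2) (3 / 2)"
  define c where "c = (1 + b) / 2"
  have c: "1 < c" "c < \<alpha> / 2" "2 * c \<le> 3" using \<alpha> by (auto simp: c_def b_def min_def field_simps)
  have "c * ln c \<le> c * (c - 1)" using c by (intro mult_left_mono ln_le_minus_one) auto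
  also have "\<dots> < \<alpha> / 2 * (c - 1)" using c by (intro mult_strict_right_mono) auto
  finally have rate: "c * ln c < \<alpha> / 2 * (c - 1)" .
  have p2_top: "filterlim (\<lambda>n. 2 * p n) at_top sequentially"
    by (intro filterlim_tendsto_pos_mult_at_top[OF tendsto_const _ p_top]) simp
  let ?m = "\<lambda>n. m_fun Q (p n) (v n)" and ?m2 = "\<lambda>n. m_fun Q (2 * p n) (v n)"
    and ?mr = "\<lambda>n. m_fun Q (c * (2 * p n)) (v n)" and ?\<sigma> = "\<lambda>n. sigma_fun Q (p n) (v n)"
  define X where "X n u = (Y_var Q (v n) u powr p n - ?m n) / ?\<sigma> n" for n u
  have [measurable]: "X n \<in> borel_measurable borel" for n unfolding X_def[abs_def] by measurable
  note ev = eventually_sigma[OF v] eventually_moments[OF v] p_pos eventually_k_less card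
  define L where "L n = (\<integral>u. \<bar>X n u\<bar> powr (2 * c) \<partial>uniform01)" for n
  have moments: "eventually (\<lambda>n. (integrable uniform01 (X n) \<and> (\<integral>u. X n u \<partial>uniform01) = 0 \<and>
      integrable uniform01 (\<lambda>u. (X n u)\<^sup>2) \<and> (\<integral>u. (X n u)\<^sup>2 \<partial>uniform01) = 1 \<and>
      integrable uniform01 (\<lambda>u. \<bar>X n u\<bar> powr (2 * c))) \<and>
      L n / real (card (I n)) powr (2 * c / 2 - 1) \<le>
        2 powr c * (?mr n / (?m2 n powr c * exp (\<alpha> / 2 * (c - 1) * (2 * p n))) + ((?m n)\<^sup>2 / ?m2 n) powr c)) sequentially"
    using ev
  proof eventually_elim
    case (elim n)
    let ?Y = "\<lambda>u. Y_var Q (v n) u powr p n"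
    have pos: "0 < ?m n" "0 < ?m2 n" "0 < ?\<sigma> n" and \<sigma>2: "(?\<sigma> n)\<^sup>2 = ?m2 n - (?m n)\<^sup>2" and half: "?m2 n / 2 \<le> (?\<sigma> n)\<^sup>2"
      using elim(1) by auto
    have sq: "(?Y u)\<^sup>2 = Y_var Q (v n) u powr (2 * p n)" for u
      by (simp add: power2_eq_square powr_add[symmetric])
    have int: "integrable uniform01 ?Y" "integrable uniform01 (\<lambda>u. (?Y u)\<^sup>2)"
      "integrable uniform01 (\<lambda>u. Y_var Q (v n) u powr (c * (2 * p n)))"
      using elim(2,3) c by (simp_all add: sq)
    have m: "(\<integral>u. ?Y u \<partial>uniform01) = ?m n" "(\<integral>u. (?Y u)\<^sup>2 \<partial>uniform01) = ?m2 n"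
      "(\<integral>u. Y_var Q (v n) u powr (c * (2 * p n)) \<partial>uniform01) = ?mr n"
      by (simp_all add: m_fun_def sq)
    have X1: "integrable uniform01 (X n)" "(\<integral>u. X n u \<partial>uniform01) = 0"
      using int m by (auto simp: X_def[abs_def] u.prob_space)
    have Xsq: "(X n u)\<^sup>2 = ((?Y u)\<^sup>2 - 2 * ?m n * ?Y u + (?m n)\<^sup>2) / (?\<sigma> n)\<^sup>2" for u
      by (simp add: X_def power_divide power2_diff mult_ac)
    have X2: "integrable uniform01 (\<lambda>u. (X n u)\<^sup>2)"
      unfolding Xsq using int by (intro integrable_divide_zero integrable_add integrable_diff integrable_mult_right) auto
    have "(\<integral>u. (X n u)\<^sup>2 \<partial>uniform01) = (?m2 n - 2 * ?m n * ?m n + (?m n)\<^sup>2) / (?\<sigma> n)\<^sup>2"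
      unfolding Xsq using int m by (simp add: u.prob_space)
    also have "?m2 n - 2 * ?m n * ?m n + (?m n)\<^sup>2 = (?\<sigma> n)\<^sup>2"
      unfolding \<sigma>2 by (simp add: power2_eq_square)
    also have "(?\<sigma> n)\<^sup>2 / (?\<sigma> n)\<^sup>2 = 1" using pos(3) by simp
    finally have X3: "(\<integral>u. (X n u)\<^sup>2 \<partial>uniform01) = 1" .
    have \<sigma>c: "(?\<sigma> n) powr (2 * c) \<ge> (?m2 n / 2) powr c"
    proof -
      have "(?\<sigma> n) powr (2 * c) = ((?\<sigma> n)\<^sup>2) powr c" using pos by (simp add: powr_powr flip: powr_numeral)
      then show ?thesis using half pos c by (auto intro!: powr_mono2)
    qed
    define K where "K = (?m2 n / 2) powr c"
    have K: "K > 0" using pos by (simp add: K_def)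
    have pw: "\<bar>X n u\<bar> powr (2 * c) \<le> (Y_var Q (v n) u powr (c * (2 * p n)) + ?m n powr (2 * c)) / K" for u
    proof -
      have "\<bar>X n u\<bar> powr (2 * c) = \<bar>?Y u - ?m n\<bar> powr (2 * c) / ?\<sigma> n powr (2 * c)"
        using pos by (simp add: X_def abs_divide powr_divide)
      also have "\<dots> \<le> \<bar>?Y u - ?m n\<bar> powr (2 * c) / K"
        using \<sigma>c K pos by (intro divide_left_mono) (auto simp: K_def intro!: mult_pos_pos)
      \<comment> \<open>Both numbers are nonnegative, so their distance is at most the larger one;
        no factor depending on the exponent arises.\<close>
      also have "\<bar>?Y u - ?m n\<bar> powr (2 * c) \<le> ?Y u powr (2 * c) + ?m n powr (2 * c)"
      proof (cases "?Y u \<le> ?m n")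
        case True
        then have "\<bar>?Y u - ?m n\<bar> powr (2 * c) \<le> ?m n powr (2 * c)"
          using c pos by (intro powr_mono2) (auto simp: abs_if)
        then show ?thesis by (simp add: add_increasing)
      next
        case False
        then have "\<bar>?Y u - ?m n\<bar> powr (2 * c) \<le> ?Y u powr (2 * c)"
          using c pos by (intro powr_mono2) (auto simp: abs_if)
        then show ?thesis by (simp add: add_increasing2)
      qed
      also have "?Y u powr (2 * c) = Y_var Q (v n) u powr (c * (2 * p n))" by (simp add: powr_powr mult_ac)
      finally show ?thesis using K by (simp add: divide_right_mono)
    qed
    have intK: "integrable uniform01 (\<lambda>u. (Y_var Q (v n) u powr (c * (2 * p n)) + ?m n powr (2 * c)) / K)"
      using int by auto
    have X4: "integrable uniform01 (\<lambda>u. \<bar>X n u\<bar> powr (2 * c))"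
      using K by (intro Bochner_Integration.integrable_bound[OF intK]) (auto intro!: AE_I2 order.trans[OF pw])
    have "L n \<le> (\<integral>u. (Y_var Q (v n) u powr (c * (2 * p n)) + ?m n powr (2 * c)) / K \<partial>uniform01)"
      unfolding L_def by (rule integral_mono[OF X4 intK pw])
    also have "\<dots> = (?mr n + ?m n powr (2 * c)) / K"
      using int m by (simp add: u.prob_space)
    finally have L: "L n \<le> (?mr n + ?m n powr (2 * c)) / K" .
    define k' where "k' = real (k n) powr (c - 1)"
    have k': "k' \<ge> 1" using elim(4) c unfolding k'_def by (intro ge_one_powr_ge_zero) auto
    \<comment> \<open>k\<hat>(c - 1) is exp(\<alpha>(c - 1)p), rewritten in terms of 2p because the
      ratio estimate is used for the sequence 2p.\<close>
    have k'_eq: "exp (\<alpha> / 2 * (c - 1) * (2 * p n)) = k'"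
      using elim(4) by (simp add: k'_def k_powr mult_ac)
    have Kinv: "1 / K = 2 powr c / ?m2 n powr c" using pos by (simp add: K_def powr_divide)
    have "L n / k' \<le> (?mr n + ?m n powr (2 * c)) / K / k'"
      using L k' by (intro divide_right_mono) auto
    also have "\<dots> = 2 powr c * (?mr n / (?m2 n powr c * k') + (?m n powr (2 * c) / ?m2 n powr c) / k')"
      using Kinv K k' pos by (simp add: field_simps)
    \<comment> \<open>The contribution of the mean tends to 0 without help from k, so dividing it by
      \<open>k' \<ge> 1\<close> is dropped.\<close>
    also have "\<dots> \<le> 2 powr c * (?mr n / (?m2 n powr c * k') + ?m n powr (2 * c) / ?m2 n powr c)"
    proof (intro mult_left_mono add_left_mono)
      show "?m n powr (2 * c) / ?m2 n powr c / k' \<le> ?m n powr (2 * c) / ?m2 n powr c"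
        using k' divide_left_mono[of 1 k' "?m n powr (2 * c) / ?m2 n powr c"] by simp
    qed simp
    also have "?m n powr (2 * c) / ?m2 n powr c = ((?m n)\<^sup>2 / ?m2 n) powr c"
      using pos by (simp add: powr_divide powr_powr flip: powr_numeral)
    finally have "L n / k' \<le> 2 powr c * (?mr n / (?m2 n powr c * k') + ((?m n)\<^sup>2 / ?m2 n) powr c)" .
    then show ?case using X1 X2 X3 X4 elim(5) unfolding k'_eq by (simp add: k'_def)
  qed
  have "(\<lambda>n. 2 powr c * (?mr n / (?m2 n powr c * exp (\<alpha> / 2 * (c - 1) * (2 * p n))) + ((?m n)\<^sup>2 / ?m2 n) powr c)) \<longlonglongrightarrow> 2 powr c * (0 + 0)"
  proof (intro tendsto_mult tendsto_add tendsto_const)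
    show "(\<lambda>n. ?mr n / (?m2 n powr c * exp (\<alpha> / 2 * (c - 1) * (2 * p n)))) \<longlonglongrightarrow> 0"
      by (rule moment_ratio_tendsto_0[OF v p2_top _ rate]) (use c in simp)
    show "(\<lambda>n. ((?m n)\<^sup>2 / ?m2 n) powr c) \<longlonglongrightarrow> 0"
    proof (rule tendsto_zero_powrI[OF mean_square_ratio_tendsto_0[OF v] tendsto_const])
      show "eventually (\<lambda>n. 0 \<le> (?m n)\<^sup>2 / ?m2 n) sequentially"
        using ev(1) by eventually_elim simp
    qed (use c in simp)
  qed
  then have upper: "(\<lambda>n. 2 powr c * (?mr n / (?m2 n powr c * exp (\<alpha> / 2 * (c - 1) * (2 * p n))) + ((?m n)\<^sup>2 / ?m2 n) powr c)) \<longlonglongrightarrow> 0"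
    by simp
  have lyapunov: "(\<lambda>n. L n / real (card (I n)) powr (2 * c / 2 - 1)) \<longlonglongrightarrow> 0"
  proof (rule tendsto_sandwich[OF _ _ tendsto_const upper])
    show "eventually (\<lambda>n. 0 \<le> L n / real (card (I n)) powr (2 * c / 2 - 1)) sequentially"
      by (auto simp: L_def intro!: always_eventually divide_nonneg_nonneg integral_nonneg_AE)
    show "eventually (\<lambda>n. L n / real (card (I n)) powr (2 * c / 2 - 1) \<le>
        2 powr c * (?mr n / (?m2 n powr c * exp (\<alpha> / 2 * (c - 1) * (2 * p n))) + ((?m n)\<^sup>2 / ?m2 n) powr c)) sequentially"
      using moments by (rule eventually_mono) blast
  qed
  have card_top: "filterlim (\<lambda>n. card (I n)) at_top sequentially"
    using k_top card by (subst filterlim_cong[OF refl refl card])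
  let ?\<zeta> = "\<lambda>n \<omega>. (\<Sum>i\<in>I n. X n (U i \<omega>)) / sqrt (real (card (I n)))"
  have conv: "weak_conv_m (\<lambda>n. distr M borel (?\<zeta> n)) std_normal_distribution"
    by (rule lyapunov_clt[where r="2 * c"])
      (use I card_top c lyapunov moments in \<open>auto simp: L_def elim!: eventually_mono\<close>)
  have \<zeta>_meas: "?\<zeta> n \<in> borel_measurable M" for n
    by (intro borel_measurable_divide sum_U_measurable I) auto
  have "(\<lambda>n. cdf (distr M borel (?\<zeta> n)) ((s n - ?m n) * sqrt (real (k n)) / ?\<sigma> n)) \<longlonglongrightarrow> cdf std_normal_distribution x"
    by (rule weak_conv_m_cdf_tendsto[OF _ real_dist_normal_dist conv isCont_cdf_std_normal s])
      (use \<zeta>_meas in auto)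
  then show ?thesis
  proof (rule Lim_transform_eventually)
    show "eventually (\<lambda>n. cdf (distr M borel (?\<zeta> n)) ((s n - ?m n) * sqrt (real (k n)) / ?\<sigma> n) =
        prob {\<omega>\<in>space M. S_row v I n \<omega> \<le> s n}) sequentially"
      using ev
    proof eventually_elim
      case (elim n)
      have \<sigma>: "?\<sigma> n > 0" and kn: "real (k n) > 0" using elim by auto
      have "?\<zeta> n \<omega> = (S_row v I n \<omega> - ?m n) * sqrt (real (k n)) / ?\<sigma> n" for \<omega>
      proof -
        have "(\<Sum>i\<in>I n. X n (U i \<omega>)) = (real (k n) * S_row v I n \<omega> - real (k n) * ?m n) / ?\<sigma> n"
          using elim(5) kn by (simp add: X_def S_row_def sum_subtractf flip: sum_divide_distrib)
        also have "\<dots> / sqrt (real (k n)) = (S_row v I n \<omega> - ?m n) * (real (k n) / sqrt (real (k n))) / ?\<sigma> n"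
          by (simp add: algebra_simps diff_divide_distrib)
        finally show ?thesis using elim(5) by (simp add: real_div_sqrt)
      qed
      then have "?\<zeta> n \<omega> \<le> (s n - ?m n) * sqrt (real (k n)) / ?\<sigma> n \<longleftrightarrow> S_row v I n \<omega> \<le> s n" for \<omega>
        using \<sigma> kn by (simp add: divide_le_cancel mult_le_cancel_right)
      moreover have "cdf (distr M borel (?\<zeta> n)) y = prob {\<omega>\<in>space M. ?\<zeta> n \<omega> \<le> y}" for y
        using \<zeta>_meas by (subst cdf_def, subst measure_distr) (auto intro!: arg_cong[where f=prob])
      ultimately show ?case by simp
    qed
  qed
qed

end

section \<open>Consistency and asymptotic normality\<close>

lemma powr_root_le_iff:
  fixes z b p :: real
  assumes "z \<ge> 0" "b > 0" "p > 0"
  shows "z powr (1 / p) \<le> b \<longleftrightarrow> z \<le> b powr p" and "b \<le> z powr (1 / p) \<longleftrightarrow> b powr p \<le> z"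
proof -
  have z: "z = (z powr (1 / p)) powr p" and b: "b = (b powr p) powr (1 / p)"
    using assms by (simp_all add: powr_powr)
  show "z powr (1 / p) \<le> b \<longleftrightarrow> z \<le> b powr p"
    using powr_mono2[of p "z powr (1 / p)" b] powr_mono2[of "1 / p" z "b powr p"] assms z b by auto
  show "b \<le> z powr (1 / p) \<longleftrightarrow> b powr p \<le> z"
    using powr_mono2[of p b "z powr (1 / p)"] powr_mono2[of "1 / p" "b powr p" z] assms z b by auto
qed

lemma powr_inverse_le_iff:
  fixes y m c p x :: real
  assumes "y \<ge> 0" "m > 0" "c > 0" "p > 0" "0 < 1 + c * x / p"
  shows "1 / c * p * ((y / m) powr (1 / p) - 1) \<le> x \<longleftrightarrow> y \<le> m * (1 + c * x / p) powr p"
proof -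
  have "1 / c * p * ((y / m) powr (1 / p) - 1) \<le> x \<longleftrightarrow> (y / m) powr (1 / p) \<le> 1 + c * x / p"
    using assms by (simp add: field_simps)
  also have "\<dots> \<longleftrightarrow> y / m \<le> (1 + c * x / p) powr p"
    using assms by (intro powr_root_le_iff) auto
  also have "\<dots> \<longleftrightarrow> y \<le> m * (1 + c * x / p) powr p"
    using assms by (simp add: field_simps)
  finally show ?thesis .
qed

text \<open>A delta method with growing exponent: p ln(1 + c x/p) differs from c x by at most 2 c^2
  x^2/p, so the power is 1 + c x to first order in the small parameter c.\<close>

lemma powr_threshold_tendsto:
  fixes c p :: "nat \<Rightarrow> real"
  assumes c: "c \<longlonglongrightarrow> 0" "eventually (\<lambda>n. 0 < c n) sequentially" and p: "filterlim p at_top sequentially"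
  shows "(\<lambda>n. ((1 + c n * x / p n) powr p n - 1) / c n) \<longlonglongrightarrow> x"
    and "eventually (\<lambda>n. 0 < 1 + c n * x / p n) sequentially"
proof -
  define z where "z n = c n * x / p n" for n
  have "(\<lambda>n. x / p n) \<longlonglongrightarrow> 0" by (rule real_tendsto_divide_at_top[OF tendsto_const p])
  then have xp: "(\<lambda>n. c n * (x / p n)) \<longlonglongrightarrow> 0 * 0" using c by (intro tendsto_intros)
  then have z: "z \<longlonglongrightarrow> 0" by (simp add: z_def[abs_def])
  have p0: "eventually (\<lambda>n. 0 < p n) sequentially" using p by (simp add: filterlim_at_top_dense)
  have zsmall: "eventually (\<lambda>n. dist (z n) 0 < 1 / 2) sequentially" using z by (intro tendstoD) auto
  then show "eventually (\<lambda>n. 0 < 1 + c n * x / p n) sequentially"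
    by eventually_elim (unfold z_def dist_real_def, linarith)
  define E where "E n = p n * ln (1 + z n)" for n
  have Ec: "(\<lambda>n. E n / c n - x) \<longlonglongrightarrow> 0"
  proof (rule Lim_null_comparison)
    show "eventually (\<lambda>n. norm (E n / c n - x) \<le> 2 * x * (c n * (x / p n))) sequentially"
      using zsmall p0 c(2)
    proof eventually_elim
      case (elim n)
      have "\<bar>ln (1 + z n) - z n\<bar> \<le> 2 * (z n)\<^sup>2"
        using elim(1) by (intro abs_ln_one_plus_x_minus_x_bound) (simp add: dist_real_def)
      then have "p n / c n * \<bar>ln (1 + z n) - z n\<bar> \<le> p n / c n * (2 * (z n)\<^sup>2)"
        using elim by (intro mult_left_mono) auto
      moreover have "E n / c n - x = p n / c n * (ln (1 + z n) - z n)"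
        using elim by (simp add: E_def z_def field_simps)
      moreover have "p n / c n * (2 * (z n)\<^sup>2) = 2 * x * (c n * (x / p n))"
        using elim by (simp add: z_def power2_eq_square field_simps)
      ultimately show ?case using elim by (simp add: abs_mult)
    qed
    show "(\<lambda>n. 2 * x * (c n * (x / p n))) \<longlonglongrightarrow> 0"
      using tendsto_mult[OF tendsto_const xp] by simp
  qed
  then have Ec': "(\<lambda>n. E n / c n) \<longlonglongrightarrow> x" by (simp add: LIM_zero_iff)
  have "(\<lambda>n. E n / c n * c n) \<longlonglongrightarrow> x * 0" using Ec' c by (intro tendsto_intros)
  then have "(\<lambda>n. E n / c n * c n) \<longlonglongrightarrow> 0" by (simp only: mult_zero_right)
  then have E0: "E \<longlonglongrightarrow> 0"
    by (rule Lim_transform_eventually) (use c(2) in \<open>auto elim!: eventually_mono\<close>)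
  \<comment> \<open>The continuous extension of (exp t - 1)/t to 0, needed because
    \<open>E n\<close> may vanish, for instance when \<open>x = 0\<close>.\<close>
  define \<phi> where "\<phi> t = (if t = 0 then 1 else (exp t - 1) / t)" for t :: real
  have "((\<lambda>t. (exp t - 1) / t) \<longlongrightarrow> 1) (at (0::real))" by (rule lim_exp_minus_1)
  then have "(\<phi> \<longlongrightarrow> 1) (at 0)"
    by (rule Lim_transform_eventually) (auto simp: \<phi>_def eventually_at_filter)
  then have "isCont \<phi> 0" by (simp add: isCont_def \<phi>_def)
  then have "(\<lambda>n. \<phi> (E n)) \<longlonglongrightarrow> \<phi> 0" using E0 by (rule isCont_tendsto_compose)
  then have "(\<lambda>n. \<phi> (E n) * (E n / c n)) \<longlonglongrightarrow> \<phi> 0 * x" using Ec' by (intro tendsto_intros)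
  then have "(\<lambda>n. \<phi> (E n) * (E n / c n)) \<longlonglongrightarrow> x" by (simp add: \<phi>_def)
  then show "(\<lambda>n. ((1 + c n * x / p n) powr p n - 1) / c n) \<longlonglongrightarrow> x"
  proof (rule Lim_transform_eventually)
    show "eventually (\<lambda>n. \<phi> (E n) * (E n / c n) = ((1 + c n * x / p n) powr p n - 1) / c n) sequentially"
      using zsmall
    proof eventually_elim
      case (elim n)
      then have "1 + z n > 0" by (auto simp: dist_real_def abs_if split: if_splits)
      then have "(1 + z n) powr p n = exp (E n)" by (simp add: powr_def E_def)
      then show ?case by (simp add: \<phi>_def z_def)
    qed
  qed
qed

context power_hill
begin

lemma order_stat_k_measurable:
  assumes "1 \<le> k n" "k n < n"
  shows "order_stat U n (k n + 1) \<in> borel_measurable M" "S_stat Q U (k n) n q \<in> borel_measurable M"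
proof -
  have os[measurable]: "order_stat U n i \<in> borel_measurable M" if "i \<in> {1..k n + 1}" for i
    using that assms by (intro borel_measurable_order_stat random_variable_U) auto
  then show V[measurable]: "order_stat U n (k n + 1) \<in> borel_measurable M" by simp
  have os': "order_stat U n i \<in> borel_measurable M" if "i \<in> {1..k n}" for i
    using that by (intro os) auto
  have "(\<lambda>\<omega>. ln (Q (1 - order_stat U n i \<omega>) / Q (1 - order_stat U n (k n + 1) \<omega>)) powr q) \<in> borel_measurable M"
    if "i \<in> {1..k n}" for i
    using os'[OF that] V by measurable
  then show "S_stat Q U (k n) n q \<in> borel_measurable M"
    unfolding S_stat_def[abs_def] by (intro borel_measurable_times borel_measurable_const borel_measurable_sum)
qed

lemma converges_in_distribution_of_rows:
  fixes h :: "nat \<Rightarrow> real \<times> real \<Rightarrow> real"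
  assumes h[measurable]: "\<And>n. h n \<in> borel_measurable (borel \<Otimes>\<^sub>M borel)"
    and rows: "\<And>x v I. row v I \<Longrightarrow>
      (\<lambda>n. prob {\<omega>\<in>space M. h n (v n, S_row v I n \<omega>) \<le> x}) \<longlonglongrightarrow> cdf std_normal_distribution x"
  shows "converges_in_distribution M
    (\<lambda>n \<omega>. h n (order_stat U n (k n + 1) \<omega>, S_stat Q U (k n) n (p n) \<omega>)) std_normal_distribution"
  unfolding converges_in_distribution_def weak_conv_m_def weak_conv_def
proof (intro allI impI)
  fix x :: real
  interpret N: real_distribution std_normal_distribution by (rule real_dist_normal_dist)
  let ?T = "\<lambda>n \<omega>. h n (order_stat U n (k n + 1) \<omega>, S_stat Q U (k n) n (p n) \<omega>)"
  have "(\<lambda>n. prob {\<omega>\<in>space M. (order_stat U n (k n + 1) \<omega>, S_stat Q U (k n) n (p n) \<omega>) \<in> {y. h n y \<le> x}})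
      \<longlonglongrightarrow> cdf std_normal_distribution x"
  proof (rule S_stat_tendsto_of_rows)
    fix n
    have "{y \<in> space (borel \<Otimes>\<^sub>M borel). h n y \<le> x} \<in> sets (borel \<Otimes>\<^sub>M borel)" by measurable
    then show "{y. h n y \<le> x} \<in> sets (borel \<Otimes>\<^sub>M borel)" by (simp add: space_pair_measure)
  qed (use rows N.cdf_nonneg N.cdf_bounded_prob in auto)
  then show "(\<lambda>n. cdf (distr M borel (?T n)) x) \<longlonglongrightarrow> cdf std_normal_distribution x"
  proof (rule Lim_transform_eventually)
    show "eventually (\<lambda>n. prob {\<omega>\<in>space M. (order_stat U n (k n + 1) \<omega>, S_stat Q U (k n) n (p n) \<omega>) \<in> {y. h n y \<le> x}}
      = cdf (distr M borel (?T n)) x) sequentially"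
      using eventually_k_less
    proof eventually_elim
      case (elim n)
      then have [measurable]: "order_stat U n (k n + 1) \<in> borel_measurable M" "S_stat Q U (k n) n (p n) \<in> borel_measurable M"
        using order_stat_k_measurable[of n] by blast+
      have "?T n \<in> borel_measurable M" by measurable
      then show ?case
        by (subst cdf_def, subst measure_distr) (auto intro!: arg_cong[where f=prob])
    qed
  qed
qed

lemma S_row_nonneg: "0 \<le> S_row v I n \<omega>"
  unfolding S_row_def by (auto intro!: divide_nonneg_nonneg sum_nonneg)

text \<open>The relative standard deviation of a row average, which is the small parameter in
  \<open>powr_threshold_tendsto\<close>. As k = exp(\<alpha>p), it vanishes because 2 ln 2 < 2 <
  \<alpha>.\<close>

lemma noise_ratio_tendsto_0:
  assumes \<alpha>: "\<alpha> > 2" and v: "filterlim v (at_right 0) sequentially"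
  shows "(\<lambda>n. sigma_fun Q (p n) (v n) / (m_fun Q (p n) (v n) * sqrt (real (k n)))) \<longlonglongrightarrow> 0"
proof -
  let ?m = "\<lambda>n. m_fun Q (p n) (v n)" and ?m2 = "\<lambda>n. m_fun Q (2 * p n) (v n)" and ?\<sigma> = "\<lambda>n. sigma_fun Q (p n) (v n)"
  have "2 * ln 2 < \<alpha>" using \<alpha> ln_2_less_1 by linarith
  then have "(\<lambda>n. ?m2 n / (?m n powr 2 * exp (\<alpha> * p n))) \<longlonglongrightarrow> 0"
    by (intro moment_ratio_tendsto_0[OF v p_top]) auto
  then have lim: "(\<lambda>n. sqrt (?m2 n / (?m n powr 2 * exp (\<alpha> * p n)))) \<longlonglongrightarrow> 0"
    using tendsto_real_sqrt by fastforce
  show ?thesis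
  proof (rule Lim_null_comparison[OF _ lim])
    show "eventually (\<lambda>n. norm (?\<sigma> n / (?m n * sqrt (real (k n)))) \<le> sqrt (?m2 n / (?m n powr 2 * exp (\<alpha> * p n)))) sequentially"
      using eventually_sigma[OF v] eventually_ge_at_top[of 1]
    proof eventually_elim
      case (elim n)
      have kn: "real (k n) = exp (\<alpha> * p n)" using elim k_exp by simp
      have "?\<sigma> n \<le> sqrt (?m2 n)" using elim by (intro real_le_rsqrt) auto
      then have "?\<sigma> n / (?m n * sqrt (real (k n))) \<le> sqrt (?m2 n) / (?m n * sqrt (real (k n)))"
        using elim by (intro divide_right_mono) auto
      also have "\<dots> = sqrt (?m2 n / (?m n powr 2 * exp (\<alpha> * p n)))"
        using elim unfolding kn by (simp add: real_sqrt_divide real_sqrt_mult powr_numeral)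
      finally show ?case using elim by simp
    qed
  qed
qed

lemma clt_random_centering:
  assumes \<alpha>: "\<alpha> > 2"
  shows "converges_in_distribution M
    (\<lambda>n \<omega>. let V = order_stat U n (k n + 1) \<omega> in
      sqrt (real (k n)) * m_fun Q (p n) V / sigma_fun Q (p n) V * p n *
      ((S_stat Q U (k n) n (p n) \<omega> / m_fun Q (p n) V) powr (1 / p n) - 1))
    std_normal_distribution"
proof -
  define h where "h n y = sqrt (real (k n)) * m_fun Q (p n) (fst y) / sigma_fun Q (p n) (fst y) * p n *
      ((snd y / m_fun Q (p n) (fst y)) powr (1 / p n) - 1)" for n and y :: "real \<times> real"
  have "converges_in_distribution M
    (\<lambda>n \<omega>. h n (order_stat U n (k n + 1) \<omega>, S_stat Q U (k n) n (p n) \<omega>)) std_normal_distribution"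
  proof (rule converges_in_distribution_of_rows)
    show "h n \<in> borel_measurable (borel \<Otimes>\<^sub>M borel)" for n unfolding h_def by measurable
    fix x v I assume row: "row v I"
    then have v: "filterlim v (at_right 0) sequentially" by (simp add: row_def)
    let ?m = "\<lambda>n. m_fun Q (p n) (v n)" and ?\<sigma> = "\<lambda>n. sigma_fun Q (p n) (v n)"
    define c where "c n = ?\<sigma> n / (?m n * sqrt (real (k n)))" for n
    have c0: "c \<longlonglongrightarrow> 0" unfolding c_def[abs_def] by (rule noise_ratio_tendsto_0[OF \<alpha> v])
    have c_pos: "eventually (\<lambda>n. 0 < c n) sequentially"
      using eventually_sigma[OF v] eventually_k_less by eventually_elim (simp add: c_def)
    note thr = powr_threshold_tendsto[OF c0 c_pos p_top, of x]
    \<comment> \<open>The inequality \<open>h n (v n, y) \<le> x\<close> solved for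
      \<open>y\<close>, using that the normalisation in \<open>h\<close> is
      \<open>1 / c n * p n\<close>.\<close>
    define s where "s n = ?m n * (1 + c n * x / p n) powr p n" for n
    have "(\<lambda>n. (s n - ?m n) * sqrt (real (k n)) / ?\<sigma> n) \<longlonglongrightarrow> x"
    proof (rule Lim_transform_eventually[OF thr(1)])
      show "eventually (\<lambda>n. ((1 + c n * x / p n) powr p n - 1) / c n = (s n - ?m n) * sqrt (real (k n)) / ?\<sigma> n) sequentially"
        using eventually_sigma[OF v] eventually_k_less
        by eventually_elim (simp add: c_def s_def field_simps)
    qed
    from row_clt[OF \<alpha> row this]
    show "(\<lambda>n. prob {\<omega>\<in>space M. h n (v n, S_row v I n \<omega>) \<le> x}) \<longlonglongrightarrow> cdf std_normal_distribution x"
    proof (rule Lim_transform_eventually)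
      show "eventually (\<lambda>n. prob {\<omega>\<in>space M. S_row v I n \<omega> \<le> s n} = prob {\<omega>\<in>space M. h n (v n, S_row v I n \<omega>) \<le> x}) sequentially"
        using eventually_sigma[OF v] c_pos p_pos thr(2)
      proof eventually_elim
        case (elim n)
        have "h n (v n, y) = 1 / c n * p n * ((y / ?m n) powr (1 / p n) - 1)" for y
          using elim by (simp add: h_def c_def)
        then have "h n (v n, S_row v I n \<omega>) \<le> x \<longleftrightarrow> S_row v I n \<omega> \<le> s n" for \<omega>
          unfolding s_def using elim by (simp only:) (intro powr_inverse_le_iff S_row_nonneg; simp)
        then show ?case by simp
      qed
    qed
  qed
  then show ?thesis by (simp add: h_def Let_def)
qed

section \<open>Consistency: weak law from below, Markov bound from above\<close>

lemma lln_row: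
  assumes \<alpha>: "\<alpha> > 1" and row: "row v I"
  shows "(\<lambda>n. prob {\<omega>\<in>space M. S_row v I n \<omega> \<le> m_fun Q (p n) (v n) / 2}) \<longlonglongrightarrow> 0"
proof -
  have v: "filterlim v (at_right 0) sequentially" and I: "\<And>n. finite (I n)" "\<And>n. I n \<subseteq> {1..}"
    and card: "eventually (\<lambda>n. card (I n) = k n) sequentially"
    using row by (auto simp: row_def)
  \<comment> \<open>\<open>r\<close> is the midpoint of 1 and \<open>b\<close>: below \<alpha>, so
    that r ln r \<le> r (r - 1) < \<alpha> (r - 1), and at most 2 for the truncation
    argument.\<close>
  define b where "b = min \<alpha> 2"
  define r where "r = (1 + b) / 2"
  have r: "1 < r" "r < \<alpha>" "r \<le> 2" using \<alpha> by (auto simp: r_def b_def min_def field_simps)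
  have "r * ln r \<le> r * (r - 1)" using r by (intro mult_left_mono ln_le_minus_one) auto
  also have "\<dots> < \<alpha> * (r - 1)" using r by (intro mult_strict_right_mono) auto
  finally have rate: "r * ln r < \<alpha> * (r - 1)" .
  define L where "L n = m_fun Q (r * p n) (v n) / (m_fun Q (p n) (v n) powr r * exp (\<alpha> * (r - 1) * p n))" for n
  have L0: "L \<longlonglongrightarrow> 0"
    unfolding L_def[abs_def] using r rate by (intro moment_ratio_tendsto_0[OF v p_top]) auto
  then have L16: "(\<lambda>n. 16 * L n) \<longlonglongrightarrow> 0" using tendsto_mult[OF tendsto_const, of L 0 _ 16] by simp
  have "eventually (\<lambda>n. L n < 1 / 4) sequentially" using L0 by (rule order_tendstoD) simp
  then have "eventually (\<lambda>n. prob {\<omega>\<in>space M. S_row v I n \<omega> \<le> m_fun Q (p n) (v n) / 2} \<le> 16 * L n) sequentially"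
    using eventually_moments[OF v] p_pos card eventually_k_less
  proof eventually_elim
    case (elim n)
    let ?X = "\<lambda>u. Y_var Q (v n) u powr p n"
    have kn: "real (k n) > 0" using elim by simp
    have pw: "?X u powr r = Y_var Q (v n) u powr (r * p n)" for u by (simp add: powr_powr mult.commute)
    have "prob {\<omega>\<in>space M. (\<Sum>i\<in>I n. ?X (U i \<omega>)) \<le> real (card (I n)) * m_fun Q (p n) (v n) / 2} \<le> 16 * L n"
    proof (rule prob_sum_U_le_half_mean[OF I, where r=r])
      show "I n \<noteq> {}" using elim by auto
      show "L n = (\<integral>u. ?X u powr r \<partial>uniform01) / (m_fun Q (p n) (v n) powr r * real (card (I n)) powr (r - 1))"
        using elim by (simp add: L_def pw m_fun_def k_powr mult_ac)
    qed (use elim r in \<open>auto simp: pw m_fun_def\<close>)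
    moreover have "S_row v I n \<omega> \<le> m_fun Q (p n) (v n) / 2 \<longleftrightarrow>
        (\<Sum>i\<in>I n. ?X (U i \<omega>)) \<le> real (card (I n)) * m_fun Q (p n) (v n) / 2" for \<omega>
      using elim kn by (simp add: S_row_def field_simps)
    ultimately show ?case by simp
  qed
  then show ?thesis
    by (rule tendsto_sandwich[OF _ _ tendsto_const L16, rotated]) simp
qed

text \<open>Upward deviations that matter exceed the mean by an exponential factor in p, so the
  first moment suffices on that side.\<close>

lemma markov_row:
  assumes row: "row v I"
  shows "eventually (\<lambda>n. \<forall>t>0. prob {\<omega>\<in>space M. t \<le> S_row v I n \<omega>} \<le> m_fun Q (p n) (v n) / t) sequentially"
proof -
  have v: "filterlim v (at_right 0) sequentially" and I: "\<And>n. finite (I n)" "\<And>n. I n \<subseteq> {1..}"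
    and card: "eventually (\<lambda>n. card (I n) = k n) sequentially"
    using row by (auto simp: row_def)
  show ?thesis
    using eventually_moments[OF v] p_pos card eventually_k_less
  proof eventually_elim
    case (elim n)
    let ?X = "\<lambda>u. Y_var Q (v n) u powr p n"
    have i1: "i \<ge> 1" if "i \<in> I n" for i using I(2)[of n] that by auto
    have int: "integrable M (\<lambda>\<omega>. ?X (U i \<omega>))" if "i \<in> I n" for i
      using elim by (subst integrable_U[OF i1[OF that], of ?X]) auto
    have "expectation (S_row v I n) = 1 / real (k n) * (\<Sum>i\<in>I n. expectation (\<lambda>\<omega>. ?X (U i \<omega>)))"
      unfolding S_row_def[abs_def] using int by simp
    also have "(\<Sum>i\<in>I n. expectation (\<lambda>\<omega>. ?X (U i \<omega>))) = (\<Sum>i\<in>I n. m_fun Q (p n) (v n))"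
      using integral_U[OF i1, of _ ?X] by (intro sum.cong) (auto simp: m_fun_def)
    also have "1 / real (k n) * \<dots> = m_fun Q (p n) (v n)" using elim by simp
    finally have E: "expectation (S_row v I n) = m_fun Q (p n) (v n)" .
    have intS: "integrable M (S_row v I n)" unfolding S_row_def[abs_def] using int by simp
    show ?case
    proof (intro allI impI)
      fix t :: real assume "t > 0"
      then show "prob {\<omega>\<in>space M. t \<le> S_row v I n \<omega>} \<le> m_fun Q (p n) (v n) / t"
        using integral_Markov_inequality_measure[OF intS, of "{}" t] S_row_nonneg E by simp
    qed
  qed
qed

text \<open>A root outside (\<gamma> - d, \<gamma> + d) puts S on the wrong side of (\<gamma>
  \<plusminus> d)\<hat>p Gamma(p + 1), which is exponentially far from the mean; factors such as 2
  or 1/2 are then irrelevant.\<close>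

lemma root_row:
  assumes \<alpha>: "\<alpha> > 1" and row: "row v I" and e: "e > 0"
  shows "(\<lambda>n. prob {\<omega>\<in>space M. e < \<bar>(S_row v I n \<omega> / Gamma (p n + 1)) powr (1 / p n) - \<gamma>\<bar>}) \<longlonglongrightarrow> 0"
proof -
  have v: "filterlim v (at_right 0) sequentially" using row by (simp add: row_def)
  note [measurable] = S_row_measurable[OF row]
  define d where "d = min e (\<gamma> / 2)"
  have d: "0 < d" "d \<le> e" "d < \<gamma>" using e \<gamma>_pos by (auto simp: d_def min_def)
  obtain v0 where v0: "0 < v0" "v0 < 1"
    "\<And>v q. 0 < v \<Longrightarrow> v < v0 \<Longrightarrow> 0 < q \<Longrightarrow> (\<gamma> - d / 2) powr q / 2 * Gamma (q + 1) \<le> m_fun Q q v"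
    "\<And>v q. 0 < v \<Longrightarrow> v < v0 \<Longrightarrow> 0 < q \<Longrightarrow> m_fun Q q v \<le> 2 * (\<gamma> + d / 2) powr q * Gamma (q + 1)"
    using moment_bounds[of "d / 2"] d by (smt (verit, best) half_gt_zero field_sum_of_halves)
  have powr0: "(\<lambda>n. a powr p n) \<longlonglongrightarrow> 0" if "0 < a" "a < 1" for a
  proof -
    have "(\<lambda>n. exp (0 - (- ln a) * p n)) \<longlonglongrightarrow> 0"
      using that by (intro exp_tendsto_0_of_rate[where L=0] p_top) auto
    then show ?thesis using that by (simp add: powr_def mult.commute)
  qed
  \<comment> \<open>The moments are known up to d/2 in the base, the event concerns d; the quotients
    of bases are below 1 and their p-th powers vanish.\<close>
  define a1 where "a1 = (\<gamma> + d / 2) / (\<gamma> + d)"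
  define a2 where "a2 = (\<gamma> - d) / (\<gamma> - d / 2)"
  have a: "0 < a1" "a1 < 1" "0 < a2" "a2 < 1" using d \<gamma>_pos by (auto simp: a1_def a2_def divide_simps)
  \<comment> \<open>One factor 1/2 comes from the lower moment bound, the other from comparing with
    half the mean.\<close>
  have "eventually (\<lambda>n. a2 powr p n < 1 / 4) sequentially"
    using powr0[OF a(3,4)] by (rule order_tendstoD) simp
  then have ev: "eventually (\<lambda>n. prob {\<omega>\<in>space M. e < \<bar>(S_row v I n \<omega> / Gamma (p n + 1)) powr (1 / p n) - \<gamma>\<bar>}
      \<le> 2 * a1 powr p n + prob {\<omega>\<in>space M. S_row v I n \<omega> \<le> m_fun Q (p n) (v n) / 2}) sequentially"
    using markov_row[OF row] p_pos eventually_at_right_0_seq[OF v v0(1)]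
  proof eventually_elim
    case (elim n)
    define G where "G = Gamma (p n + 1)"
    have G: "G > 0" using elim by (simp add: G_def Gamma_real_pos)
    define t where "t = (\<gamma> + d) powr p n * G"
    have t: "t > 0" using G d \<gamma>_pos by (simp add: t_def)
    have "{\<omega>\<in>space M. e < \<bar>(S_row v I n \<omega> / G) powr (1 / p n) - \<gamma>\<bar>} \<subseteq>
      {\<omega>\<in>space M. t \<le> S_row v I n \<omega>} \<union> {\<omega>\<in>space M. S_row v I n \<omega> \<le> m_fun Q (p n) (v n) / 2}"
    proof safe
      fix \<omega> assume \<omega>: "\<omega> \<in> space M" and far: "e < \<bar>(S_row v I n \<omega> / G) powr (1 / p n) - \<gamma>\<bar>"
        and large: "\<not> S_row v I n \<omega> \<le> m_fun Q (p n) (v n) / 2"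
      let ?z = "S_row v I n \<omega> / G"
      have z: "?z \<ge> 0" using G S_row_nonneg by simp
      have "\<not> ?z powr (1 / p n) \<le> \<gamma> - d"
      proof
        assume "?z powr (1 / p n) \<le> \<gamma> - d"
        then have "?z \<le> (\<gamma> - d) powr p n" using powr_root_le_iff(1)[OF z] d elim by simp
        also have "(\<gamma> - d) powr p n = a2 powr p n * (\<gamma> - d / 2) powr p n"
          using d by (simp add: a2_def powr_mult[symmetric])
        also have "\<dots> \<le> 1 / 4 * (\<gamma> - d / 2) powr p n"
          using elim by (intro mult_right_mono) auto
        finally have "S_row v I n \<omega> \<le> 1 / 4 * (\<gamma> - d / 2) powr p n * G"
          using G by (simp add: field_simps)
        also have "\<dots> = ((\<gamma> - d / 2) powr p n / 2 * G) / 2" by simp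
        also have "\<dots> \<le> m_fun Q (p n) (v n) / 2"
          using v0(3)[of "v n" "p n"] elim by (auto simp: G_def mult_ac)
        finally show False using large by simp
      qed
      then have "\<gamma> + d \<le> ?z powr (1 / p n)" using far d by linarith
      then have "(\<gamma> + d) powr p n \<le> ?z" using powr_root_le_iff(2)[OF z] d \<gamma>_pos elim by simp
      then show "t \<le> S_row v I n \<omega>" using G by (simp add: t_def field_simps)
    qed
    then have "prob {\<omega>\<in>space M. e < \<bar>(S_row v I n \<omega> / G) powr (1 / p n) - \<gamma>\<bar>} \<le>
      prob ({\<omega>\<in>space M. t \<le> S_row v I n \<omega>} \<union> {\<omega>\<in>space M. S_row v I n \<omega> \<le> m_fun Q (p n) (v n) / 2})"
      by (intro finite_measure_mono) measurable
    also have "\<dots> \<le> prob {\<omega>\<in>space M. t \<le> S_row v I n \<omega>} + prob {\<omega>\<in>space M. S_row v I n \<omega> \<le> m_fun Q (p n) (v n) / 2}"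
      by (intro measure_Un_le) measurable
    also have "prob {\<omega>\<in>space M. t \<le> S_row v I n \<omega>} \<le> m_fun Q (p n) (v n) / t" using elim t by blast
    also have "\<dots> \<le> 2 * (\<gamma> + d / 2) powr p n * G / t"
      using v0(4)[of "v n" "p n"] elim t by (intro divide_right_mono) (auto simp: G_def)
    also have "\<dots> = 2 * a1 powr p n"
      using G d \<gamma>_pos by (simp add: t_def a1_def powr_divide)
    finally show ?case by (simp add: G_def)
  qed
  have "(\<lambda>n. 2 * a1 powr p n + prob {\<omega>\<in>space M. S_row v I n \<omega> \<le> m_fun Q (p n) (v n) / 2}) \<longlonglongrightarrow> 2 * 0 + 0"
    by (intro tendsto_intros powr0 a lln_row[OF \<alpha> row])
  then have "(\<lambda>n. 2 * a1 powr p n + prob {\<omega>\<in>space M. S_row v I n \<omega> \<le> m_fun Q (p n) (v n) / 2}) \<longlonglongrightarrow> 0" by simp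
  from tendsto_sandwich[OF _ ev tendsto_const this] show ?thesis by simp
qed

lemma consistency:
  assumes \<alpha>: "\<alpha> > 1"
  shows "converges_in_probability M
    (\<lambda>n \<omega>. (S_stat Q U (k n) n (p n) \<omega> / Gamma (p n + 1)) powr (1 / p n)) \<gamma>"
  unfolding converges_in_probability_def
proof (intro conjI allI impI)
  show "eventually (\<lambda>n. (\<lambda>\<omega>. (S_stat Q U (k n) n (p n) \<omega> / Gamma (p n + 1)) powr (1 / p n)) \<in> borel_measurable M) sequentially"
    using eventually_k_less
  proof eventually_elim
    case (elim n)
    then have [measurable]: "S_stat Q U (k n) n (p n) \<in> borel_measurable M"
      using order_stat_k_measurable[of n] by blast
    show ?case by measurable
  qed
  fix e :: real assume e: "e > 0"
  let ?B = "\<lambda>n. {y :: real \<times> real. e < \<bar>(snd y / Gamma (p n + 1)) powr (1 / p n) - \<gamma>\<bar>}"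
  have "(\<lambda>n. prob {\<omega>\<in>space M. (order_stat U n (k n + 1) \<omega>, S_stat Q U (k n) n (p n) \<omega>) \<in> ?B n}) \<longlonglongrightarrow> 0"
  proof (rule S_stat_tendsto_of_rows)
    fix n
    have "{y \<in> space (borel \<Otimes>\<^sub>M borel :: (real \<times> real) measure). e < \<bar>(snd y / Gamma (p n + 1)) powr (1 / p n) - \<gamma>\<bar>} \<in> sets (borel \<Otimes>\<^sub>M borel)"
      by measurable
    then show "?B n \<in> sets (borel \<Otimes>\<^sub>M borel)" by (simp add: space_pair_measure)
  qed (use root_row[OF \<alpha> _ e] in auto)
  then show "(\<lambda>n. prob {\<omega>\<in>space M. e < \<bar>(S_stat Q U (k n) n (p n) \<omega> / Gamma (p n + 1)) powr (1 / p n) - \<gamma>\<bar>}) \<longlonglongrightarrow> 0"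
    by simp
qed

lemma m_lim_pos: "q > 0 \<Longrightarrow> m_lim \<gamma> q > 0"
  using \<gamma>_pos by (simp add: m_lim_def Gamma_real_pos)

text \<open>Replacing the moments at \<open>v n\<close> by the limiting ones changes the
  standardised threshold by factors tending to 1 and by the bias
  \<open>(m' n / m n - 1) / c n\<close>, which the growth condition controls. The closeness
  hypothesis is used at p for the means and at 2p for the variances.\<close>

lemma row_clt_deterministic:
  assumes \<alpha>: "\<alpha> > 2" and row: "row v I"
    and b: "b \<longlonglongrightarrow> 0" "eventually (\<lambda>n. 0 \<le> b n) sequentially"
    and close: "eventually (\<lambda>n. \<forall>q>0. exp (- b n) * m_lim \<gamma> q \<le> m_fun Q q (v n) \<and> m_fun Q q (v n) \<le> exp (b n) * m_lim \<gamma> q) sequentially"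
    and \<beta>: "\<beta> < ln 2" and growth: "eventually (\<lambda>n. sqrt (real (k n)) * b n \<le> K * exp (\<beta> * p n)) sequentially"
  shows "(\<lambda>n. prob {\<omega>\<in>space M. sqrt (real (k n)) * m_lim \<gamma> (p n) / sigma_lim \<gamma> (p n) * p n *
      ((S_row v I n \<omega> / m_lim \<gamma> (p n)) powr (1 / p n) - 1) \<le> x}) \<longlonglongrightarrow> cdf std_normal_distribution x"
proof -
  have v: "filterlim v (at_right 0) sequentially" using row by (simp add: row_def)
  define m m2 \<sigma> m' m2' \<sigma>' where "m n = m_fun Q (p n) (v n)" and "m2 n = m_fun Q (2 * p n) (v n)"
    and "\<sigma> n = sigma_fun Q (p n) (v n)" and "m' n = m_lim \<gamma> (p n)" and "m2' n = m_lim \<gamma> (2 * p n)"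
    and "\<sigma>' n = sigma_lim \<gamma> (p n)" for n
  note defs = m_def m2_def \<sigma>_def m'_def m2'_def \<sigma>'_def
  have pos: "eventually (\<lambda>n. 0 < m n \<and> 0 < m2 n \<and> 0 < \<sigma> n \<and> (\<sigma> n)\<^sup>2 = m2 n - (m n)\<^sup>2 \<and> m2 n / 2 \<le> (\<sigma> n)\<^sup>2 \<and> 0 < m' n \<and> 0 < m2' n) sequentially"
    using eventually_sigma[OF v] p_pos by eventually_elim (auto simp: defs intro: m_lim_pos)
  have exp_b: "(\<lambda>n. exp (b n)) \<longlonglongrightarrow> 1" "(\<lambda>n. exp (- b n)) \<longlonglongrightarrow> 1"
    using tendsto_exp[OF b(1)] tendsto_exp[OF tendsto_minus[OF b(1)]] by simp_all
  have ratios: "eventually (\<lambda>n. exp (- b n) \<le> m n / m' n \<and> m n / m' n \<le> exp (b n) \<and>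
      exp (- b n) \<le> m2 n / m2' n \<and> m2 n / m2' n \<le> exp (b n)) sequentially"
    using close pos p_pos
  proof eventually_elim
    case (elim n)
    have "exp (- b n) * m' n \<le> m n" "m n \<le> exp (b n) * m' n"
      "exp (- b n) * m2' n \<le> m2 n" "m2 n \<le> exp (b n) * m2' n"
      using elim by (auto simp: defs)
    then show ?case using elim by (simp add: pos_le_divide_eq pos_divide_le_eq)
  qed
  have m_ratio: "(\<lambda>n. m n / m' n) \<longlonglongrightarrow> 1"
    by (rule tendsto_sandwich[OF _ _ exp_b(2,1)]; rule eventually_mono[OF ratios]) auto
  have m2_ratio: "(\<lambda>n. m2 n / m2' n) \<longlonglongrightarrow> 1"
    by (rule tendsto_sandwich[OF _ _ exp_b(2,1)]; rule eventually_mono[OF ratios]) auto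
  have sq0: "(\<lambda>n. (m n)\<^sup>2 / m2 n) \<longlonglongrightarrow> 0" unfolding defs by (rule mean_square_ratio_tendsto_0[OF v])
  have m'_ratio: "(\<lambda>n. m' n / m n) \<longlonglongrightarrow> 1"
    using tendsto_inverse[OF m_ratio] by simp
  \<comment> \<open>Carried over from the moments at \<open>v n\<close> through the two ratios,
    which avoids a separate estimate of Gamma quotients.\<close>
  have "(\<lambda>n. (m n)\<^sup>2 / m2 n * (m' n / m n)\<^sup>2 * (m2 n / m2' n)) \<longlonglongrightarrow> 0 * 1\<^sup>2 * 1"
    by (intro tendsto_intros sq0 m'_ratio m2_ratio)
  also have "0 * 1\<^sup>2 * 1 = (0::real)" by simp
  finally have sq0': "(\<lambda>n. (m' n)\<^sup>2 / m2' n) \<longlonglongrightarrow> 0"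
    by (rule Lim_transform_eventually)
      (use pos in \<open>auto elim!: eventually_mono simp: power_divide\<close>)
  have \<sigma>'_sq: "eventually (\<lambda>n. (\<sigma>' n)\<^sup>2 = m2' n - (m' n)\<^sup>2 \<and> 0 < \<sigma>' n) sequentially"
  proof -
    have "eventually (\<lambda>n. (m' n)\<^sup>2 / m2' n < 1) sequentially" using sq0' by (rule order_tendstoD) simp
    then show ?thesis using pos
    proof eventually_elim
      case (elim n)
      have "\<sigma>' n = sqrt (m2' n - (m' n)\<^sup>2)"
        using \<gamma>_pos by (simp add: defs sigma_lim_def m_lim_def power_mult_distrib right_diff_distrib powr_power mult.commute)
      then show ?case using elim by (simp add: field_simps)
    qed
  qed
  \<comment> \<open>Both variances are asymptotic to \<open>m2' n\<close>, so the standard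
    deviations are asymptotic to each other.\<close>
  have "(\<lambda>n. m2 n / m2' n - (m n)\<^sup>2 / m2 n * (m2 n / m2' n)) \<longlonglongrightarrow> 1 - 0 * 1"
    by (intro tendsto_intros m2_ratio sq0)
  also have "1 - 0 * 1 = (1::real)" by simp
  finally have \<sigma>1: "(\<lambda>n. (\<sigma> n)\<^sup>2 / m2' n) \<longlonglongrightarrow> 1"
    by (rule Lim_transform_eventually)
      (use pos in \<open>auto elim!: eventually_mono simp: diff_divide_distrib\<close>)
  have "(\<lambda>n. 1 - (m' n)\<^sup>2 / m2' n) \<longlonglongrightarrow> 1 - 0" by (intro tendsto_intros sq0')
  also have "1 - 0 = (1::real)" by simp
  finally have \<sigma>2: "(\<lambda>n. (\<sigma>' n)\<^sup>2 / m2' n) \<longlonglongrightarrow> 1"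
  proof (rule Lim_transform_eventually)
    show "eventually (\<lambda>n. 1 - (m' n)\<^sup>2 / m2' n = (\<sigma>' n)\<^sup>2 / m2' n) sequentially"
      using \<sigma>'_sq pos by eventually_elim (simp add: diff_divide_distrib)
  qed
  have "(\<lambda>n. sqrt ((\<sigma>' n)\<^sup>2 / m2' n / ((\<sigma> n)\<^sup>2 / m2' n))) \<longlonglongrightarrow> sqrt (1 / 1)"
    by (intro tendsto_intros \<sigma>1 \<sigma>2) simp
  also have "sqrt (1 / 1) = 1" by simp
  finally have \<sigma>_ratio: "(\<lambda>n. \<sigma>' n / \<sigma> n) \<longlonglongrightarrow> 1"
  proof (rule Lim_transform_eventually)
    show "eventually (\<lambda>n. sqrt ((\<sigma>' n)\<^sup>2 / m2' n / ((\<sigma> n)\<^sup>2 / m2' n)) = \<sigma>' n / \<sigma> n) sequentially"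
      using \<sigma>'_sq pos
    proof eventually_elim
      case (elim n)
      then have "0 < \<sigma>' n" "0 < \<sigma> n" "0 < m2' n" by auto
      then have "(\<sigma>' n)\<^sup>2 / m2' n / ((\<sigma> n)\<^sup>2 / m2' n) = (\<sigma>' n / \<sigma> n)\<^sup>2" "0 \<le> \<sigma>' n / \<sigma> n"
        by (simp_all add: power_divide)
      then show ?case by (simp only: real_sqrt_abs abs_of_nonneg)
    qed
  qed
  define c c' where "c n = \<sigma> n / (m n * sqrt (real (k n)))" and "c' n = \<sigma>' n / (m' n * sqrt (real (k n)))" for n
  have c0: "c \<longlonglongrightarrow> 0" unfolding c_def[abs_def] defs by (rule noise_ratio_tendsto_0[OF \<alpha> v])
  have c_pos: "eventually (\<lambda>n. 0 < c n \<and> 0 < c' n) sequentially"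
    using pos \<sigma>'_sq eventually_k_less by eventually_elim (simp add: c_def c'_def)
  have "(\<lambda>n. \<sigma>' n / \<sigma> n * (m n / m' n)) \<longlonglongrightarrow> 1 * 1" by (intro tendsto_intros \<sigma>_ratio m_ratio)
  also have "1 * 1 = (1::real)" by simp
  finally have c_ratio: "(\<lambda>n. c' n / c n) \<longlonglongrightarrow> 1"
  proof (rule Lim_transform_eventually)
    show "eventually (\<lambda>n. \<sigma>' n / \<sigma> n * (m n / m' n) = c' n / c n) sequentially"
      using pos \<sigma>'_sq eventually_k_less by eventually_elim (simp add: c_def c'_def)
  qed
  have "(\<lambda>n. c' n / c n * c n) \<longlonglongrightarrow> 1 * 0" by (intro tendsto_intros c_ratio c0)
  also have "1 * 0 = (0::real)" by simp
  finally have c'0: "c' \<longlonglongrightarrow> 0"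
    by (rule Lim_transform_eventually) (use c_pos in \<open>auto elim!: eventually_mono\<close>)
  \<comment> \<open>The bias is at most 2 b/c = 2 sqrt k b m/\<sigma>. Here sqrt k b is at most K
    exp(\<beta>p), and m/\<sigma> is at most sqrt(2 m^2/m2), of exponential rate - ln 2; hence
    \<beta> < ln 2 is what makes the product vanish.\<close>
  have bias: "(\<lambda>n. (m' n / m n - 1) / c n) \<longlonglongrightarrow> 0"
  proof (rule Lim_null_comparison)
    have "2 * \<beta> < 2 * ln 2" using \<beta> by simp
    then have "(\<lambda>n. m n powr 2 * exp (2 * \<beta> * p n) / m2 n) \<longlonglongrightarrow> 0"
      unfolding defs by (intro moment_inverse_ratio_tendsto_0[OF v p_top]) auto
    then have "(\<lambda>n. 2 * sqrt 2 * K * sqrt (m n powr 2 * exp (2 * \<beta> * p n) / m2 n)) \<longlonglongrightarrow> 2 * sqrt 2 * K * sqrt 0"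
      by (intro tendsto_intros)
    then show "(\<lambda>n. 2 * sqrt 2 * K * sqrt (m n powr 2 * exp (2 * \<beta> * p n) / m2 n)) \<longlonglongrightarrow> 0" by simp
    have "eventually (\<lambda>n. b n < 1) sequentially" using b(1) by (rule order_tendstoD) simp
    then show "eventually (\<lambda>n. norm ((m' n / m n - 1) / c n) \<le> 2 * sqrt 2 * K * sqrt (m n powr 2 * exp (2 * \<beta> * p n) / m2 n)) sequentially"
      using b(2) close pos p_pos growth c_pos eventually_k_less
    proof eventually_elim
      case (elim n)
      have lo: "exp (- b n) * m' n \<le> m n" and up: "m n \<le> exp (b n) * m' n" using elim by (auto simp: defs)
      have eb: "exp (b n) \<le> 1 + 2 * b n"
      proof -
        have "exp (b n) \<le> 1 + b n + (b n)\<^sup>2" using elim by (intro exp_bound) auto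
        also have "(b n)\<^sup>2 \<le> b n" using elim by (simp add: power2_eq_square mult_left_le)
        finally show ?thesis by simp
      qed
      have "m' n \<le> exp (b n) * m n" using lo elim by (simp add: exp_minus field_simps)
      then have "m' n / m n \<le> exp (b n)" using elim by (simp add: field_simps)
      moreover have "exp (- b n) \<le> m' n / m n" using up elim by (simp add: exp_minus field_simps)
      moreover have "1 - b n \<le> exp (- b n)" using exp_ge_add_one_self[of "- b n"] by simp
      ultimately have "\<bar>m' n / m n - 1\<bar> \<le> 2 * b n" using eb elim by (simp add: abs_le_iff)
      then have "norm ((m' n / m n - 1) / c n) \<le> 2 * b n / c n"
        using elim by (simp add: abs_divide divide_right_mono)
      also have "\<dots> = 2 * (sqrt (real (k n)) * b n) * (m n / \<sigma> n)" using elim by (simp add: c_def)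
      also have "\<dots> \<le> 2 * (K * exp (\<beta> * p n)) * (m n / \<sigma> n)"
        using elim by (intro mult_right_mono mult_left_mono) auto
      also have "\<dots> \<le> 2 * (K * exp (\<beta> * p n)) * (sqrt 2 * (m n / sqrt (m2 n)))"
      proof (rule mult_left_mono)
        have "sqrt (m2 n / 2) \<le> \<sigma> n" using elim by (intro real_le_lsqrt) auto
        then have "m n / \<sigma> n \<le> m n / sqrt (m2 n / 2)" using elim by (intro divide_left_mono) auto
        then show "m n / \<sigma> n \<le> sqrt 2 * (m n / sqrt (m2 n))" by (simp add: real_sqrt_divide mult.commute)
        have "0 \<le> sqrt (real (k n)) * b n" using elim by simp
        also have "\<dots> \<le> K * exp (\<beta> * p n)" using elim by simp
        finally show "0 \<le> 2 * (K * exp (\<beta> * p n))" by simp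
      qed
      also have "\<dots> = 2 * sqrt 2 * K * sqrt (m n powr 2 * exp (2 * \<beta> * p n) / m2 n)"
      proof -
        have "exp (2 * \<beta> * p n) = (exp (\<beta> * p n))\<^sup>2" by (simp add: power2_eq_square exp_add[symmetric])
        then show ?thesis using elim by (simp add: real_sqrt_divide real_sqrt_mult powr_numeral)
      qed
      finally show ?case .
    qed
  qed
  note thr = powr_threshold_tendsto[OF c'0 _ p_top, of x]
  have c'_pos: "eventually (\<lambda>n. 0 < c' n) sequentially" using c_pos by (auto elim: eventually_mono)
  define s where "s n = m' n * (1 + c' n * x / p n) powr p n" for n
  \<comment> \<open>Splits the standardised threshold: with \<tau> the p-th power, (m'/m \<tau> -
    1)/c is m'/m (\<tau> - 1)/c plus (m'/m - 1)/c, and the first term is expanded in c'.\<close>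
  have "(\<lambda>n. m' n / m n * (((1 + c' n * x / p n) powr p n - 1) / c' n) * (c' n / c n) + (m' n / m n - 1) / c n) \<longlonglongrightarrow> 1 * x * 1 + 0"
    by (intro tendsto_intros m'_ratio thr(1) c'_pos c_ratio bias)
  also have "1 * x * 1 + 0 = x" by simp
  finally have "(\<lambda>n. (s n - m n) * sqrt (real (k n)) / \<sigma> n) \<longlonglongrightarrow> x"
  proof (rule Lim_transform_eventually)
    show "eventually (\<lambda>n. m' n / m n * (((1 + c' n * x / p n) powr p n - 1) / c' n) * (c' n / c n) + (m' n / m n - 1) / c n
      = (s n - m n) * sqrt (real (k n)) / \<sigma> n) sequentially"
      using pos c_pos eventually_k_less
    proof eventually_elim
      case (elim n)
      let ?t = "(1 + c' n * x / p n) powr p n"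
      have "m' n / m n * ((?t - 1) / c' n) * (c' n / c n) + (m' n / m n - 1) / c n = (m' n / m n * ?t - 1) / c n"
        using elim by (simp add: field_simps)
      also have "\<dots> = (s n - m n) * sqrt (real (k n)) / \<sigma> n"
        using elim by (simp add: c_def s_def field_simps)
      finally show ?case .
    qed
  qed
  from row_clt[OF \<alpha> row this[unfolded m_def \<sigma>_def]]
  show ?thesis
  proof (rule Lim_transform_eventually)
    show "eventually (\<lambda>n. prob {\<omega>\<in>space M. S_row v I n \<omega> \<le> s n} =
        prob {\<omega>\<in>space M. sqrt (real (k n)) * m_lim \<gamma> (p n) / sigma_lim \<gamma> (p n) * p n *
          ((S_row v I n \<omega> / m_lim \<gamma> (p n)) powr (1 / p n) - 1) \<le> x}) sequentially"
      using pos c_pos p_pos thr(2)[OF c'_pos]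
    proof eventually_elim
      case (elim n)
      have eq: "sqrt (real (k n)) * m_lim \<gamma> (p n) / sigma_lim \<gamma> (p n) = 1 / c' n"
        by (simp add: c'_def m'_def \<sigma>'_def)
      have "1 / c' n * p n * ((S_row v I n \<omega> / m' n) powr (1 / p n) - 1) \<le> x \<longleftrightarrow> S_row v I n \<omega> \<le> s n" for \<omega>
        unfolding s_def using elim by (intro powr_inverse_le_iff S_row_nonneg) auto
      then show ?case unfolding eq by (simp add: m'_def)
    qed
  qed
qed

end

section \<open>Second-order condition and deterministic centering\<close>

lemma regularly_varying_pos:
  assumes "regularly_varying_at_0 a \<rho>"
  shows "eventually (\<lambda>v. 0 < a v) (at_right 0)"
  using assms unfolding regularly_varying_at_0_def eventually_at_right_field by fastforce

text \<open>
  Since the oscillation bound holds for all \<open>u \<in> (0, 1]\<close>, the values of \<open>l\<close> at \<open>u v\<close> and \<open>v\<close> can both be compared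
  with \<open>l w\<close>. Thus \<open>a\<close> is needed only at the deterministic point \<open>w\<close>, and no uniform convergence theorem
  for the merely measurable function \<open>a\<close> is required.
\<close>

lemma (in regular_tail) second_order_moments:
  assumes a: "regularly_varying_at_0 a \<rho>"
    and osc: "Limsup (at_right 0) (\<lambda>v. SUP u\<in>{0<..1}. ereal (\<bar>l (u * v) - l v\<bar> / a v)) < \<infinity>"
    and small: "((\<lambda>v. a v / l v) \<longlongrightarrow> 0) (at_right 0)"
  obtains C \<delta> where "0 < C" "0 < \<delta>" "\<And>w. 0 < w \<Longrightarrow> w < \<delta> \<Longrightarrow> 0 \<le> C * (a w / l w)"
    "\<And>v w q. 0 < v \<Longrightarrow> v \<le> w \<Longrightarrow> w < \<delta> \<Longrightarrow> 0 < q \<Longrightarrow>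
      exp (- (C * (a w / l w))) * m_lim \<gamma> q \<le> m_fun Q q v \<and> m_fun Q q v \<le> exp (C * (a w / l w)) * m_lim \<gamma> q"
proof -
  obtain N :: nat where "Limsup (at_right 0) (\<lambda>v. SUP u\<in>{0<..1}. ereal (\<bar>l (u * v) - l v\<bar> / a v)) < ereal (real N)"
    using less_PInf_Ex_of_nat[THEN iffD1, OF less_imp_neq[OF osc]] by (elim exE)
  then have "eventually (\<lambda>v. (SUP u\<in>{0<..1}. ereal (\<bar>l (u * v) - l v\<bar> / a v)) < ereal (real N)) (at_right 0)"
    by (rule Limsup_lessD)
  then have ev_osc: "eventually (\<lambda>v. \<forall>u\<in>{0<..1}. \<bar>l (u * v) - l v\<bar> / a v < real N) (at_right 0)"
    by (rule eventually_mono) (auto dest: SUP_lessD)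
  \<comment> \<open>Adding 1 keeps the constant positive even for \<open>N = 0\<close>, as it
    appears in a denominator next.\<close>
  define C0 where "C0 = real N + 1"
  have C0: "C0 > 0" by (simp add: C0_def)
  \<comment> \<open>The 8 gives \<open>C0 * a w \<le> l w / 8\<close>, hence
    \<open>l w / 2 \<le> l v\<close>, and makes the relative error \<open>\<theta>\<close> at most
    1/2, where the logarithm is bounded linearly.\<close>
  have ev_small: "eventually (\<lambda>v. a v / l v < 1 / (8 * C0)) (at_right 0)"
    using small C0 by (intro order_tendstoD) auto
  obtain \<delta>0 where \<delta>0: "0 < \<delta>0" "\<delta>0 \<le> 1" "\<And>s. 0 < s \<Longrightarrow> s < \<delta>0 \<Longrightarrow> 0 < l s" "\<And>s. 0 < s \<Longrightarrow> s < \<delta>0 \<Longrightarrow> 0 < Q (1 - s)"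
    using l_pos by blast
  obtain \<delta>1 where \<delta>1: "0 < \<delta>1" "\<And>w. 0 < w \<Longrightarrow> w < \<delta>1 \<Longrightarrow> (\<forall>u\<in>{0<..1}. \<bar>l (u * w) - l w\<bar> / a w < real N) \<and> 0 < a w \<and> a w / l w < 1 / (8 * C0)"
    using eventually_conj[OF ev_osc eventually_conj[OF regularly_varying_pos[OF a] ev_small]]
    unfolding eventually_at_right_field by blast
  define \<delta> where "\<delta> = min \<delta>0 \<delta>1"
  define C where "C = 8 * C0 / \<gamma>"
  have C: "C > 0" using C0 \<gamma>_pos by (simp add: C_def)
  have nonneg: "0 \<le> C * (a w / l w)" if "0 < w" "w < \<delta>" for w
    using C \<delta>0(3)[of w] \<delta>1(2)[of w] that by (simp add: \<delta>_def less_imp_le)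
  have osc_w: "\<bar>l x - l w\<bar> \<le> C0 * a w" if "0 < x" "x \<le> w" "w < \<delta>" for x w
  proof -
    have w: "0 < w" "w < \<delta>1" using that by (auto simp: \<delta>_def)
    have "x / w \<in> {0<..1}" using that w by simp
    then have "\<bar>l (x / w * w) - l w\<bar> / a w < real N" "0 < a w" using \<delta>1(2)[OF w] by blast+
    then have "\<bar>l x - l w\<bar> < real N * a w" using w by (simp add: field_simps)
    also have "\<dots> \<le> C0 * a w" using \<open>0 < a w\<close> by (simp add: C0_def)
    finally show ?thesis by simp
  qed
  show ?thesis
  proof (rule that[of C \<delta>])
    fix v w q assume v: "0 < v" "v \<le> w" and w: "w < \<delta>" and q: "0 < (q::real)"
    define A where "A = a w / l w"
    have w0: "0 < w" "w < \<delta>0" "w < \<delta>1" "w < 1" using v w \<delta>0 by (auto simp: \<delta>_def)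
    have lw: "0 < l w" and lv: "0 < l v" using \<delta>0(3) v w0 by auto
    have A: "0 < A" "A < 1 / (8 * C0)" using \<delta>1(2)[OF w0(1,3)] lw by (auto simp: A_def)
    have aw: "a w = A * l w" using lw by (simp add: A_def)
    have "C0 * a w \<le> l w / 8"
    proof -
      have "C0 * A \<le> 1 / 8" using A C0 by (simp add: field_simps)
      then have "C0 * A * l w \<le> 1 / 8 * l w" using lw by (intro mult_right_mono) auto
      then show ?thesis by (simp add: aw)
    qed
    then have lv_half: "l w / 2 \<le> l v" using osc_w[OF v w] lw by linarith
    \<comment> \<open>Comparing \<open>u * v\<close> and \<open>v\<close> with \<open>w\<close>
      costs \<open>2 * C0 * a w\<close>, that is \<open>\<theta> * (l w / 2)\<close>, at most
      \<open>\<theta> * l v\<close>; so \<open>\<theta>\<close> bounds the relative oscillation of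
      \<open>l\<close> at \<open>v\<close>.\<close>
    define \<theta> where "\<theta> = 4 * C0 * A"
    have \<theta>: "0 \<le> \<theta>" "\<theta> \<le> 1 / 2" using A C0 by (auto simp: \<theta>_def field_simps)
    \<comment> \<open>\<open>Y_var Q v u\<close> is \<gamma> times - ln u up to a logarithmic error
      \<open>2 * \<theta>\<close>, which amounts to a shift by
      \<open>2 * \<theta> / \<gamma>\<close>. The constant \<open>C\<close> is chosen to make this
      equal to \<open>C * (a w / l w)\<close>.\<close>
    define b where "b = 2 * \<theta> / \<gamma>"
    have b: "b \<ge> 0" using \<theta> \<gamma>_pos by (simp add: b_def)
    have Y: "\<gamma> * max 0 (- ln u - b) \<le> Y_var Q v u \<and> Y_var Q v u \<le> \<gamma> * (- ln u + b)" if u: "0 < u" "u < 1" for u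
    proof -
      have "u * v \<le> 1 * v" using u v by (intro mult_right_mono) auto
      then have uv: "0 < u * v" "u * v \<le> v" "u * v \<le> w" "u * v < 1"
        using u v w0 by (simp, linarith+)
      have luv: "0 < l (u * v)" using \<delta>0(3) uv w0 by auto
      have "\<bar>l (u * v) - l v\<bar> \<le> 2 * (C0 * a w)" using osc_w[OF uv(1,3) w] osc_w[OF v w] by linarith
      also have "\<dots> = \<theta> * (l w / 2)" by (simp add: \<theta>_def aw)
      also have "\<dots> \<le> \<theta> * l v" using lv_half \<theta> by (intro mult_left_mono) auto
      finally have "\<bar>l (u * v) / l v - 1\<bar> \<le> \<theta>" using lv by (simp add: abs_le_iff field_simps)
      then have z: "\<bar>l (u * v) / l v - 1\<bar> \<le> \<theta>" (is "\<bar>?z\<bar> \<le> \<theta>") .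
      have ln_z: "\<bar>ln (1 + ?z) - ?z\<bar> \<le> 2 * ?z\<^sup>2" using z \<theta> by (intro abs_ln_one_plus_x_minus_x_bound) auto
      have "2 * y\<^sup>2 \<le> \<bar>y\<bar>" if "\<bar>y\<bar> \<le> 1 / 2" for y :: real
        using mult_right_mono[OF that abs_ge_zero[of y]] unfolding power2_eq_square abs_mult_self_eq by linarith
      then have "2 * ?z\<^sup>2 \<le> \<bar>?z\<bar>" using z \<theta> by (meson order.trans)
      with ln_z have "\<bar>ln (1 + ?z)\<bar> \<le> 2 * \<theta>" using z by linarith
      then have ln_l: "\<bar>ln (l (u * v) / l v)\<bar> \<le> 2 * \<theta>" by simp
      have Y_eq: "Y_var Q v u = \<gamma> * (- ln u) + ln (l (u * v) / l v)"
        unfolding Y_var_def using uv v w0 lv luv u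
        by (simp add: Q_tail ln_mult ln_div ln_powr algebra_simps)
      have "Q (1 - v) \<le> Q (1 - u * v)" using uv v w0 by (intro Q_antimono) auto
      then have "1 \<le> Q (1 - u * v) / Q (1 - v)" using \<delta>0(4)[of v] v w0 by simp
      then have Y0: "0 \<le> Y_var Q v u" unfolding Y_var_def by simp
      have \<gamma>b: "\<gamma> * b = 2 * \<theta>" using \<gamma>_pos by (simp add: b_def)
      have "\<gamma> * (- ln u - b) \<le> Y_var Q v u" "Y_var Q v u \<le> \<gamma> * (- ln u + b)"
        unfolding Y_eq right_diff_distrib distrib_left \<gamma>b using ln_l by linarith+
      with Y0 show ?thesis by (simp add: max_def)
    qed
    have bC: "b = C * (a w / l w)" by (simp add: b_def \<theta>_def C_def A_def mult_ac)
    note B = powr_moment_bounds[OF Y_var_measurable q b, of \<gamma> \<gamma> v]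
    show "exp (- (C * (a w / l w))) * m_lim \<gamma> q \<le> m_fun Q q v \<and> m_fun Q q v \<le> exp (C * (a w / l w)) * m_lim \<gamma> q"
      unfolding bC[symmetric] m_fun_def m_lim_def using B(2,3) Y \<gamma>_pos by (simp add: mult_ac)
  qed (use C nonneg \<delta>0 \<delta>1 in \<open>auto simp: \<delta>_def\<close>)
qed

lemma (in power_hill) clt_deterministic_centering:
  assumes \<alpha>: "\<alpha> > 2" and a: "regularly_varying_at_0 a \<rho>"
    and osc: "Limsup (at_right 0) (\<lambda>v. SUP u\<in>{0<..1}. ereal (\<bar>l (u * v) - l v\<bar> / a v)) < \<infinity>"
    and small: "((\<lambda>v. a v / l v) \<longlongrightarrow> 0) (at_right 0)"
    and growth: "limsup (\<lambda>n. ereal (1 / p n * ln (sqrt (real (k n)) *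
             (a (real (k n) / real n) / l (real (k n) / real n))))) < ereal (ln 2)"
  shows "converges_in_distribution M
         (\<lambda>n \<omega>. sqrt (real (k n)) * m_lim \<gamma> (p n) / sigma_lim \<gamma> (p n) * p n *
            ((S_stat Q U (k n) n (p n) \<omega> / m_lim \<gamma> (p n)) powr (1 / p n) - 1))
         std_normal_distribution"
proof -
  obtain C \<delta> where C: "0 < C" and \<delta>: "0 < \<delta>" and nonneg: "\<And>w. 0 < w \<Longrightarrow> w < \<delta> \<Longrightarrow> 0 \<le> C * (a w / l w)"
    and close: "\<And>v w q. 0 < v \<Longrightarrow> v \<le> w \<Longrightarrow> w < \<delta> \<Longrightarrow> 0 < q \<Longrightarrow>
      exp (- (C * (a w / l w))) * m_lim \<gamma> q \<le> m_fun Q q v \<and> m_fun Q q v \<le> exp (C * (a w / l w)) * m_lim \<gamma> q"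
    using second_order_moments[OF a osc small] by blast
  define b where "b n = C * (a (w n) / l (w n))" for n
  define t where "t n = real (k n) / real n" for n
  have w_t: "w n = 2 * t n" for n by (simp add: w_def t_def)
  have t_pos: "eventually (\<lambda>n. 0 < t n) sequentially"
    using eventually_k_less by eventually_elim (simp add: t_def)
  have t_right: "filterlim t (at_right 0) sequentially"
    using k_ratio[folded t_def] t_pos by (auto simp: filterlim_at elim!: eventually_mono)
  have w_right: "filterlim w (at_right 0) sequentially"
    using w_tendsto t_pos by (auto simp: filterlim_at w_t elim!: eventually_mono)
  have "(\<lambda>n. C * (a (w n) / l (w n))) \<longlonglongrightarrow> C * 0"
    by (intro tendsto_intros filterlim_compose[OF small w_right])
  then have b0: "b \<longlonglongrightarrow> 0" by (simp add: b_def[abs_def])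
  have w_ev: "eventually (\<lambda>n. 0 < w n \<and> w n < \<delta>) sequentially"
    by (rule eventually_at_right_0_seq[OF w_right \<delta>])
  have b_nonneg: "eventually (\<lambda>n. 0 \<le> b n) sequentially"
    using w_ev by eventually_elim (simp only: b_def nonneg)
  \<comment> \<open>Strictness of the growth condition leaves room for a fixed exponent below ln 2
    that eventually dominates.\<close>
  obtain \<beta> where \<beta>: "limsup (\<lambda>n. ereal (1 / p n * ln (sqrt (real (k n)) * (a (t n) / l (t n))))) < ereal \<beta>" "\<beta> < ln 2"
    using ereal_dense2[OF growth] unfolding t_def by auto
  \<comment> \<open>The error \<open>b\<close> lives at \<open>w\<close>, twice the point
    \<open>t\<close> of the growth condition; regular variation at ratio 2 shows that the change
    costs at most the factor \<open>2 powr \<rho> + 1\<close>.\<close>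
  have "((\<lambda>v. a (2 * v) / a v) \<longlongrightarrow> 2 powr \<rho>) (at_right 0)" "((\<lambda>v. l (2 * v) / l v) \<longlongrightarrow> 2 powr 0) (at_right 0)"
    using a slow unfolding regularly_varying_at_0_def by auto
  from this[THEN filterlim_compose[OF _ t_right]]
  have "(\<lambda>n. (a (2 * t n) / a (t n)) / (l (2 * t n) / l (t n))) \<longlonglongrightarrow> 2 powr \<rho> / 2 powr 0"
    by (intro tendsto_divide) auto
  then have ev_ratio: "eventually (\<lambda>n. (a (2 * t n) / a (t n)) / (l (2 * t n) / l (t n)) < 2 powr \<rho> + 1) sequentially"
    by (rule order_tendstoD) simp
  have ev_pos: "eventually (\<lambda>n. 0 < a (t n)) sequentially" "eventually (\<lambda>n. 0 < l (t n)) sequentially"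
    by (rule eventually_compose_filterlim[OF regularly_varying_pos[OF a] t_right],
        rule eventually_compose_filterlim[OF regularly_varying_pos[OF slow] t_right])
  have growth': "eventually (\<lambda>n. sqrt (real (k n)) * b n \<le> (C * (2 powr \<rho> + 1)) * exp (\<beta> * p n)) sequentially"
    using Limsup_lessD[OF \<beta>(1)] p_pos ev_ratio ev_pos eventually_k_less
  proof eventually_elim
    case (elim n)
    let ?A = "a (t n) / l (t n)"
    have A: "0 < sqrt (real (k n)) * ?A" using elim by simp
    have "ln (sqrt (real (k n)) * ?A) < \<beta> * p n" using elim(1,2) by (simp add: field_simps)
    then have "sqrt (real (k n)) * ?A < exp (\<beta> * p n)" using A by (metis exp_less_cancel_iff exp_ln)
    moreover have "a (w n) / l (w n) = (a (2 * t n) / a (t n)) / (l (2 * t n) / l (t n)) * ?A"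
      using elim by (simp add: w_t field_simps)
    then have "a (w n) / l (w n) \<le> (2 powr \<rho> + 1) * ?A"
      using elim by (simp only:) (intro mult_right_mono; simp)
    then have "sqrt (real (k n)) * b n \<le> sqrt (real (k n)) * (C * ((2 powr \<rho> + 1) * ?A))"
      unfolding b_def using C by (intro mult_left_mono) auto
    moreover have "sqrt (real (k n)) * (C * ((2 powr \<rho> + 1) * ?A)) = C * (2 powr \<rho> + 1) * (sqrt (real (k n)) * ?A)"
      by (simp only: mult_ac)
    moreover have "C * (2 powr \<rho> + 1) * (sqrt (real (k n)) * ?A) \<le> C * (2 powr \<rho> + 1) * exp (\<beta> * p n)"
      using C calculation(1) by (intro mult_left_mono) (auto simp: add_nonneg_nonneg)
    ultimately show ?case by linarith
  qed
  define h where "h n y = sqrt (real (k n)) * m_lim \<gamma> (p n) / sigma_lim \<gamma> (p n) * p n *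
      ((snd y / m_lim \<gamma> (p n)) powr (1 / p n) - 1)" for n and y :: "real \<times> real"
  have "converges_in_distribution M
    (\<lambda>n \<omega>. h n (order_stat U n (k n + 1) \<omega>, S_stat Q U (k n) n (p n) \<omega>)) std_normal_distribution"
  proof (rule converges_in_distribution_of_rows)
    show "h n \<in> borel_measurable (borel \<Otimes>\<^sub>M borel)" for n unfolding h_def by measurable
    fix x v I assume row: "row v I"
    then have v: "filterlim v (at_right 0) sequentially" and vw: "eventually (\<lambda>n. v n < w n) sequentially"
      by (auto simp: row_def)
    have "eventually (\<lambda>n. \<forall>q>0. exp (- b n) * m_lim \<gamma> q \<le> m_fun Q q (v n) \<and> m_fun Q q (v n) \<le> exp (b n) * m_lim \<gamma> q) sequentially"
      using eventually_at_right_0_seq[OF v zero_less_one] vw w_ev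
    proof eventually_elim
      case (elim n)
      then show ?case unfolding b_def using close[of "v n" "w n"] by auto
    qed
    from row_clt_deterministic[OF \<alpha> row b0 b_nonneg this \<beta>(2) growth']
    show "(\<lambda>n. prob {\<omega>\<in>space M. h n (v n, S_row v I n \<omega>) \<le> x}) \<longlonglongrightarrow> cdf std_normal_distribution x"
      by (simp add: h_def)
  qed
  then show ?thesis by (simp add: h_def)
qed

theorem theorem4p6:
  fixes M :: "'a measure" and U :: "nat \<Rightarrow> 'a \<Rightarrow> real"
    and D :: "real measure" and Q l :: "real \<Rightarrow> real" and \<gamma> \<alpha> :: real
    and k :: "nat \<Rightarrow> nat" and p :: "nat \<Rightarrow> real"
  assumes "prob_space M"
    and "prob_space.indep_vars M (\<lambda>_. borel) U {1..}"
    and "\<And>i. i \<ge> 1 \<Longrightarrow> distr M borel (U i) = uniform01"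
    and "\<gamma> > 0"
    and "real_distribution D" and "Q = quantile (cdf D)"
    and "\<And>s. s \<in> {0<..<1} \<Longrightarrow> Q (1 - s) = s powr (-\<gamma>) * l s"
    and "slowly_varying_at_0 l"
    and "\<And>n. n \<ge> 1 \<Longrightarrow> 1 \<le> k n \<and> k n \<le> n"
    and "filterlim k at_top sequentially"
    and "(\<lambda>n. real (k n) / real n) \<longlonglongrightarrow> 0"
    and "\<alpha> > 0"
    and "\<And>n. p n = 1 / \<alpha> * ln (real (k n))"
  shows
    "(\<alpha> > 1 \<longrightarrow>
       converges_in_probability M
         (\<lambda>n \<omega>. (S_stat Q U (k n) n (p n) \<omega> / Gamma (p n + 1)) powr (1 / p n)) \<gamma>) \<and>
     (\<alpha> > 2 \<longrightarrow>
       converges_in_distribution M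
         (\<lambda>n \<omega>. let V = order_stat U n (k n + 1) \<omega> in
            sqrt (real (k n)) * m_fun Q (p n) V / sigma_fun Q (p n) V * p n *
            ((S_stat Q U (k n) n (p n) \<omega> / m_fun Q (p n) V) powr (1 / p n) - 1))
         std_normal_distribution) \<and>
     (\<alpha> > 2 \<and>
      (\<exists>a \<rho>. regularly_varying_at_0 a \<rho> \<and>
         Limsup (at_right 0) (\<lambda>v. SUP u\<in>{0<..1}. ereal (\<bar>l (u * v) - l v\<bar> / a v)) < \<infinity> \<and>
         ((\<lambda>v. a v / l v) \<longlongrightarrow> 0) (at_right 0) \<and>
         (\<lambda>n. p n * (a (real (k n) / real n) / l (real (k n) / real n))) \<longlonglongrightarrow> 0 \<and>
         limsup (\<lambda>n. ereal (1 / p n * ln (sqrt (real (k n)) *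
             (a (real (k n) / real n) / l (real (k n) / real n))))) < ereal (ln 2)) \<longrightarrow>
       converges_in_distribution M
         (\<lambda>n \<omega>. sqrt (real (k n)) * m_lim \<gamma> (p n) / sigma_lim \<gamma> (p n) * p n *
            ((S_stat Q U (k n) n (p n) \<omega> / m_lim \<gamma> (p n)) powr (1 / p n) - 1))
         std_normal_distribution)"
proof -
  interpret power_hill M U D Q l \<gamma> k p \<alpha>
    by (intro power_hill.intro iid_uniform.intro iid_uniform_axioms.intro regular_tail.intro
      power_hill_axioms.intro assms)
  show ?thesis
    using consistency clt_random_centering clt_deterministic_centering by blast
qed

end
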